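(* Let $\xi$ be an ordinal, $p\in(1,\infty)$, and $A:X\to Y$ an operator. (i) $A\in\mathfrak{N}_{\xi,p}$ if and only if there exist constants $C,b\geqslant1$ such that for any $\sigma>0$ there exists an equivalent norm $|\cdot|$ on $Y$ such that $$b^{-1}B_Y^{|\cdot|}\subset B_Y\subset bB_Y^{|\cdot|}\quad\text{and}\quad\varrho_\xi(\sigma;A:X\to(Y,|\cdot|))\leqslant C\sigma^p.$$ (ii) $A\in\mathfrak{N}_{\xi,\infty}$ if and only if there exist $b\geqslant1$ and $\sigma>0$ such that for any $\varepsilon>0$ there exists an equivalent norm $|\cdot|$ on $Y$ such that $$b^{-1}B_Y^{|\cdot|}\subset B_Y\subset bB_Y^{|\cdot|}\quad\text{and}\quad\varrho_\xi(\sigma;A:X\to(Y,|\cdot|))\leqslant\varepsilon.$$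
   Context: Conventions. Banach spaces are over $\mathbb{R}$ or $\mathbb{C}$ (fixed); an operator is a bounded linear operator between Banach spaces; $B_X$ is the closed unit ball; $B_Y^{|\cdot|}$ is the closed unit ball of $Y$ for the norm $|\cdot|$; $\mathbb{N}=\{1,2,\ldots\}$. $\varnothing$ is the empty sequence; finite sequences are ordered by $s<t$ iff $s$ is a proper initial segment of $t$; $s\frown t$ is concatenation; for a set $T$ of nonempty finite sequences, $MAX(T)$ is the set of its maximal elements. For an ordinal $\zeta$ and a sequence of ordinals $t=(\zeta_i)_{i=1}^k$, $\zeta+t=(\zeta+\zeta_i)_{i=1}^k$, and $\zeta+G=\{\zeta+t:t\in G\}$. Trees. $\Gamma_{0,1}=\{(0)\}$; for a limit ordinal $\xi$, $\Gamma_{\xi,1}=\bigcup_{\zeta<\xi}(\omega^\zeta+\Gamma_{\zeta+1,1})$; $\Gamma_{\xi+1,1}=\bigcup_{n=1}^\infty\Gamma_{\xi,n}$; and $\Gamma_{\xi,n+1}=\{\omega^\xi n+s:s\in\Gamma_{\xi,1}\}\cup\{(\omega^\xi n+t)\frown u:t\in MAX(\Gamma_{\xi,1}),u\in\Gamma_{\xi,n}\}$ (the unions over $\zeta$ and $n$ are disjoint). Each $t\in\Gamma_{\xi,n}$ is uniquely $t=(\omega^\xi(n-1)+t_1)\frown\ldots\frown(\omega^\xi(n-i)+t_i)$ with $1\leqslant i\leqslant n$, $t_j\in\Gamma_{\xi,1}$, and $t_j\in MAX(\Gamma_{\xi,1})$ for $j<i$; $\Lambda_{\xi,n,i}$ is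 the set of $t$ with this value of $i$. Functions $\mathbb{P}_{\xi,n}:\Gamma_{\xi,n}\to[0,1]$: $\mathbb{P}_{0,1}((0))=1$; for limit $\xi$, $\mathbb{P}_{\xi,1}(\omega^\zeta+t)=\mathbb{P}_{\zeta+1,1}(t)$ for $t\in\Gamma_{\zeta+1,1}$, $\zeta<\xi$; $\mathbb{P}_{\xi+1,1}(t)=n^{-1}\mathbb{P}_{\xi,n}(t)$ for $t\in\Gamma_{\xi,n}$; $\mathbb{P}_{\xi,n+1}(\omega^\xi n+s)=\mathbb{P}_{\xi,1}(s)$ and $\mathbb{P}_{\xi,n+1}((\omega^\xi n+t)\frown u)=\mathbb{P}_{\xi,n}(u)$. For a directed set $D$, $\Gamma_{\xi,n}.D=\{(\zeta_i,u_i)_{i=1}^k:(\zeta_i)_{i=1}^k\in\Gamma_{\xi,n},u_i\in D\}$; $\Lambda_{\xi,n,i}.D$ is the set of those members with $(\zeta_i)_{i=1}^k\in\Lambda_{\xi,n,i}$, and $\mathbb{P}_{\xi,n}((\zeta_i,u_i)_{i=1}^k)=\mathbb{P}_{\xi,n}((\zeta_i)_{i=1}^k)$. A collection $(x_t)_{t\in\Gamma_{\xi,n}.D}\subset X$ is weakly null if for every $t\in\{\varnothing\}\cup\Gamma_{\xi,n}.D$ and every $\zeta$ such that $t\frown(\zeta,u)\in\Gamma_{\xi,n}.D$ for some (equivalently every) $u\in D$, the net $(x_{t\frown(\zeta,u)})_{u\in D}$ is weakly null. $D_X$ is the set of weakly open subsets of $X$ containing $0$, directed by reverse inclusion, and $\mathcal{B}^X_{\xi,n}$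 is the set of weakly null collections $(x_t)_{t\in\Gamma_{\xi,n}.D_X}\subset B_X$. Modulus. For an operator $A:X\to Y$, $\sigma\geqslant0$, $y\in Y$, let $\varrho_\xi(\sigma;y;A)=\sup\{\inf\{\|y+\sigma A\sum_{\varnothing<s\leqslant t}\mathbb{P}_{\xi,1}(s)x_s\|-1:t\in MAX(\Gamma_{\xi,1}.D_X)\}:(x_t)\in\mathcal{B}^X_{\xi,1}\}$ and $\varrho_\xi(\sigma;A)=\sup_{y\in B_Y}\varrho_\xi(\sigma;y;A)$ (and $\varrho_\xi(\sigma;A)=0$ if $Y=\{0\}$). $\varrho_\xi(\sigma;A:X\to(Y,|\cdot|))$ is the same quantity computed with $Y$ normed by $|\cdot|$. Seminorm and class. On $c_{00}$ with canonical basis $(e_i)$, $\|\sum_{i=1}^\infty a_ie_i\|_{\xi,A}=\sup\{\inf\{\|A\sum_{i=1}^na_i\sum_{\Lambda_{\xi,n,i}.D_X\ni s\leqslant t}\mathbb{P}_{\xi,n}(s)x_s\|:t\in MAX(\Gamma_{\xi,n}.D_X)\}:n\in\mathbb{N},(x_t)\in\mathcal{B}^X_{\xi,n}\}$; $\theta_{\xi,n}(A)=\|n^{-1}\sum_{i=1}^ne_i\|_{\xi,A}$. For $1<p\leqslant\infty$ and $1/p+1/q=1$, $\mathfrak{N}_{\xi,p}$ is the class of operators $A$ with $\sup_n\theta_{\xi,n}(A)n^{1/q}<\infty$. *)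

theory Defs
  imports "HOL-Analysis.Analysis" "HOL-Library.Sublist"
begin

section \<open>Ordinals\<close>

unbundle cardinal_syntax

text \<open>
  For a type \<open>'o\<close>, the type \<open>'o ordinal\<close> is well ordered with order type the successor
  cardinal of \<open>\<kappa> = |nat + 'o|\<close>, so its elements are exactly the ordinals of cardinality at
  most \<open>\<kappa>\<close>.  A statement that is polymorphic in \<open>'o\<close> therefore speaks about all ordinals.
  As the successor of an infinite cardinal is regular, each of the least elements in the definitions
  of the arithmetic operations below exists.
\<close>

typedef 'o ordinal = "Field (cardSuc |UNIV :: (nat + 'o) set| )"
proof -
  have "Field (cardSuc |UNIV :: (nat + 'o) set| ) \<noteq> {}"
    using card_of_cardSuc_finite[of "UNIV :: (nat + 'o) set"]
    by (metis finite.emptyI finite_Plus_UNIV_iff infinite_UNIV_nat)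
  then show ?thesis by blast
qed

lemma ordinal_Card_order: "Card_order (cardSuc |UNIV :: (nat + 'o) set| )"
  by (rule cardSuc_Card_order[OF card_of_Card_order])

lemma ordinal_Well_order: "Well_order (cardSuc |UNIV :: (nat + 'o) set| )"
  using ordinal_Card_order unfolding card_order_on_def by blast

lemma ordinal_infinite: "\<not> finite (Field (cardSuc |UNIV :: (nat + 'o) set| ))"
  by (simp add: card_of_cardSuc_finite)

instantiation ordinal :: (type) wellorder
begin

definition less_eq_ordinal :: "'a ordinal \<Rightarrow> 'a ordinal \<Rightarrow> bool" where
  "a \<le> b \<longleftrightarrow> (Rep_ordinal a, Rep_ordinal b) \<in> cardSuc |UNIV :: (nat + 'a) set|"

definition less_ordinal :: "'a ordinal \<Rightarrow> 'a ordinal \<Rightarrow> bool" where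
  "(a :: 'a ordinal) < b \<longleftrightarrow> a \<le> b \<and> \<not> b \<le> a"

instance
proof
  let ?r = "cardSuc |UNIV :: (nat + 'a) set|"
  note wo = ordinal_Well_order[where 'o = 'a]
  have lin: "linear_order_on (Field ?r) ?r" and wf: "wf (?r - Id)"
    using wo unfolding well_order_on_def by auto
  have refl: "refl_on (Field ?r) ?r" and trans: "trans ?r" and antisym: "antisym ?r"
    and total: "total_on (Field ?r) ?r"
    using lin unfolding linear_order_on_def partial_order_on_def preorder_on_def by auto
  fix x y z :: "'a ordinal"
  show "(x < y) = (x \<le> y \<and> \<not> y \<le> x)" by (rule less_ordinal_def)
  show le_refl: "x \<le> x"
    using refl Rep_ordinal[of x] unfolding less_eq_ordinal_def refl_on_def by blast
  show "x \<le> y \<Longrightarrow> y \<le> z \<Longrightarrow> x \<le> z"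
    using trans unfolding less_eq_ordinal_def trans_def by blast
  show as: "x \<le> y \<Longrightarrow> y \<le> x \<Longrightarrow> x = y" for x y :: "'a ordinal"
    using antisym unfolding less_eq_ordinal_def antisym_def by (meson Rep_ordinal_inject)
  show "x \<le> y \<or> y \<le> x"
    using total Rep_ordinal[of x] Rep_ordinal[of y] le_refl unfolding less_eq_ordinal_def total_on_def
    by (metis Rep_ordinal_inject)
  fix P :: "'a ordinal \<Rightarrow> bool" and a
  assume step: "\<And>x. (\<And>y. y < x \<Longrightarrow> P y) \<Longrightarrow> P x"
  have "wf (inv_image (?r - Id) Rep_ordinal)"
    using wf by (rule wf_inv_image)
  moreover have "{(x, y). x < y} \<subseteq> inv_image (?r - Id) (Rep_ordinal :: 'a ordinal \<Rightarrow> _)"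
    by (auto simp: inv_image_def less_ordinal_def less_eq_ordinal_def Rep_ordinal_inject)
  ultimately have "wf {(x, y :: 'a ordinal). x < y}"
    by (rule wf_subset)
  then show "P a"
    by (induction a rule: wf_induct_rule) (use step in auto)
qed

end

text \<open>Any function is bounded on an initial segment.\<close>

lemma ordinal_bounded:
  fixes f :: "'o ordinal \<Rightarrow> 'o ordinal"
  shows "\<exists>c. \<forall>x<b. f x < c"
proof -
  let ?r = "cardSuc |UNIV :: (nat + 'o) set|"
  let ?f = "\<lambda>u. Rep_ordinal (f (Abs_ordinal u))"
  let ?B = "?f ` underS ?r (Rep_ordinal b)"
  have ref: "(u, u) \<in> ?r" if "u \<in> Field ?r" for u
    using ordinal_Well_order[where 'o='o] that well_order_on_Field wo_rel.REFL
    by (metis refl_onD wo_rel.intro)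
  have "|underS ?r (Rep_ordinal b)| <o ?r"
    by (rule card_of_underS[OF ordinal_Card_order Rep_ordinal])
  then have "|?B| <o ?r"
    by (rule ordLeq_ordLess_trans[OF card_of_image])
  then have card: "|?B| \<le>o |UNIV :: (nat + 'o) set|"
    using cardSuc_ordLeq_ordLess[OF card_of_Card_order card_of_Card_order] by blast
  have chain: "relChain ?r (\<lambda>i. {u. (u, i) \<in> ?r})"
    using ordinal_Well_order[where 'o='o] unfolding relChain_def
    by (auto simp: order_on_defs dest: transD)
  have sub: "?B \<subseteq> (\<Union>i\<in>Field ?r. {u. (u, i) \<in> ?r})"
    using ref Rep_ordinal by auto
  have "\<exists>i\<in>Field ?r. ?B \<subseteq> {u. (u, i) \<in> ?r}"
    by (rule cardSuc_UNION[OF card_of_Card_order _ chain sub card]) (simp add: Field_card_of)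
  then obtain i where i: "i \<in> Field ?r" "?B \<subseteq> {u. (u, i) \<in> ?r}" by blast
  obtain j where j: "j \<in> Field ?r" "i \<noteq> j" "(i, j) \<in> ?r"
    using infinite_Card_order_limit[OF ordinal_Card_order ordinal_infinite i(1)] by blast
  have ij: "Abs_ordinal i < Abs_ordinal j"
    using i(1) j unfolding order.strict_iff_order
    by (simp add: less_eq_ordinal_def Abs_ordinal_inverse Abs_ordinal_inject)
  have "f x \<le> Abs_ordinal i" if "x < b" for x
  proof -
    have "Rep_ordinal x \<in> underS ?r (Rep_ordinal b)"
      using that unfolding order.strict_iff_order underS_def
      by (simp add: less_eq_ordinal_def Rep_ordinal_inject)
    then have "?f (Rep_ordinal x) \<in> ?B" by (rule imageI)
    then have "Rep_ordinal (f x) \<in> ?B" by (simp add: Rep_ordinal_inverse)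
    with i show ?thesis
      by (auto simp: less_eq_ordinal_def Abs_ordinal_inverse)
  qed
  with ij show ?thesis by (meson le_less_trans)
qed

lemma ordinal_gt_ex: "\<exists>c. (a :: 'o ordinal) < c"
proof (cases "\<exists>b. a < b")
  case False
  then have "\<forall>x. x \<le> a" by (meson not_le)
  moreover obtain j where "j \<in> Field (cardSuc |UNIV :: (nat + 'o) set| )" "Rep_ordinal a \<noteq> j"
      "(Rep_ordinal a, j) \<in> cardSuc |UNIV :: (nat + 'o) set|"
    using infinite_Card_order_limit[OF ordinal_Card_order ordinal_infinite Rep_ordinal] by blast
  then have "a \<le> Abs_ordinal j" "a \<noteq> Abs_ordinal j"
    by (auto simp: less_eq_ordinal_def Abs_ordinal_inverse)
  ultimately show ?thesis by (metis order.antisym)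
qed

instantiation ordinal :: (type) zero
begin
definition zero_ordinal :: "'a ordinal" where "(0 :: 'a ordinal) = (LEAST a. True)"
instance ..
end

definition osucc :: "'o ordinal \<Rightarrow> 'o ordinal" where
  "osucc a = (LEAST c. a < c)"

definition limit_ordinal :: "'o ordinal \<Rightarrow> bool" where
  "limit_ordinal a \<longleftrightarrow> a \<noteq> 0 \<and> (\<nexists>b. a = osucc b)"

definition opred :: "'o ordinal \<Rightarrow> 'o ordinal" where
  "opred a = (THE b. a = osucc b)"

primrec ordinal_of_nat :: "nat \<Rightarrow> 'o ordinal" where
  "ordinal_of_nat 0 = 0"
| "ordinal_of_nat (Suc n) = osucc (ordinal_of_nat n)"

definition omega :: "'o ordinal" where
  "omega = (LEAST a. limit_ordinal a)"

text \<open>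
  The usual recursions, with the successor and limit clauses merged:
  \<open>a + b\<close> is the supremum of \<open>{a} \<union> {a + b' + 1 | b' < b}\<close>,
  \<open>a * b\<close> is the supremum of \<open>{a * b' + a | b' < b}\<close> and
  \<open>\<omega>\<^sup>b\<close> is the supremum of \<open>{1} \<union> {\<omega>\<^bsup>b'\<^esup> * \<omega> | b' < b}\<close>.
\<close>

function oadd :: "'o ordinal \<Rightarrow> 'o ordinal \<Rightarrow> 'o ordinal" where
  "oadd a b = (LEAST c. a \<le> c \<and> (\<forall>b'\<in>{..<b}. oadd a b' < c))"
  by auto
termination by (relation "inv_image {(x, y). x < y} snd") (auto simp: wf)

declare oadd.simps [simp del]

instantiation ordinal :: (type) plus
begin
definition plus_ordinal :: "'a ordinal \<Rightarrow> 'a ordinal \<Rightarrow> 'a ordinal" where "(a :: 'a ordinal) + b = oadd a b"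
instance ..
end

function omult :: "'o ordinal \<Rightarrow> 'o ordinal \<Rightarrow> 'o ordinal" where
  "omult a b = (LEAST c. \<forall>b'\<in>{..<b}. omult a b' + a \<le> c)"
  by auto
termination by (relation "inv_image {(x, y). x < y} snd") (auto simp: wf)

declare omult.simps [simp del]

instantiation ordinal :: (type) times
begin
definition times_ordinal :: "'a ordinal \<Rightarrow> 'a ordinal \<Rightarrow> 'a ordinal" where "(a :: 'a ordinal) * b = omult a b"
instance ..
end

function omega_pow :: "'o ordinal \<Rightarrow> 'o ordinal" where
  "omega_pow b = (LEAST c. osucc 0 \<le> c \<and> (\<forall>b'\<in>{..<b}. omega_pow b' * omega \<le> c))"
  by auto
termination by (relation "{(x, y). x < y}") (auto simp: wf)

declare omega_pow.simps [simp del]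

lemma ordinal_zero_le [simp]: "(0 :: 'o ordinal) \<le> a"
  unfolding zero_ordinal_def by (simp add: Least_le)

lemma less_osucc [simp]: "a < osucc a"
  unfolding osucc_def using ordinal_gt_ex by (rule LeastI_ex)

lemma osucc_le_iff: "osucc a \<le> b \<longleftrightarrow> a < b"
  using less_le_trans[OF less_osucc] by (auto simp: osucc_def intro: Least_le)

lemma osucc_inject [simp]: "osucc a = osucc b \<longleftrightarrow> a = b"
  by (metis less_osucc linorder_neqE not_le osucc_le_iff)

lemma osucc_neq_0 [simp]: "osucc a \<noteq> 0"
  by (metis less_osucc not_le ordinal_zero_le)

lemma opred_osucc [simp]: "opred (osucc a) = a"
  by (auto simp: opred_def)

lemma limit_ordinal_osucc_less: "limit_ordinal a \<Longrightarrow> b < a \<Longrightarrow> osucc b < a"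
  by (metis limit_ordinal_def order.not_eq_order_implies_strict osucc_le_iff)

lemma oadd_bounds: "a \<le> a + b" "b' < b \<Longrightarrow> a + b' < a + b"
  for a b b' :: "'o ordinal"
proof -
  obtain c where c: "\<forall>b'<b. oadd a b' < c" using ordinal_bounded by blast
  have "a \<le> max a c \<and> (\<forall>b'\<in>{..<b}. oadd a b' < max a c)"
    using c by (auto simp: less_max_iff_disj)
  from LeastI[where P = "\<lambda>c. a \<le> c \<and> (\<forall>b'\<in>{..<b}. oadd a b' < c)", OF this]
  have "a \<le> oadd a b \<and> (\<forall>b'\<in>{..<b}. oadd a b' < oadd a b)"
    by (subst oadd.simps, subst (3) oadd.simps)
  then show "a \<le> a + b" "b' < b \<Longrightarrow> a + b' < a + b" by (auto simp: plus_ordinal_def)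
qed

lemma oadd_least: "a \<le> c \<Longrightarrow> (\<And>b'. b' < b \<Longrightarrow> a + b' < c) \<Longrightarrow> a + b \<le> c"
  for a b c :: "'o ordinal"
  unfolding plus_ordinal_def by (subst oadd.simps) (auto intro: Least_le)

lemma oadd_0 [simp]: "a + 0 = (a :: 'o ordinal)"
  by (intro antisym oadd_least oadd_bounds) (auto simp: not_le[symmetric])

lemma oadd_osucc [simp]: "a + osucc b = osucc (a + b)"
proof (rule antisym)
  show "a + osucc b \<le> osucc (a + b)"
  proof (rule oadd_least)
    show "a \<le> osucc (a + b)"
      using oadd_bounds(1)[of a b] less_osucc[of "a + b"] by (meson le_less_trans less_imp_le)
    show "a + b' < osucc (a + b)" if "b' < osucc b" for b'
    proof -
      have "b' \<le> b" using that osucc_le_iff by (metis not_le)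
      then have "a + b' \<le> a + b" using oadd_bounds(2) by (metis le_less order.refl)
      then show ?thesis using less_osucc by (rule le_less_trans)
    qed
  qed
  show "osucc (a + b) \<le> a + osucc b"
    by (simp add: osucc_le_iff oadd_bounds)
qed

unbundle no cardinal_syntax

section \<open>The trees and the probabilities on them\<close>

text \<open>Finite sequences are lists; \<open>strict_prefix\<close> is the tree order.\<close>

definition maximal :: "'e list set \<Rightarrow> 'e list set" where
  "maximal T = {t \<in> T. \<nexists>s. s \<in> T \<and> strict_prefix t s}"

definition shift :: "'o ordinal \<Rightarrow> 'o ordinal list \<Rightarrow> 'o ordinal list" where
  "shift z t = map (\<lambda>a. z + a) t"

text \<open>\<open>Gam \<xi> n\<close> is \<open>\<Gamma>\<^bsub>\<xi>,n\<^esub>\<close>, indexed by \<open>n \<ge> 1\<close>; \<open>Gam \<xi> 0\<close> is a dummy.\<close>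

function Gam :: "'o ordinal \<Rightarrow> nat \<Rightarrow> 'o ordinal list set" where
  "Gam \<xi> 0 = {}"
| "Gam \<xi> (Suc 0) =
     (if \<xi> = 0 then {[0]}
      else if limit_ordinal \<xi> then \<Union>\<zeta>\<in>{..<\<xi>}. shift (omega_pow \<zeta>) ` Gam (osucc \<zeta>) (Suc 0)
      else \<Union>n\<in>{1..}. Gam (opred \<xi>) n)"
| "Gam \<xi> (Suc (Suc n)) =
     {shift (omega_pow \<xi> * ordinal_of_nat (Suc n)) s | s. s \<in> Gam \<xi> (Suc 0)} \<union>
     {shift (omega_pow \<xi> * ordinal_of_nat (Suc n)) t @ u | t u.
        t \<in> maximal (Gam \<xi> (Suc 0)) \<and> u \<in> Gam \<xi> (Suc n)}"
  by pat_completeness auto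
termination
  by (relation "{(x, y). x < y} <*lex*> {(m, n). m < n}")
    (auto simp: wf limit_ordinal_osucc_less limit_ordinal_def)

declare Gam.simps [simp del]

lemma Gam_0: "Gam 0 1 = {[0]}"
  by (simp add: Gam.simps)

lemma Gam_limit:
  "limit_ordinal \<xi> \<Longrightarrow> Gam \<xi> 1 = (\<Union>\<zeta>\<in>{..<\<xi>}. shift (omega_pow \<zeta>) ` Gam (osucc \<zeta>) 1)"
  by (simp add: Gam.simps limit_ordinal_def)

lemma Gam_osucc: "Gam (osucc \<xi>) 1 = (\<Union>n\<in>{1..}. Gam \<xi> n)"
  by (simp add: Gam.simps limit_ordinal_def)

lemma Gam_Suc:
  "n \<ge> 1 \<Longrightarrow> Gam \<xi> (n + 1) =
     {shift (omega_pow \<xi> * ordinal_of_nat n) s | s. s \<in> Gam \<xi> 1} \<union>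
     {shift (omega_pow \<xi> * ordinal_of_nat n) t @ u | t u. t \<in> maximal (Gam \<xi> 1) \<and> u \<in> Gam \<xi> n}"
  by (cases n) (auto simp: Gam.simps(3))

definition Lam :: "'o ordinal \<Rightarrow> nat \<Rightarrow> nat \<Rightarrow> 'o ordinal list set" where
  "Lam \<xi> n i = {t \<in> Gam \<xi> n. 1 \<le> i \<and> i \<le> n \<and>
     (\<exists>ts. length ts = i \<and> (\<forall>j<i. ts ! j \<in> Gam \<xi> 1) \<and> (\<forall>j<i - 1. ts ! j \<in> maximal (Gam \<xi> 1)) \<and>
        t = concat (map (\<lambda>j. shift (omega_pow \<xi> * ordinal_of_nat (n - (j + 1))) (ts ! j)) [0..<i]))}"

text \<open>The graph of \<open>\<bbbP>\<^bsub>\<xi>,n\<^esub>\<close>, given by its defining equations.\<close>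

inductive Prob_graph :: "'o ordinal \<Rightarrow> nat \<Rightarrow> 'o ordinal list \<Rightarrow> real \<Rightarrow> bool" where
  zero: "Prob_graph 0 1 [0] 1"
| limit: "\<lbrakk>limit_ordinal \<xi>; \<zeta> < \<xi>; t \<in> Gam (osucc \<zeta>) 1; Prob_graph (osucc \<zeta>) 1 t r\<rbrakk>
    \<Longrightarrow> Prob_graph \<xi> 1 (shift (omega_pow \<zeta>) t) r"
| succ: "\<lbrakk>n \<ge> 1; t \<in> Gam \<xi> n; Prob_graph \<xi> n t r\<rbrakk> \<Longrightarrow> Prob_graph (osucc \<xi>) 1 t (r / real n)"
| first: "\<lbrakk>n \<ge> 1; s \<in> Gam \<xi> 1; Prob_graph \<xi> 1 s r\<rbrakk>
    \<Longrightarrow> Prob_graph \<xi> (n + 1) (shift (omega_pow \<xi> * ordinal_of_nat n) s) r"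
| later: "\<lbrakk>n \<ge> 1; t \<in> maximal (Gam \<xi> 1); u \<in> Gam \<xi> n; Prob_graph \<xi> n u r\<rbrakk>
    \<Longrightarrow> Prob_graph \<xi> (n + 1) (shift (omega_pow \<xi> * ordinal_of_nat n) t @ u) r"

definition Prob :: "'o ordinal \<Rightarrow> nat \<Rightarrow> 'o ordinal list \<Rightarrow> real" where
  "Prob \<xi> n t = (THE r. Prob_graph \<xi> n t r)"

text \<open>
  For a set \<open>T\<close> of sequences of ordinals, \<open>tree_prod T D\<close> is \<open>T.D\<close>: a sequence of pairs
  \<open>(\<zeta>\<^sub>i, u\<^sub>i)\<close> is a list of pairs.
\<close>

definition tree_prod :: "'o ordinal list set \<Rightarrow> 'd set \<Rightarrow> ('o ordinal \<times> 'd) list set" where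
  "tree_prod T D = {t. map fst t \<in> T \<and> set (map snd t) \<subseteq> D}"

section \<open>Banach spaces over the real or complex field\<close>

text \<open>
  The scalar field: a normed field over the reals that is either the real line or, for some
  \<open>i\<close> with \<open>i\<^sup>2 = -1\<close>, has every element of the form \<open>a + b i\<close> with \<open>a\<close>, \<open>b\<close> real.
  As the norm is multiplicative, it is then the usual absolute value.
\<close>

class real_or_complex = real_normed_field +
  assumes real_or_complex:
    "(\<forall>x. \<exists>a. x = scaleR a 1) \<or>
     (\<exists>i. i * i = - 1 \<and> (\<forall>x. \<exists>a b. x = scaleR a 1 + scaleR b i))"

instance real :: real_or_complex
  by standard simp

instance complex :: real_or_complex
proof
  have "x = Re x *\<^sub>R 1 + Im x *\<^sub>R \<i>" for x
    by (simp add: complex_eq_iff)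
  then show "(\<forall>x :: complex. \<exists>a. x = a *\<^sub>R 1) \<or>
      (\<exists>i :: complex. i * i = - 1 \<and> (\<forall>x. \<exists>a b. x = a *\<^sub>R 1 + b *\<^sub>R i))"
    by (metis i_squared)
qed

locale banach_over = vector_space scale
  for scale :: "'k::real_or_complex \<Rightarrow> 'x::banach \<Rightarrow> 'x" +
  assumes scale_of_real: "scale (of_real r) x = r *\<^sub>R x"
    and norm_scale: "norm (scale c x) = norm c * norm x"

lemma banach_over_real: "banach_over ((*\<^sub>R) :: real \<Rightarrow> 'x::banach \<Rightarrow> 'x)"
  by unfold_locales (auto simp: algebra_simps)

lemma banach_over_complex: "banach_over ((*) :: complex \<Rightarrow> complex \<Rightarrow> complex)"
  by unfold_locales (auto simp: algebra_simps norm_mult scaleR_conv_of_real)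

definition operator ::
  "('k::real_or_complex \<Rightarrow> 'x::real_normed_vector \<Rightarrow> 'x) \<Rightarrow> ('k \<Rightarrow> 'y::real_normed_vector \<Rightarrow> 'y) \<Rightarrow>
     ('x \<Rightarrow> 'y) \<Rightarrow> bool"
  where "operator sX sY A \<longleftrightarrow> bounded_linear A \<and> (\<forall>c x. A (sX c x) = sY c (A x))"

definition weak_topology :: "('k::real_or_complex \<Rightarrow> 'x::banach \<Rightarrow> 'x) \<Rightarrow> 'x topology" where
  "weak_topology sX = topology_generated_by {f -` U | f U. operator sX (*) f \<and> open (U :: 'k set)}"

definition D_weak :: "('k::real_or_complex \<Rightarrow> 'x::banach \<Rightarrow> 'x) \<Rightarrow> 'x set set" where
  "D_weak sX = {U. openin (weak_topology sX) U \<and> 0 \<in> U}"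

definition equivalent_norm :: "('k::real_or_complex \<Rightarrow> 'y::banach \<Rightarrow> 'y) \<Rightarrow> ('y \<Rightarrow> real) \<Rightarrow> bool" where
  "equivalent_norm sY N \<longleftrightarrow>
     (\<forall>y. 0 \<le> N y) \<and> (\<forall>y. N y = 0 \<longleftrightarrow> y = 0) \<and>
     (\<forall>y z. N (y + z) \<le> N y + N z) \<and> (\<forall>c y. N (sY c y) = norm c * N y) \<and>
     (\<exists>a>0. \<exists>b>0. \<forall>y. a * norm y \<le> N y \<and> N y \<le> b * norm y)"

definition unit_ball :: "('y \<Rightarrow> real) \<Rightarrow> 'y set" where
  "unit_ball N = {y. N y \<le> 1}"

section \<open>Weakly null collections\<close>

text \<open>
  The filter of tails of a directed set; a net indexed by \<open>D\<close> converges iff it converges along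
  this filter.
\<close>

definition tails :: "'d set \<Rightarrow> ('d \<Rightarrow> 'd \<Rightarrow> bool) \<Rightarrow> 'd filter" where
  "tails D le = (INF u\<^sub>0\<in>D. principal {u \<in> D. le u\<^sub>0 u})"

definition weakly_null ::
  "('k::real_or_complex \<Rightarrow> 'x::banach \<Rightarrow> 'x) \<Rightarrow> 'd set \<Rightarrow> ('d \<Rightarrow> 'd \<Rightarrow> bool) \<Rightarrow>
     'o ordinal \<Rightarrow> nat \<Rightarrow> (('o ordinal \<times> 'd) list \<Rightarrow> 'x) \<Rightarrow> bool"
  where "weakly_null sX D le \<xi> n x \<longleftrightarrow>
    (\<forall>t \<in> {[]} \<union> tree_prod (Gam \<xi> n) D. \<forall>\<zeta>.
       (\<exists>u\<in>D. t @ [(\<zeta>, u)] \<in> tree_prod (Gam \<xi> n) D) \<longrightarrow>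
       limitin (weak_topology sX) (\<lambda>u. x (t @ [(\<zeta>, u)])) 0 (tails D le))"

text \<open>
  Collections indexed by \<open>\<Gamma>\<^bsub>\<xi>,n\<^esub>.D\<^sub>X\<close> are total functions; their values off the index set are
  irrelevant.
\<close>

definition B_coll ::
  "('k::real_or_complex \<Rightarrow> 'x::banach \<Rightarrow> 'x) \<Rightarrow> 'o ordinal \<Rightarrow> nat \<Rightarrow>
     (('o ordinal \<times> 'x set) list \<Rightarrow> 'x) set"
  where "B_coll sX \<xi> n =
    {x. weakly_null sX (D_weak sX) (\<lambda>U V. V \<subseteq> U) \<xi> n x \<and>
        (\<forall>t \<in> tree_prod (Gam \<xi> n) (D_weak sX). x t \<in> cball 0 1)}"

section \<open>The modulus\<close>

text \<open>
  The norm \<open>N\<close> of the codomain is a parameter.  Suprema and infima are taken in the extended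
  reals.
\<close>

definition rho_at ::
  "('k::real_or_complex \<Rightarrow> 'x::banach \<Rightarrow> 'x) \<Rightarrow> 'o ordinal \<Rightarrow> real \<Rightarrow> 'y::banach \<Rightarrow> ('x \<Rightarrow> 'y) \<Rightarrow>
     ('y \<Rightarrow> real) \<Rightarrow> ereal"
  where "rho_at sX \<xi> \<sigma> y A N =
    (SUP x \<in> B_coll sX \<xi> 1. INF t \<in> maximal (tree_prod (Gam \<xi> 1) (D_weak sX)).
       ereal (N (y + \<sigma> *\<^sub>R A (\<Sum>s\<in>{s. s \<noteq> [] \<and> prefix s t}. Prob \<xi> 1 (map fst s) *\<^sub>R x s)) - 1))"

definition rho ::
  "('k::real_or_complex \<Rightarrow> 'x::banach \<Rightarrow> 'x) \<Rightarrow> 'o ordinal \<Rightarrow> real \<Rightarrow> ('x \<Rightarrow> 'y::banach) \<Rightarrow>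
     ('y \<Rightarrow> real) \<Rightarrow> ereal"
  where "rho sX \<xi> \<sigma> A N =
    (if (UNIV :: 'y set) = {0} then 0 else SUP y \<in> unit_ball N. rho_at sX \<xi> \<sigma> y A N)"

section \<open>The seminorm and the class\<close>

text \<open>Scalar sequences are functions of which only the values at indices \<open>i \<ge> 1\<close> matter.\<close>

definition xi_seminorm ::
  "('k::real_or_complex \<Rightarrow> 'x::banach \<Rightarrow> 'x) \<Rightarrow> 'o ordinal \<Rightarrow> ('x \<Rightarrow> 'y::banach) \<Rightarrow> (nat \<Rightarrow> 'k) \<Rightarrow> ereal"
  where "xi_seminorm sX \<xi> A a =
    (SUP n\<in>{1..}. SUP x \<in> B_coll sX \<xi> n. INF t \<in> maximal (tree_prod (Gam \<xi> n) (D_weak sX)).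
       ereal (norm (A (\<Sum>i=1..n. sX (a i)
         (\<Sum>s\<in>{s \<in> tree_prod (Lam \<xi> n i) (D_weak sX). prefix s t}. Prob \<xi> n (map fst s) *\<^sub>R x s)))))"

definition basis_vec :: "nat \<Rightarrow> nat \<Rightarrow> 'k::real_or_complex" where
  "basis_vec i j = (if j = i then 1 else 0)"

definition theta ::
  "('k::real_or_complex \<Rightarrow> 'x::banach \<Rightarrow> 'x) \<Rightarrow> 'o ordinal \<Rightarrow> nat \<Rightarrow> ('x \<Rightarrow> 'y::banach) \<Rightarrow> ereal"
  where "theta sX \<xi> n A = xi_seminorm sX \<xi> A (\<lambda>j. inverse (of_nat n) * (\<Sum>i=1..n. basis_vec i j))"

definition N_class ::
  "('k::real_or_complex \<Rightarrow> 'x::banach \<Rightarrow> 'x) \<Rightarrow> ('k \<Rightarrow> 'y::banach \<Rightarrow> 'y) \<Rightarrow> 'o ordinal \<Rightarrow> ereal \<Rightarrow>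
     ('x \<Rightarrow> 'y) set"
  where "N_class sX sY \<xi> p = {A. operator sX sY A \<and>
    (\<exists>q :: real. 1 / p + 1 / ereal q = 1 \<and>
       (SUP n\<in>{1..}. theta sX \<xi> n A * ereal (real n powr (1 / q))) < \<infinity>)}"

end

theory Submission
  imports Defs
begin

text \<open>
  Call a set of vectors \<open>\<xi>\<close>-large if it contains all averages
  \<open>\<Sum>\<^bsub>s \<le> t\<^esub> \<bbbP>\<^bsub>\<xi>,1\<^esub>(s) x\<^sub>s\<close>, for \<open>t\<close> maximal, of some weakly null collection in the unit ball.  Both the
  modulus \<open>\<rho>\<^sub>\<xi>\<close> and the numbers \<open>\<theta>\<^bsub>\<xi>,n\<^esub>\<close> are determined by the \<open>\<xi>\<close>-large sets: for the former, every large
  set contains a \<open>z\<close> such that \<open>y + \<sigma> A z\<close> is not much longer than \<open>1\<close>; for the latter, every \<open>n\<close>-fold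
  large set of lists contains \<open>[z\<^sub>1, \<dots>, z\<^sub>n]\<close> with \<open>A (z\<^sub>1 + \<dots> + z\<^sub>n) / n\<close> small.

  The trees and the probabilities on them are defined by recursion on \<open>\<xi>\<close>, and the large sets obey the
  corresponding recursion (lemma \<open>realizes_iff\<close>): a set is \<open>0\<close>-large iff it meets every weak
  neighbourhood of zero inside the unit ball, \<open>(\<xi> + 1)\<close>-large iff for every \<open>n\<close> it contains the means of
  an \<open>n\<close>-fold \<open>\<xi>\<close>-large set of lists, and \<open>\<xi>\<close>-large for a limit \<open>\<xi>\<close> iff it is \<open>(\<zeta> + 1)\<close>-large for
  all \<open>\<zeta> < \<xi>\<close>.  Transfinite induction then shows that large sets are partition regular: if the union of two
  sets is large, so is one of them (\<open>Large_partition_regular\<close>).  At successors this uses that means of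
  large sets are large (\<open>Large_average\<close>).

  Suppose that \<open>A\<close> is in the class, so that \<open>n\<close> steps of size \<open>\<sigma>\<close>, that is, a sum
  \<open>\<sigma> A (z\<^sub>1 + \<dots> + z\<^sub>n)\<close>, can be kept below a constant \<open>M\<close> in norm as long as \<open>n\<close> is of order \<open>\<sigma>\<^bsup>-p\<^esup>\<close>
  (any \<open>n\<close> if \<open>p = \<infinity>\<close>).  Let \<open>f\<^sub>k(y)\<close> be the supremum of the levels above which the norm
  of \<open>y + \<sigma> A (z\<^sub>1 + \<dots> + z\<^sub>k)\<close> lies on a \<open>k\<close>-fold large set.  Partition regularity makes \<open>f\<^sub>k\<close> convex, and
  \<open>\<parallel>y\<parallel> \<le> f\<^sub>k(y) \<le> \<parallel>y\<parallel> + M\<close>.  One step transforms \<open>f\<^sub>k\<close> into at most \<open>f\<^bsub>k+1\<^esub>\<close>, so by partition regularity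
  again it increases \<open>F = (f\<^sub>0 + \<dots> + f\<^bsub>n-1\<^esub>) / n\<close> by at most \<open>(f\<^sub>n - f\<^sub>0) / n \<le> M / n\<close> (\<open>F_step\<close>).  The
  Minkowski functional of \<open>{y. F y \<le> M + 1}\<close> is the required norm (\<open>exists_renorming\<close>).

  Conversely, a norm with modulus at most \<open>r\<close> at \<open>\<sigma>\<close> grows by about \<open>r\<close> at most in each of \<open>n\<close> steps which
  start at zero, so \<open>\<sigma> A (z\<^sub>1 + \<dots> + z\<^sub>n)\<close> has norm at most about \<open>1 + n r\<close> (\<open>theta_le_of_rho\<close>).
\<close>

text \<open>
  The trees \<open>\<Gamma>\<^bsub>\<xi>,1\<^esub>\<close> are indexed by the literal \<open>1\<close>, which the simplifier would turn into \<open>Suc 0\<close>.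
\<close>

declare One_nat_def [simp del]

section \<open>Ordinal arithmetic\<close>

lemma oadd_less_cancel [simp]: "a + b < a + c \<longleftrightarrow> b < c" for a b c :: "'o ordinal"
  by (metis oadd_bounds(2) not_less_iff_gr_or_eq)

lemma oadd_le_cancel [simp]: "a + b \<le> a + c \<longleftrightarrow> b \<le> c" for a b c :: "'o ordinal"
  by (metis oadd_less_cancel not_less)

lemma oadd_inj [simp]: "a + b = a + c \<longleftrightarrow> b = c" for a b c :: "'o ordinal"
  by (metis oadd_less_cancel not_less_iff_gr_or_eq)

lemma zero_oadd [simp]: "0 + a = a" for a :: "'o ordinal"
proof (induction a rule: less_induct)
  case (less a)
  show ?case
  proof (rule antisym)
    show "0 + a \<le> a" by (rule oadd_least) (use less in auto)
    show "a \<le> 0 + a"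
      by (metis less oadd_bounds(2) not_less order_less_irrefl)
  qed
qed

lemma oadd_assoc: "a + (b + c) = (a + b) + c" for a b c :: "'o ordinal"
proof (induction c rule: less_induct)
  case (less c)
  show ?case
  proof (rule antisym)
    show "a + (b + c) \<le> (a + b) + c"
    proof (rule oadd_least)
      show "a \<le> a + b + c" using oadd_bounds(1) order_trans by blast
      fix d assume d: "d < b + c"
      show "a + d < a + b + c"
      proof (cases "d < b")
        case True
        then show ?thesis by (meson oadd_bounds less_le_trans)
      next
        case False
        then obtain c' where "c' < c" "d \<le> b + c'"
          using d by (meson oadd_least not_le)
        then show ?thesis
          by (metis less oadd_bounds(2) oadd_le_cancel le_less_trans)
      qed
    qed
    show "(a + b) + c \<le> a + (b + c)"
      by (rule oadd_least) (auto simp: oadd_bounds less[symmetric])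
  qed
qed

lemma oadd_mono_left: "c \<le> d \<Longrightarrow> c + a \<le> d + a" for a c d :: "'o ordinal"
proof (induction a rule: less_induct)
  case (less a)
  show ?case
    by (rule oadd_least) (meson less oadd_bounds order_trans le_less_trans)+
qed

lemma omult_bound: "b' < b \<Longrightarrow> a * b' + a \<le> a * b" for a b b' :: "'o ordinal"
proof -
  assume "b' < b"
  obtain c where c: "\<forall>x<b. omult a x + a < c"
    using ordinal_bounded[of b "\<lambda>x. omult a x + a"] by (elim exE)
  then have "\<forall>x\<in>{..<b}. omult a x + a \<le> c" by (simp add: less_imp_le)
  from LeastI[where P = "\<lambda>c. \<forall>x\<in>{..<b}. omult a x + a \<le> c", OF this]
  have "\<forall>x\<in>{..<b}. omult a x + a \<le> omult a b"
    by (subst omult.simps[of a b])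
  with \<open>b' < b\<close> show ?thesis by (auto simp: times_ordinal_def)
qed

lemma omult_least: "(\<And>b'. b' < b \<Longrightarrow> a * b' + a \<le> c) \<Longrightarrow> a * b \<le> c" for a b c :: "'o ordinal"
  unfolding times_ordinal_def by (subst omult.simps) (auto intro: Least_le)

lemma omult_mono: "b' \<le> b \<Longrightarrow> a * b' \<le> a * b" for a b b' :: "'o ordinal"
  by (metis omult_bound oadd_bounds(1) order.order_iff_strict order_trans)

lemma omult_0 [simp]: "a * 0 = 0" for a :: "'o ordinal"
  by (intro antisym omult_least) (auto simp: not_le[symmetric])

lemma omult_osucc [simp]: "a * osucc b = a * b + a" for a b :: "'o ordinal"
proof (rule antisym)
  show "a * osucc b \<le> a * b + a"
    by (rule omult_least) (metis oadd_mono_left omult_mono osucc_le_iff not_le)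
qed (simp add: omult_bound)

lemma ex_limit_ordinal: "\<exists>a :: 'o ordinal. limit_ordinal a"
proof (rule ccontr)
  assume no: "\<not> ?thesis"
  have "a \<in> range ordinal_of_nat" for a :: "'o ordinal"
  proof (induction a rule: less_induct)
    case (less a)
    show ?case
    proof (cases "a = 0")
      case True
      then show ?thesis by (metis ordinal_of_nat.simps(1) rangeI)
    next
      case False
      then obtain b where b: "a = osucc b" using no by (auto simp: limit_ordinal_def)
      then obtain n where "b = ordinal_of_nat n" using less[of b] by auto
      then have "a = ordinal_of_nat (Suc n)" using b by simp
      then show ?thesis by blast
    qed
  qed
  then have "countable (UNIV :: 'o ordinal set)"
    by (metis UNIV_eq_I countable_image countableI_type)
  then have "countable (Rep_ordinal ` (UNIV :: 'o ordinal set))" by simp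
  then have c: "countable (Field (cardSuc (card_of (UNIV :: (nat + 'o) set))))"
    by (simp add: type_definition.Rep_range[OF type_definition_ordinal])
  have "ordLess2 (card_of (UNIV :: (nat + 'o) set)) (cardSuc (card_of (UNIV :: (nat + 'o) set)))"
    by (rule cardSuc_greater[OF card_of_Card_order])
  moreover have "ordLeq3 (cardSuc (card_of (UNIV :: (nat + 'o) set)))
      (card_of (UNIV :: nat set))"
  proof -
    obtain f :: "_ \<Rightarrow> nat" where "inj_on f (Field (cardSuc (card_of (UNIV :: (nat + 'o) set))))"
      using c unfolding countable_def by blast
    then have "ordLeq3 (card_of (Field (cardSuc (card_of (UNIV :: (nat + 'o) set)))))
        (card_of (UNIV :: nat set))"
      by (rule card_of_ordLeqI) simp
    then show ?thesis
      using card_of_Field_ordIso[OF ordinal_Card_order] ordIso_ordLeq_trans ordIso_symmetric by blast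
  qed
  moreover have "ordLeq3 (card_of (UNIV :: nat set)) (card_of (UNIV :: (nat + 'o) set))"
    by (rule card_of_ordLeqI[where f = Inl]) auto
  ultimately show False
    by (meson not_ordLess_ordLeq ordLeq_transitive)
qed

lemma ordinal_of_nat_less_omega: "ordinal_of_nat n < (omega :: 'o ordinal)"
proof -
  have lim: "limit_ordinal (omega :: 'o ordinal)"
    unfolding omega_def using ex_limit_ordinal by (rule LeastI_ex)
  show ?thesis
  proof (induction n)
    case 0
    then show ?case using lim by (auto simp: limit_ordinal_def order.not_eq_order_implies_strict)
  qed (use lim limit_ordinal_osucc_less in auto)
qed

lemma omega_pow_bounds:
  "osucc 0 \<le> omega_pow b" "b' < b \<Longrightarrow> omega_pow b' * omega \<le> omega_pow b" for b :: "'o ordinal"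
proof -
  obtain c where c: "\<forall>x<b. omega_pow x * omega < c"
    using ordinal_bounded[of b "\<lambda>x. omega_pow x * omega"] by (elim exE)
  have "osucc 0 \<le> max (osucc 0) c \<and> (\<forall>x\<in>{..<b}. omega_pow x * omega \<le> max (osucc 0) c)"
    using c by (auto simp: le_max_iff_disj)
  from LeastI[where P = "\<lambda>c. osucc 0 \<le> c \<and> (\<forall>x\<in>{..<b}. omega_pow x * omega \<le> c)", OF this]
  have "osucc 0 \<le> omega_pow b \<and> (\<forall>x\<in>{..<b}. omega_pow x * omega \<le> omega_pow b)"
    by (subst (1 2) omega_pow.simps[of b])
  then show "osucc 0 \<le> omega_pow b" "b' < b \<Longrightarrow> omega_pow b' * omega \<le> omega_pow b" by auto
qed

lemma omega_pow_mult_nat_le: "omega_pow b * ordinal_of_nat n \<le> omega_pow (osucc b)"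
  by (meson less_imp_le less_osucc omega_pow_bounds(2) omult_mono order_trans
      ordinal_of_nat_less_omega)

lemma omega_pow_mono: "b' \<le> b \<Longrightarrow> omega_pow b' \<le> omega_pow b"
proof -
  have "omega_pow b' \<le> omega_pow b' * omega" for b' :: "'o ordinal"
    using omult_mono[OF less_imp_le[OF ordinal_of_nat_less_omega[of "Suc 0"]], of "omega_pow b'"]
    by simp
  then show "b' \<le> b \<Longrightarrow> omega_pow b' \<le> omega_pow b"
    by (metis omega_pow_bounds(2) order.order_iff_strict order_trans)
qed

lemma oadd_omult_nat: "a + a * ordinal_of_nat n = a * ordinal_of_nat (Suc n)"
  by (induction n) (simp_all add: oadd_assoc)

lemma omult_nat_1 [simp]: "a * ordinal_of_nat 1 = a"
  by (simp add: One_nat_def)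

lemma ordinal_of_nat_mono: "m \<le> n \<Longrightarrow> ordinal_of_nat m \<le> ordinal_of_nat n"
  by (induction n) (auto simp: le_Suc_eq intro: order_trans[OF _ less_imp_le[OF less_osucc]])

section \<open>The trees\<close>

lemma ordinal_cases [case_names zero succ limit]:
  obtains "a = 0" | b where "a = osucc b" | "limit_ordinal a"
  by (auto simp: limit_ordinal_def)

text \<open>
  Induction along the recursion that defines the trees: \<open>\<Gamma>\<^bsub>\<xi>,1\<^esub>\<close> comes before \<open>\<Gamma>\<^bsub>\<xi>,n\<^esub>\<close> for \<open>n > 1\<close>,
  and both come before \<open>\<Gamma>\<^bsub>\<eta>,1\<^esub>\<close> for \<open>\<eta> > \<xi>\<close>.
\<close>
lemma Gam_induct [consumes 1, case_names zero limit succ step]: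
  fixes P :: "'o ordinal \<Rightarrow> nat \<Rightarrow> bool"
  assumes n: "n \<ge> 1"
    and zero: "P 0 1"
    and limit: "\<And>\<xi>. limit_ordinal \<xi> \<Longrightarrow> (\<And>\<zeta>. \<zeta> < \<xi> \<Longrightarrow> P (osucc \<zeta>) 1) \<Longrightarrow> P \<xi> 1"
    and succ: "\<And>\<xi>. (\<And>n. n \<ge> 1 \<Longrightarrow> P \<xi> n) \<Longrightarrow> P (osucc \<xi>) 1"
    and step: "\<And>\<xi> n. n \<ge> 1 \<Longrightarrow> P \<xi> 1 \<Longrightarrow> P \<xi> n \<Longrightarrow> P \<xi> (n + 1)"
  shows "P \<xi> n"
proof -
  have "\<forall>n\<ge>1. P \<xi> n" for \<xi>
  proof (induction \<xi> rule: less_induct)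
    case (less \<xi>)
    have one: "P \<xi> 1"
    proof (cases \<xi> rule: ordinal_cases)
      case z: zero
      show ?thesis unfolding z by (rule zero)
    next
      case s: (succ \<eta>)
      show ?thesis unfolding s
      proof (rule succ)
        show "P \<eta> n" if "n \<ge> 1" for n
          using less[of \<eta>] that s by simp
      qed
    next
      case l: limit
      show ?thesis
      proof (rule limit[OF l])
        show "P (osucc \<zeta>) 1" if "\<zeta> < \<xi>" for \<zeta>
          by (rule less[OF limit_ordinal_osucc_less[OF l that], rule_format, OF order_refl])
      qed
    qed
    have "P \<xi> n" if "n \<ge> 1" for n
      using that
    proof (induction n rule: dec_induct)
      case (step n)
      then show ?case using assms(5)[OF _ one, of n] by (metis Suc_eq_plus1)
    qed (rule one)
    then show ?case by blast
  qed
  then show ?thesis using n by blast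
qed

lemma shift_prefix [simp]: "prefix (shift z s) (shift z t) \<longleftrightarrow> prefix s t"
proof
  assume "prefix (shift z s) (shift z t)"
  then have "shift z s = take (length s) (shift z t)"
    by (metis append_eq_conv_conj length_map prefixE shift_def)
  then have "map ((+) z) s = map ((+) z) (take (length s) t)"
    by (simp add: shift_def take_map)
  moreover have "inj ((+) z)" by (auto simp: inj_def)
  ultimately show "prefix s t" by (metis inj_map_eq_map take_is_prefix)
qed (auto simp: shift_def map_mono_prefix)

lemma shift_inj [simp]: "shift z s = shift z t \<longleftrightarrow> s = t"
  by (metis prefix_order.eq_iff shift_prefix)

lemma shift_strict_prefix [simp]: "strict_prefix (shift z s) (shift z t) \<longleftrightarrow> strict_prefix s t"
  by (simp add: strict_prefix_def)

lemma shift_Nil [simp]: "shift z t = [] \<longleftrightarrow> t = []" "[] = shift z t \<longleftrightarrow> t = []" "shift z [] = []" by (auto simp: shift_def)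

lemma shift_0 [simp]: "shift 0 t = t" by (simp add: shift_def)

lemma hd_shift: "t \<noteq> [] \<Longrightarrow> hd (shift z t) = z + hd t" by (simp add: shift_def hd_map)

lemma prefix_shiftD: "prefix s (shift z r) \<Longrightarrow> \<exists>k. s = shift z (take k r)"
  unfolding shift_def by (metis prefix_def append_eq_conv_conj take_map)

lemma maximal_subset: "t \<in> maximal T \<Longrightarrow> t \<in> T" by (simp add: maximal_def)

lemma maximal_prefix: "t \<in> maximal T \<Longrightarrow> s \<in> T \<Longrightarrow> prefix t s \<Longrightarrow> s = t"
  by (auto simp: maximal_def strict_prefix_def)

lemma Nil_notin_Gam: "n \<ge> 1 \<Longrightarrow> [] \<notin> Gam \<xi> n"
  by (induction \<xi> n rule: Gam_induct)
    (auto simp: Gam_0 Gam_limit Gam_osucc Gam_Suc)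

lemma Gam_nonempty: "n \<ge> 1 \<Longrightarrow> Gam \<xi> n \<noteq> {}"
proof (induction \<xi> n rule: Gam_induct)
  case (limit \<xi>)
  have "0 < \<xi>" using limit(1) by (auto simp: limit_ordinal_def order.not_eq_order_implies_strict)
  then show ?case using limit by (auto simp: Gam_limit)
next
  case (step \<xi> n)
  then show ?case by (auto simp: Gam_Suc)
qed (auto simp: Gam_0 Gam_osucc)

lemma Gam_prefix: "n \<ge> 1 \<Longrightarrow> t \<in> Gam \<xi> n \<Longrightarrow> prefix s t \<Longrightarrow> s \<noteq> [] \<Longrightarrow> s \<in> Gam \<xi> n"
proof (induction \<xi> n arbitrary: s t rule: Gam_induct)
  case zero
  then show ?case by (auto simp: Gam_0 prefix_Cons)
next
  case (limit \<xi>)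
  then obtain \<zeta> r where r: "\<zeta> < \<xi>" "r \<in> Gam (osucc \<zeta>) 1" "t = shift (omega_pow \<zeta>) r"
    by (auto simp: Gam_limit)
  then obtain k where k: "s = shift (omega_pow \<zeta>) (take k r)"
    using prefix_shiftD limit(4) by blast
  then have "take k r \<in> Gam (osucc \<zeta>) 1"
    using limit(2)[OF r(1,2) take_is_prefix, of k] limit(5) by auto
  then show ?case using k r(1) unfolding Gam_limit[OF limit(1)] by blast
next
  case (succ \<xi>)
  then show ?case by (auto simp: Gam_osucc)
next
  case (step \<xi> n)
  let ?z = "omega_pow \<xi> * ordinal_of_nat n"
  have A: "\<exists>r'. s = shift ?z r' \<and> r' \<in> Gam \<xi> 1" if pr: "prefix s (shift ?z r)" "r \<in> Gam \<xi> 1" for r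
  proof -
    obtain k where k: "s = shift ?z (take k r)"
      using prefix_shiftD[OF pr(1)] by blast
    then have "take k r \<in> Gam \<xi> 1"
      using step(2)[OF pr(2) take_is_prefix, of k] step(6) by auto
    then show ?thesis using k by blast
  qed
  consider (a) r where "t = shift ?z r" "r \<in> Gam \<xi> 1" |
     (b) r u where "t = shift ?z r @ u" "r \<in> maximal (Gam \<xi> 1)" "u \<in> Gam \<xi> n"
    using step(4) Gam_Suc[OF step(1)] by blast
  then show ?case
  proof cases
    case a
    then show ?thesis using A step(5) Gam_Suc[OF step(1)] by blast
  next
    case b
    then have "prefix s (shift ?z r) \<or> (\<exists>u'. s = shift ?z r @ u' \<and> prefix u' u)"
      using step(5) by (auto simp: prefix_append)
    then show ?thesis
    proof (elim disjE exE conjE)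
      assume "prefix s (shift ?z r)"
      then show ?thesis using A[OF _ maximal_subset[OF b(2)]] Gam_Suc[OF step(1)] by blast
    next
      fix u' assume u: "s = shift ?z r @ u'" "prefix u' u"
      show ?thesis
      proof (cases "u' = []")
        case True
        then show ?thesis using u(1) maximal_subset[OF b(2)] Gam_Suc[OF step(1), of \<xi>] by auto
      next
        case False
        then have "u' \<in> Gam \<xi> n" using step(3)[OF b(3) u(2)] by blast
          then show ?thesis using u(1) b(2) Gam_Suc[OF step(1)] by blast
      qed
    qed
  qed
qed

text \<open>
  The first entries of the members of \<open>\<Gamma>\<^bsub>\<xi>,n\<^esub>\<close> lie in the interval \<open>[\<omega>\<^sup>\<xi> (n - 1), \<omega>\<^sup>\<xi> n)\<close>, so the
  unions in the definition of the trees are disjoint.  The last clause carries the induction through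
  limit ordinals: there \<open>\<omega>\<^sup>\<zeta>\<close> is added on the left to an entry of \<open>\<Gamma>\<^bsub>\<zeta>+1,1\<^esub>\<close>, and the result must
  stay below \<open>\<omega>\<^bsup>\<zeta>+1\<^esup>\<close>.
\<close>

lemma Gam_hd:
  "n \<ge> 1 \<Longrightarrow> t \<in> Gam \<xi> n \<Longrightarrow>
     omega_pow \<xi> * ordinal_of_nat (n - 1) \<le> hd t \<and> hd t < omega_pow \<xi> * ordinal_of_nat n \<and>
     (\<forall>\<zeta>. \<xi> = osucc \<zeta> \<longrightarrow> n = 1 \<longrightarrow> omega_pow \<zeta> + hd t < omega_pow \<xi>)"
proof (induction \<xi> n arbitrary: t rule: Gam_induct)
  case zero
  then show ?case using omega_pow_bounds(1)[of 0] by (auto simp: Gam_0 osucc_le_iff)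
next
  case (limit \<xi>)
  then obtain \<zeta> r where r: "\<zeta> < \<xi>" "r \<in> Gam (osucc \<zeta>) 1" "t = shift (omega_pow \<zeta>) r"
    by (auto simp: Gam_limit)
  then have ne: "r \<noteq> []" using Nil_notin_Gam by (metis order_refl)
  have "omega_pow (osucc \<zeta>) \<le> omega_pow \<xi>"
    using r by (simp add: omega_pow_mono osucc_le_iff)
  then show ?case using limit(2)[OF r(1,2)] limit(1) r ne
    by (auto simp: hd_shift limit_ordinal_def intro: less_le_trans)
next
  case (succ \<xi>)
  then obtain n where n: "n \<ge> 1" "t \<in> Gam \<xi> n" by (auto simp: Gam_osucc)
  have *: "hd t < omega_pow \<xi> * ordinal_of_nat n" using succ n by blast
  then have "omega_pow \<xi> + hd t < omega_pow \<xi> * ordinal_of_nat (Suc n)"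
    by (metis oadd_less_cancel oadd_omult_nat)
  then have "omega_pow \<xi> + hd t < omega_pow (osucc \<xi>)"
    using omega_pow_mult_nat_le less_le_trans by blast
  moreover have "hd t < omega_pow (osucc \<xi>)"
    using * omega_pow_mult_nat_le less_le_trans by blast
  ultimately show ?case by auto
next
  case (step \<xi> n)
  let ?z = "omega_pow \<xi> * ordinal_of_nat n"
  obtain r where r: "r \<in> Gam \<xi> 1" "hd t = ?z + hd r"
  proof -
    consider (a) r where "t = shift ?z r" "r \<in> Gam \<xi> 1" |
       (b) r u where "t = shift ?z r @ u" "r \<in> maximal (Gam \<xi> 1)" "u \<in> Gam \<xi> n"
      using step(4) Gam_Suc[OF step(1)] by blast
    then show ?thesis
    proof cases
      case a
      then show ?thesis using that Nil_notin_Gam[of 1 \<xi>] by (metis hd_shift order_refl)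
    next
      case b
      then show ?thesis using that Nil_notin_Gam[of 1 \<xi>]
        by (metis hd_append hd_shift maximal_subset order_refl shift_Nil(1))
    qed
  qed
  then have "hd r < omega_pow \<xi>" using step(2)[of r] by auto
  then have "hd t < ?z + omega_pow \<xi>" using r by simp
  moreover have "?z + omega_pow \<xi> = omega_pow \<xi> * ordinal_of_nat (n + 1)"
    by (metis Suc_eq_plus1 omult_osucc ordinal_of_nat.simps(2))
  ultimately show ?case using r step(1) by (auto simp: oadd_bounds)
qed

lemma Gam_hd_disjoint:
  assumes "m \<ge> 1" "n \<ge> 1" "s \<in> Gam \<xi> m" "t \<in> Gam \<xi> n" "hd s = hd t"
  shows "m = n"
proof -
  have *: "\<not> m < n" if "m \<ge> 1" "n \<ge> 1" "s \<in> Gam \<xi> m" "t \<in> Gam \<xi> n" "hd s = hd t" for m n and s t :: "'a ordinal list"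
  proof
    assume "m < n"
    then have "omega_pow \<xi> * ordinal_of_nat m \<le> omega_pow \<xi> * ordinal_of_nat (n - 1)"
      by (intro omult_mono ordinal_of_nat_mono) simp
    then show False using Gam_hd[of m s \<xi>] Gam_hd[of n t \<xi>] that by fastforce
  qed
  from *[OF assms] *[OF assms(2,1,4,3) assms(5)[symmetric]] show ?thesis by simp
qed

lemma Gam_limit_hd_disjoint:
  assumes "s \<in> Gam (osucc \<zeta>) 1" "t \<in> Gam (osucc \<eta>) 1"
    "omega_pow \<zeta> + hd s = omega_pow \<eta> + hd t"
  shows "\<zeta> = \<eta>"
proof -
  have *: "\<not> \<zeta> < \<eta>" if "s \<in> Gam (osucc \<zeta>) 1" "t \<in> Gam (osucc \<eta>) 1"
    "omega_pow \<zeta> + hd s = omega_pow \<eta> + hd t" for \<zeta> \<eta> and s t :: "'a ordinal list"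
  proof
    assume "\<zeta> < \<eta>"
    then have "omega_pow (osucc \<zeta>) \<le> omega_pow \<eta>" by (simp add: omega_pow_mono osucc_le_iff)
    then show False using Gam_hd[OF _ that(1)] that(3) oadd_bounds(1)[of "omega_pow \<eta>" "hd t"]
      by fastforce
  qed
  from *[OF assms] *[OF assms(2,1) assms(3)[symmetric]] show ?thesis by simp
qed

text \<open>
  As distinct maximal sequences are incomparable, a sequence extends at most one of them.
\<close>
lemma shift_append_decomp:
  assumes "s \<in> maximal T" "t \<in> maximal T" "shift z s @ u = shift z t @ v"
  shows "s = t \<and> u = v"
proof -
  have "prefix (shift z s) (shift z t) \<or> prefix (shift z t) (shift z s)"
    using assms(3) by (metis prefix_def prefix_same_cases)
  then have "prefix s t \<or> prefix t s" by simp
  then have "s = t" using assms(1,2) by (metis maximal_prefix maximal_subset)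
  then show ?thesis using assms(3) by simp
qed

lemma shift_append_neq:
  assumes "s \<in> T" "t \<in> maximal T" "v \<noteq> []"
  shows "shift z s \<noteq> shift z t @ v"
proof
  assume eq: "shift z s = shift z t @ v"
  then have "prefix t s" by (metis shift_prefix prefixI)
  then have "s = t" using assms(1,2) maximal_prefix by blast
  then show False using eq assms(3) by simp
qed

section \<open>The probabilities\<close>

lemma Prob_graph_zeroD: "Prob_graph \<xi> n t r \<Longrightarrow> \<xi> = 0 \<Longrightarrow> n = 1 \<Longrightarrow> r = 1"
  by (erule Prob_graph.cases) (auto simp: limit_ordinal_def)

lemma Prob_graph_limitD:
  "Prob_graph \<xi> n t r \<Longrightarrow> limit_ordinal \<xi> \<Longrightarrow> n = 1 \<Longrightarrow>
    \<exists>\<zeta><\<xi>. \<exists>s\<in>Gam (osucc \<zeta>) 1. t = shift (omega_pow \<zeta>) s \<and> Prob_graph (osucc \<zeta>) 1 s r"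
  by (erule Prob_graph.cases) (auto simp: limit_ordinal_def)

lemma Prob_graph_succD:
  "Prob_graph \<eta> m t r \<Longrightarrow> \<eta> = osucc \<xi> \<Longrightarrow> m = 1 \<Longrightarrow>
    \<exists>n\<ge>1. \<exists>r'. t \<in> Gam \<xi> n \<and> Prob_graph \<xi> n t r' \<and> r = r' / real n"
  by (erule Prob_graph.cases) (auto simp: limit_ordinal_def)

lemma Prob_graph_stepD:
  "Prob_graph \<xi> m t r \<Longrightarrow> m = n + 1 \<Longrightarrow> n \<ge> 1 \<Longrightarrow>
    (\<exists>s\<in>Gam \<xi> 1. t = shift (omega_pow \<xi> * ordinal_of_nat n) s \<and> Prob_graph \<xi> 1 s r) \<or>
    (\<exists>s\<in>maximal (Gam \<xi> 1). \<exists>u\<in>Gam \<xi> n.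
        t = shift (omega_pow \<xi> * ordinal_of_nat n) s @ u \<and> Prob_graph \<xi> n u r)"
  by (erule Prob_graph.cases) auto

text \<open>
  The defining equations determine \<open>\<bbbP>\<^bsub>\<xi>,n\<^esub>\<close>: the pieces of the unions are disjoint, so only one clause,
  with only one choice of its parameters, applies to a given sequence.
\<close>
lemma Prob_graph_ex1: "n \<ge> 1 \<Longrightarrow> t \<in> Gam \<xi> n \<Longrightarrow> \<exists>!r. Prob_graph \<xi> n t r"
proof (induction \<xi> n arbitrary: t rule: Gam_induct)
  case zero
  then have "t = [0]" by (simp add: Gam_0)
  then show ?case using Prob_graph.zero Prob_graph_zeroD[of 0 1] by blast
next
  case (limit \<xi>)
  then obtain \<zeta> s where s: "\<zeta> < \<xi>" "s \<in> Gam (osucc \<zeta>) 1" "t = shift (omega_pow \<zeta>) s"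
    by (auto simp: Gam_limit)
  from limit(2)[OF s(1,2)] obtain r where r: "Prob_graph (osucc \<zeta>) 1 s r"
    "\<And>r'. Prob_graph (osucc \<zeta>) 1 s r' \<Longrightarrow> r' = r" by blast
  have "r' = r" if pg: "Prob_graph \<xi> 1 t r'" for r'
  proof -
    obtain \<eta> q where q: "\<eta> < \<xi>" "q \<in> Gam (osucc \<eta>) 1" "t = shift (omega_pow \<eta>) q"
      "Prob_graph (osucc \<eta>) 1 q r'"
      using Prob_graph_limitD[OF pg limit(1) refl] by blast
    have ne: "s \<noteq> []" "q \<noteq> []" using s q Nil_notin_Gam[OF order_refl] by metis+
    have "\<zeta> = \<eta>"
      using Gam_limit_hd_disjoint[OF s(2) q(2)] s(3) q(3) ne by (metis hd_shift)
    then show ?thesis using s q r by simp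
  qed
  then show ?case using Prob_graph.limit[OF limit(1) s(1,2) r(1)] s(3) by blast
next
  case (succ \<xi>)
  then obtain n where n: "n \<ge> 1" "t \<in> Gam \<xi> n" by (auto simp: Gam_osucc)
  from succ(1)[OF n] obtain r where r: "Prob_graph \<xi> n t r"
    "\<And>r'. Prob_graph \<xi> n t r' \<Longrightarrow> r' = r" by blast
  have "r' = r / real n" if pg: "Prob_graph (osucc \<xi>) 1 t r'" for r'
    using Prob_graph_succD[OF pg refl refl] Gam_hd_disjoint[OF n(1) _ n(2)] r(2) by blast
  then show ?case using Prob_graph.succ[OF n r(1)] by blast
next
  case (step \<xi> n)
  let ?z = "omega_pow \<xi> * ordinal_of_nat n"
  have ne: "u \<noteq> []" if "u \<in> Gam \<xi> n" for u using that Nil_notin_Gam[OF step(1)] by metis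
  consider (a) s where "t = shift ?z s" "s \<in> Gam \<xi> 1" |
     (b) s u where "t = shift ?z s @ u" "s \<in> maximal (Gam \<xi> 1)" "u \<in> Gam \<xi> n"
    using step(4) Gam_Suc[OF step(1)] by blast
  then show ?case
  proof cases
    case a
    from step(2)[OF a(2)] obtain r where r: "Prob_graph \<xi> 1 s r"
      "\<And>r'. Prob_graph \<xi> 1 s r' \<Longrightarrow> r' = r" by blast
    have "r' = r" if pg: "Prob_graph \<xi> (n + 1) t r'" for r'
      using Prob_graph_stepD[OF pg refl step(1)] shift_append_neq[OF a(2)] ne r(2) a(1) by fastforce
    then show ?thesis using Prob_graph.first[OF step(1) a(2) r(1)] a(1) by blast
  next
    case b
    from step(3)[OF b(3)] obtain r where r: "Prob_graph \<xi> n u r"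
      "\<And>r'. Prob_graph \<xi> n u r' \<Longrightarrow> r' = r" by blast
    have "r' = r" if pg: "Prob_graph \<xi> (n + 1) t r'" for r'
      using Prob_graph_stepD[OF pg refl step(1)]
    proof (elim disjE bexE conjE)
      fix q assume "q \<in> Gam \<xi> 1" "t = shift ?z q"
      then show ?thesis using shift_append_neq[OF _ b(2) ne[OF b(3)]] b(1) by metis
    next
      fix q v assume q: "q \<in> maximal (Gam \<xi> 1)" "v \<in> Gam \<xi> n" "t = shift ?z q @ v"
        "Prob_graph \<xi> n v r'"
      have "u = v" using shift_append_decomp[OF b(2) q(1)] b(1) q(3) by metis
      then show ?thesis using q(4) r(2) by blast
    qed
    then show ?thesis using Prob_graph.later[OF step(1) b(2,3) r(1)] b(1) by blast
  qed
qed

lemma Prob_graph_Prob: "n \<ge> 1 \<Longrightarrow> t \<in> Gam \<xi> n \<Longrightarrow> Prob_graph \<xi> n t (Prob \<xi> n t)"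
  unfolding Prob_def by (rule theI', rule Prob_graph_ex1)

lemma Prob_eqI: "n \<ge> 1 \<Longrightarrow> t \<in> Gam \<xi> n \<Longrightarrow> Prob_graph \<xi> n t r \<Longrightarrow> Prob \<xi> n t = r"
  using Prob_graph_Prob Prob_graph_ex1 by blast

lemma Prob_zero: "Prob 0 1 [0] = 1"
  by (rule Prob_eqI) (auto simp: Gam_0 intro: Prob_graph.zero)

lemma Prob_limit:
  assumes "limit_ordinal \<xi>" "\<zeta> < \<xi>" "t \<in> Gam (osucc \<zeta>) 1"
  shows "Prob \<xi> 1 (shift (omega_pow \<zeta>) t) = Prob (osucc \<zeta>) 1 t"
proof (rule Prob_eqI)
  show "shift (omega_pow \<zeta>) t \<in> Gam \<xi> 1" using assms by (auto simp: Gam_limit)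
  show "Prob_graph \<xi> 1 (shift (omega_pow \<zeta>) t) (Prob (osucc \<zeta>) 1 t)"
    by (rule Prob_graph.limit[OF assms Prob_graph_Prob[OF order_refl assms(3)]])
qed simp

lemma Prob_succ:
  assumes "n \<ge> 1" "t \<in> Gam \<xi> n"
  shows "Prob (osucc \<xi>) 1 t = Prob \<xi> n t / real n"
proof (rule Prob_eqI)
  show "t \<in> Gam (osucc \<xi>) 1" using assms by (auto simp: Gam_osucc)
  show "Prob_graph (osucc \<xi>) 1 t (Prob \<xi> n t / real n)"
    by (rule Prob_graph.succ[OF assms Prob_graph_Prob[OF assms]])
qed simp

lemma Prob_first:
  assumes "n \<ge> 1" "s \<in> Gam \<xi> 1"
  shows "Prob \<xi> (n + 1) (shift (omega_pow \<xi> * ordinal_of_nat n) s) = Prob \<xi> 1 s"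
proof (rule Prob_eqI)
  show "shift (omega_pow \<xi> * ordinal_of_nat n) s \<in> Gam \<xi> (n + 1)"
    using assms by (auto simp: Gam_Suc)
  show "Prob_graph \<xi> (n + 1) (shift (omega_pow \<xi> * ordinal_of_nat n) s) (Prob \<xi> 1 s)"
    by (rule Prob_graph.first[OF assms Prob_graph_Prob[OF order_refl assms(2)]])
qed simp

lemma Prob_later:
  assumes "n \<ge> 1" "s \<in> maximal (Gam \<xi> 1)" "u \<in> Gam \<xi> n"
  shows "Prob \<xi> (n + 1) (shift (omega_pow \<xi> * ordinal_of_nat n) s @ u) = Prob \<xi> n u"
proof (rule Prob_eqI)
  show "shift (omega_pow \<xi> * ordinal_of_nat n) s @ u \<in> Gam \<xi> (n + 1)"
    unfolding Gam_Suc[OF assms(1)] using assms(2,3) by blast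
  show "Prob_graph \<xi> (n + 1) (shift (omega_pow \<xi> * ordinal_of_nat n) s @ u) (Prob \<xi> n u)"
    by (rule Prob_graph.later[OF assms Prob_graph_Prob[OF assms(1,3)]])
qed simp

section \<open>Concatenations and unions of trees\<close>

lemma maximalD: "t \<in> maximal T \<Longrightarrow> s \<in> T \<Longrightarrow> \<not> strict_prefix t s"
  by (auto simp: maximal_def)

lemma maximalI: "t \<in> T \<Longrightarrow> (\<And>s. s \<in> T \<Longrightarrow> \<not> strict_prefix t s) \<Longrightarrow> t \<in> maximal T"
  by (auto simp: maximal_def)

lemma maximal_concat:
  assumes T: "T \<noteq> {}" "[] \<notin> T"
  shows "maximal (shift z ` S \<union> {shift z s @ u | s u. s \<in> maximal S \<and> u \<in> T}) =
    {shift z s @ u | s u. s \<in> maximal S \<and> u \<in> maximal T}" (is "maximal ?C = ?M")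
proof (rule set_eqI, rule iffI)
  fix t assume t: "t \<in> maximal ?C"
  then consider (a) s where "s \<in> S" "t = shift z s" |
    (b) s u where "s \<in> maximal S" "u \<in> T" "t = shift z s @ u"
    using maximal_subset by blast
  then show "t \<in> ?M"
  proof cases
    case a
    show ?thesis
    proof (cases "s \<in> maximal S")
      case True
      obtain u where u: "u \<in> T" using T by blast
      then have "shift z s @ u \<in> ?C" "strict_prefix (shift z s) (shift z s @ u)"
        using True T by (auto simp: strict_prefix_def)
      then show ?thesis using maximalD[OF t] a by blast
    next
      case False
      then obtain s' where "s' \<in> S" "strict_prefix s s'" using a by (auto simp: maximal_def)
      then have "shift z s' \<in> ?C" "strict_prefix t (shift z s')" using a by auto
      then show ?thesis using maximalD[OF t] by blast
    qed
  next
    case b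
    have "u \<in> maximal T"
    proof (rule ccontr)
      assume "u \<notin> maximal T"
      then obtain u' where u': "u' \<in> T" "strict_prefix u u'" using b by (auto simp: maximal_def)
      then have "shift z s @ u' \<in> ?C" "strict_prefix t (shift z s @ u')"
        using b by (auto simp: strict_prefix_def)
      then show False using maximalD[OF t] by blast
    qed
    then show ?thesis using b by blast
  qed
next
  fix t assume "t \<in> ?M"
  then obtain s u where su: "s \<in> maximal S" "u \<in> maximal T" "t = shift z s @ u" by blast
  then have une: "u \<noteq> []" using T maximal_subset by metis
  have "\<not> strict_prefix t q" if "q \<in> ?C" for q
  proof
    assume pr: "strict_prefix t q"
    then obtain w where w: "q = shift z s @ (u @ w)" "w \<noteq> []"
      using su(3) by (auto simp: strict_prefix_def prefix_def)
    from that show False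
    proof (elim UnE)
      assume "q \<in> shift z ` S"
      then show False using shift_append_neq[OF _ su(1), of _ "u @ w"] w une by blast
    next
      assume "q \<in> {shift z s @ u | s u. s \<in> maximal S \<and> u \<in> T}"
      then obtain s' u' where "s' \<in> maximal S" "u' \<in> T" "q = shift z s' @ u'" by blast
      then have "u @ w \<in> T" using shift_append_decomp[OF su(1)] w(1) by metis
      then show False using maximal_prefix[OF su(2), of "u @ w"] w(2) by simp
    qed
  qed
  moreover have "t \<in> ?C" using su maximal_subset by blast
  ultimately show "t \<in> maximal ?C" by (blast intro: maximalI)
qed

lemma maximal_union:
  assumes ne: "\<And>i. i \<in> I \<Longrightarrow> [] \<notin> T i"
    and dis: "\<And>i j s t. i \<in> I \<Longrightarrow> j \<in> I \<Longrightarrow> s \<in> T i \<Longrightarrow> t \<in> T j \<Longrightarrow> z i + hd s = z j + hd t \<Longrightarrow> i = j"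
  shows "maximal (\<Union>i\<in>I. shift (z i) ` T i) = (\<Union>i\<in>I. shift (z i) ` maximal (T i))"
    (is "maximal ?C = ?M")
proof (rule set_eqI, rule iffI)
  fix t assume t: "t \<in> maximal ?C"
  then obtain i s where s: "i \<in> I" "s \<in> T i" "t = shift (z i) s" using maximal_subset by blast
  have "s \<in> maximal (T i)"
  proof (rule ccontr)
    assume "s \<notin> maximal (T i)"
    then obtain s' where "s' \<in> T i" "strict_prefix s s'" using s by (auto simp: maximal_def)
    then have "shift (z i) s' \<in> ?C" "strict_prefix t (shift (z i) s')" using s by auto
    then show False using maximalD[OF t] by blast
  qed
  then show "t \<in> ?M" using s by blast
next
  fix t assume "t \<in> ?M"
  then obtain i s where s: "i \<in> I" "s \<in> maximal (T i)" "t = shift (z i) s" by blast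
  have "\<not> strict_prefix t q" if qC: "q \<in> ?C" for q
  proof
    assume pr: "strict_prefix t q"
    obtain j r where r: "j \<in> I" "r \<in> T j" "q = shift (z j) r" using qC by blast
    have nes: "s \<noteq> []" "r \<noteq> []" using s r ne maximal_subset by metis+
    then have "hd t = hd q" using pr s(3)
      by (metis hd_append prefix_def shift_Nil(1) strict_prefix_def)
    then have "z i + hd s = z j + hd r" using nes s r by (simp add: hd_shift)
    then have "i = j" using dis s r maximal_subset by metis
    then show False using pr s r maximalD by auto
  qed
  moreover have "t \<in> ?C" using s maximal_subset by blast
  ultimately show "t \<in> maximal ?C" by (blast intro: maximalI)
qed

text \<open>
  The translation \<open>t \<mapsto> z + t\<close> on the sequences of pairs, acting on the first components.
\<close>
definition shift_fst :: "'o ordinal \<Rightarrow> ('o ordinal \<times> 'd) list \<Rightarrow> ('o ordinal \<times> 'd) list" where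
  "shift_fst z t = map (apfst ((+) z)) t"

lemma map_fst_shift_fst [simp]: "map fst (shift_fst z t) = shift z (map fst t)"
  by (simp add: shift_fst_def shift_def o_def)

lemma map_snd_shift_fst [simp]: "map snd (shift_fst z t) = map snd t"
  by (simp add: shift_fst_def o_def)

lemma snd_set_shift_fst [simp]: "snd ` set (shift_fst z t) = snd ` set t"
  by (metis map_snd_shift_fst set_map)

lemma shift_fst_0 [simp]: "shift_fst 0 t = t" unfolding shift_fst_def by (rule map_idI) auto

lemma length_shift_fst [simp]: "length (shift_fst z t) = length t" by (simp add: shift_fst_def)

lemma shift_fst_append [simp]: "shift_fst z (s @ t) = shift_fst z s @ shift_fst z t" by (simp add: shift_fst_def)

lemma shift_fst_single [simp]: "shift_fst z [(a, u)] = [(z + a, u)]" by (simp add: shift_fst_def)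

lemma take_shift_fst: "take k (shift_fst z t) = shift_fst z (take k t)" by (simp add: shift_fst_def take_map)

lemma pair_list_eqI: "map fst s = map fst t \<Longrightarrow> map snd s = map snd t \<Longrightarrow> s = t"
  by (metis zip_map_fst_snd)

lemma inj_shift_fst: "inj (shift_fst z)"
proof (rule injI)
  fix s t :: "('a ordinal \<times> 'b) list" assume "shift_fst z s = shift_fst z t"
  then show "s = t" by (metis map_fst_shift_fst map_snd_shift_fst pair_list_eqI shift_inj)
qed

lemma inv_shift_fst [simp]: "inv (shift_fst z) (shift_fst z t) = t" by (rule inv_f_f[OF inj_shift_fst])

lemma ex_shift_fst: "map fst t = shift z p \<Longrightarrow> \<exists>q. t = shift_fst z q \<and> map fst q = p \<and> map snd q = map snd t"
proof -
  assume p: "map fst t = shift z p"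
  then have l: "length p = length t" by (metis length_map shift_def)
  have "map fst (shift_fst z (zip p (map snd t))) = map fst t"
    "map snd (shift_fst z (zip p (map snd t))) = map snd t" using l p by auto
  then have "shift_fst z (zip p (map snd t)) = t" by (rule pair_list_eqI)
  then show ?thesis using l by (intro exI[of _ "zip p (map snd t)"]) auto
qed

lemma tree_prod_iff: "t \<in> tree_prod T D \<longleftrightarrow> map fst t \<in> T \<and> snd ` set t \<subseteq> D"
  by (simp add: tree_prod_def)

lemma maximal_tree_prod:
  assumes "D \<noteq> {}"
  shows "maximal (tree_prod T D) = tree_prod (maximal T) D"
proof (rule set_eqI, rule iffI)
  fix t assume t: "t \<in> maximal (tree_prod T D)"
  have "\<not> strict_prefix (map fst t) s" if "s \<in> T" for s
  proof
    assume "strict_prefix (map fst t) s"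
    then obtain w where w: "s = map fst t @ w" "w \<noteq> []" by (auto simp: strict_prefix_def prefix_def)
    obtain d where "d \<in> D" using assms by blast
    define q where "q = t @ map (\<lambda>a. (a, d)) w"
    have "q \<in> tree_prod T D" using t w that \<open>d \<in> D\<close>
      by (force simp: q_def tree_prod_iff o_def dest!: maximal_subset)
    moreover have "strict_prefix t q" using w by (auto simp: q_def strict_prefix_def)
    ultimately show False using maximalD[OF t] by blast
  qed
  then show "t \<in> tree_prod (maximal T) D"
    using maximal_subset[OF t] by (auto simp: tree_prod_iff intro: maximalI)
next
  fix t assume t: "t \<in> tree_prod (maximal T) D"
  have "\<not> strict_prefix t q" if "q \<in> tree_prod T D" for q
  proof
    assume "strict_prefix t q"
    then obtain w where w: "q = t @ w" "w \<noteq> []" by (auto simp: strict_prefix_def prefix_def)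
    then have "strict_prefix (map fst t) (map fst q)" by (auto simp: strict_prefix_def)
    moreover have "map fst q \<in> T" using that by (simp add: tree_prod_iff)
    ultimately show False using t maximalD by (auto simp: tree_prod_iff)
  qed
  then show "t \<in> maximal (tree_prod T D)"
    using t maximal_subset by (intro maximalI) (auto simp: tree_prod_iff)
qed

text \<open>
  Collections indexed by \<open>T.D\<close>: the immediate successors of a node which have the same new first
  component \<open>\<zeta>\<close> carry a family with the property \<open>null\<close>.
\<close>

definition collection ::
  "(('d \<Rightarrow> 'x) \<Rightarrow> bool) \<Rightarrow> 'd set \<Rightarrow> 'o ordinal list set \<Rightarrow> (('o ordinal \<times> 'd) list \<Rightarrow> 'x) \<Rightarrow> bool"
  where "collection null D T x \<longleftrightarrow>
    (\<forall>t \<zeta>. map fst t @ [\<zeta>] \<in> T \<longrightarrow> snd ` set t \<subseteq> D \<longrightarrow> null (\<lambda>u. x (t @ [(\<zeta>, u)])))"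

lemma collectionD: "collection null D T x \<Longrightarrow> map fst t @ [\<zeta>] \<in> T \<Longrightarrow> snd ` set t \<subseteq> D \<Longrightarrow>
    null (\<lambda>u. x (t @ [(\<zeta>, u)]))"
  by (simp add: collection_def)

lemma collectionI: "(\<And>t \<zeta>. map fst t @ [\<zeta>] \<in> T \<Longrightarrow> snd ` set t \<subseteq> D \<Longrightarrow>
    null (\<lambda>u. x (t @ [(\<zeta>, u)]))) \<Longrightarrow> collection null D T x"
  by (simp add: collection_def)

lemma collection_sub:
  assumes x: "collection null D C x" and sub: "shift z ` S \<subseteq> C"
  shows "collection null D S (\<lambda>t. x (shift_fst z t))"
proof (rule collectionI)
  fix t \<zeta> assume t: "map fst t @ [\<zeta>] \<in> S" "snd ` set t \<subseteq> D"
  then have "map fst (shift_fst z t) @ [z + \<zeta>] \<in> C" using sub by (auto simp: shift_def)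
  from collectionD[OF x this] show "null (\<lambda>u. x (shift_fst z (t @ [(\<zeta>, u)])))" using t by simp
qed

lemma collection_after:
  assumes x: "collection null D C x" and sub: "\<And>u. u \<in> T \<Longrightarrow> map fst s @ u \<in> C" and s: "snd ` set s \<subseteq> D"
  shows "collection null D T (\<lambda>t. x (s @ t))"
proof (rule collectionI)
  fix t \<zeta> assume t: "map fst t @ [\<zeta>] \<in> T" "snd ` set t \<subseteq> D"
  then have "map fst (s @ t) @ [\<zeta>] \<in> C" using sub by auto
  from collectionD[OF x this] show "null (\<lambda>u. x (s @ t @ [(\<zeta>, u)]))" using t s by (simp add: image_Un)
qed

lemma snoc_shift_fst:
  assumes "map fst t @ [\<zeta>] = shift z p"
  obtains q b where "p = map fst q @ [b]" "t = shift_fst z q" "\<zeta> = z + b" "map snd q = map snd t"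
proof -
  have "p \<noteq> []" using assms by auto
  then obtain p' b where p: "p = p' @ [b]" by (metis rev_exhaust)
  then have "map fst t = shift z p'" "\<zeta> = z + b" using assms by (auto simp: shift_def)
  from ex_shift_fst[OF this(1)] obtain q where "t = shift_fst z q" "map fst q = p'" "map snd q = map snd t" by blast
  then show ?thesis using that[of q b] p \<open>\<zeta> = z + b\<close> by blast
qed

text \<open>
  Collections on trees without common first entries glue to a collection on their union.
\<close>
lemma collection_union:
  assumes ne: "\<And>i. i \<in> I \<Longrightarrow> [] \<notin> T i"
    and dis: "\<And>i j s t. i \<in> I \<Longrightarrow> j \<in> I \<Longrightarrow> s \<in> T i \<Longrightarrow> t \<in> T j \<Longrightarrow> z i + hd s = z j + hd t \<Longrightarrow> i = j"
    and y: "\<And>i. i \<in> I \<Longrightarrow> collection null D (T i) (y i)"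
  obtains x where "collection null D (\<Union>i\<in>I. shift (z i) ` T i) x"
    "\<And>i t. i \<in> I \<Longrightarrow> map fst t \<in> T i \<Longrightarrow> x (shift_fst (z i) t) = y i t"
proof
  define x where "x t = (let i = (THE i. i \<in> I \<and> map fst t \<in> shift (z i) ` T i) in y i (inv (shift_fst (z i)) t))" for t
  show x: "x (shift_fst (z i) t) = y i t" if i: "i \<in> I" "map fst t \<in> T i" for i t
  proof -
    have "j = i" if j: "j \<in> I" "map fst (shift_fst (z i) t) \<in> shift (z j) ` T j" for j
    proof -
      obtain s where s: "s \<in> T j" "shift (z i) (map fst t) = shift (z j) s" using j by auto
      have "s \<noteq> []" "map fst t \<noteq> []" using ne[OF i(1)] ne[OF j(1)] s(1) i(2) by metis+
      then have "z j + hd s = z i + hd (map fst t)" using s(2) by (metis hd_shift)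
      then show ?thesis using dis[OF j(1) i(1) s(1) i(2)] by blast
    qed
    then have "(THE j. j \<in> I \<and> map fst (shift_fst (z i) t) \<in> shift (z j) ` T j) = i"
      using i by (intro the_equality) auto
    then show ?thesis by (simp add: x_def)
  qed
  show "collection null D (\<Union>i\<in>I. shift (z i) ` T i) x"
  proof (rule collectionI)
    fix t \<zeta> assume t: "map fst t @ [\<zeta>] \<in> (\<Union>i\<in>I. shift (z i) ` T i)" "snd ` set t \<subseteq> D"
    then obtain i p where p: "i \<in> I" "p \<in> T i" "map fst t @ [\<zeta>] = shift (z i) p" by blast
    from p(3) obtain q b where q: "p = map fst q @ [b]" "t = shift_fst (z i) q" "\<zeta> = z i + b"
      "map snd q = map snd t" by (rule snoc_shift_fst)
    have "x (t @ [(\<zeta>, u)]) = y i (q @ [(b, u)])" for u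
      using x[OF p(1), of "q @ [(b, u)]"] q p(2) by simp
    moreover have "null (\<lambda>u. y i (q @ [(b, u)]))"
      using collectionD[OF y[OF p(1)], of q b] p(2) q t(2) by simp
    ultimately show "null (\<lambda>u. x (t @ [(\<zeta>, u)]))" by simp
  qed
qed

text \<open>
  Collections on the concatenation of two trees are assembled from a collection on the first tree and,
  for every maximal branch of it, a collection on the second tree.
\<close>
lemma collection_concat:
  assumes ne: "[] \<notin> T"
    and y: "collection null D S y"
    and w: "\<And>s. s \<in> tree_prod (maximal S) D \<Longrightarrow> collection null D T (w s)"
  obtains x where "collection null D (shift z ` S \<union> {shift z s @ u | s u. s \<in> maximal S \<and> u \<in> T}) x"
    "\<And>t. map fst t \<in> S \<Longrightarrow> x (shift_fst z t) = y t"
    "\<And>s t. map fst s \<in> maximal S \<Longrightarrow> map fst t \<in> T \<Longrightarrow> x (shift_fst z s @ t) = w s t"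
proof
  \<comment> \<open>the branch \<open>s\<close> is recovered from \<open>t\<close>: branches through two maximal nodes never meet\<close>
  define x where "x t = (if map fst t \<in> shift z ` S then y (inv (shift_fst z) t)
     else (THE v. \<exists>s r. t = shift_fst z s @ r \<and> map fst s \<in> maximal S \<and> v = w s r))" for t
  show x1: "x (shift_fst z t) = y t" if "map fst t \<in> S" for t
    using that by (simp add: x_def)
  show x2: "x (shift_fst z s @ t) = w s t" if s: "map fst s \<in> maximal S" and t: "map fst t \<in> T" for s t
  proof -
    have "map fst t \<noteq> []" using t ne by metis
    then have "map fst (shift_fst z s @ t) \<notin> shift z ` S"
      using shift_append_neq[OF _ s] by (metis imageE map_append map_fst_shift_fst)
    moreover have "(THE v. \<exists>s' r. shift_fst z s @ t = shift_fst z s' @ r \<and> map fst s' \<in> maximal S \<and> v = w s' r) = w s t"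
    proof (rule the_equality)
      show "\<exists>s' r. shift_fst z s @ t = shift_fst z s' @ r \<and> map fst s' \<in> maximal S \<and> w s t = w s' r" using s by blast
      fix v assume "\<exists>s' r. shift_fst z s @ t = shift_fst z s' @ r \<and> map fst s' \<in> maximal S \<and> v = w s' r"
      then obtain s' r where r: "shift_fst z s @ t = shift_fst z s' @ r" "map fst s' \<in> maximal S" "v = w s' r" by blast
      have "shift z (map fst s) @ map fst t = shift z (map fst s') @ map fst r"
        using arg_cong[OF r(1), of "map fst"] by simp
      then have "map fst s = map fst s'" using shift_append_decomp[OF s r(2)] by blast
      then have "length (shift_fst z s) = length (shift_fst z s')" by (metis length_map length_shift_fst)
      then have "shift_fst z s = shift_fst z s'" "t = r" using r(1) by auto
      then show "v = w s t" using r(3) by (metis inv_shift_fst)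
    qed
    ultimately show ?thesis by (simp add: x_def)
  qed
  show "collection null D (shift z ` S \<union> {shift z s @ u | s u. s \<in> maximal S \<and> u \<in> T}) x"
  proof (rule collectionI, elim UnE)
    fix t \<zeta> assume t: "snd ` set t \<subseteq> D" "map fst t @ [\<zeta>] \<in> shift z ` S"
    then obtain p where p: "p \<in> S" "map fst t @ [\<zeta>] = shift z p" by blast
    from p(2) obtain q b where q: "p = map fst q @ [b]" "t = shift_fst z q" "\<zeta> = z + b"
      "map snd q = map snd t" by (rule snoc_shift_fst)
    have "x (t @ [(\<zeta>, u)]) = y (q @ [(b, u)])" for u
      using x1[of "q @ [(b, u)]"] q p(1) by simp
    moreover have "null (\<lambda>u. y (q @ [(b, u)]))"
      using collectionD[OF y, of q b] p(1) q t(1) by simp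
    ultimately show "null (\<lambda>u. x (t @ [(\<zeta>, u)]))" by simp
  next
    fix t \<zeta> assume t: "snd ` set t \<subseteq> D"
      "map fst t @ [\<zeta>] \<in> {shift z s @ u | s u. s \<in> maximal S \<and> u \<in> T}"
    then obtain s u where su: "s \<in> maximal S" "u \<in> T" "map fst t @ [\<zeta>] = shift z s @ u" by blast
    have "u \<noteq> []" using su(2) ne by metis
    then obtain u' where u': "u = u' @ [\<zeta>]" "map fst t = shift z s @ u'"
      using su(3) by (metis append_assoc butlast_append butlast_snoc last_appendR last_snoc append_butlast_last_id)
    define t1 t2 where "t1 = take (length s) t" and "t2 = drop (length s) t"
    have t12: "t = t1 @ t2" by (simp add: t1_def t2_def)
    have l: "length (shift z s) = length s" by (simp add: shift_def)
    have "map fst t1 = shift z s" "map fst t2 = u'"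
      using u'(2) l by (simp_all add: t1_def t2_def take_map[symmetric] drop_map[symmetric])
    then obtain q where q: "t1 = shift_fst z q" "map fst q = s" "map snd q = map snd t1"
      using ex_shift_fst[of t1 z s] by blast
    have D: "snd ` set q \<subseteq> D" "snd ` set t2 \<subseteq> D" using t(1) t12 q by (auto simp: image_Un)
    have "x (t @ [(\<zeta>, u)]) = w q (t2 @ [(\<zeta>, u)])" for u
      using x2[of q "t2 @ [(\<zeta>, u)]"] q su(1,2) u' t12 \<open>map fst t2 = u'\<close> by simp
    moreover have "null (\<lambda>u. w q (t2 @ [(\<zeta>, u)]))"
      using collectionD[OF w, of q t2 \<zeta>] D q su u' \<open>map fst t2 = u'\<close> by (simp add: tree_prod_iff)
    ultimately show "null (\<lambda>u. x (t @ [(\<zeta>, u)]))" by simp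
  qed
qed

section \<open>Sums along a branch\<close>

text \<open>
  The sum \<open>\<Sum>\<^bsub>\<emptyset> < s \<le> t\<^esub> w(s) x\<^sub>s\<close> along the branch that ends in \<open>t\<close>; the weight of a node depends on its
  sequence of ordinals only.
\<close>
definition branch_sum ::
  "('o ordinal list \<Rightarrow> real) \<Rightarrow> (('o ordinal \<times> 'd) list \<Rightarrow> 'x::real_vector) \<Rightarrow> ('o ordinal \<times> 'd) list \<Rightarrow> 'x"
  where "branch_sum w x t = (\<Sum>s\<in>{s. s \<noteq> [] \<and> prefix s t}. w (map fst s) *\<^sub>R x s)"

text \<open>
  The part of the sum along the branch to \<open>t\<close> that comes from the \<open>i\<close>-th level \<open>\<Lambda>\<^bsub>\<xi>,n,i\<^esub>.D\<close>.
\<close>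
definition block_sum ::
  "'d set \<Rightarrow> 'o ordinal \<Rightarrow> nat \<Rightarrow> (('o ordinal \<times> 'd) list \<Rightarrow> 'x::real_vector) \<Rightarrow>
     ('o ordinal \<times> 'd) list \<Rightarrow> nat \<Rightarrow> 'x"
  where "block_sum D \<xi> n x t i = (\<Sum>s\<in>{s \<in> tree_prod (Lam \<xi> n i) D. prefix s t}. Prob \<xi> n (map fst s) *\<^sub>R x s)"

text \<open>
  The list of the block sums for \<open>i = 1, \<dots>, n\<close>.
\<close>
definition block_sums where "block_sums D \<xi> n x t = map (block_sum D \<xi> n x t) [1..<n + 1]"

lemma nonempty_prefixes_append:
  "{s. s \<noteq> [] \<and> prefix s (a @ b)} =
     {s. s \<noteq> [] \<and> prefix s a} \<union> (\<lambda>s. a @ s) ` {s. s \<noteq> [] \<and> prefix s b}"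
  by (auto simp: prefix_append)

lemma finite_prefixes: "finite {s. s \<noteq> [] \<and> prefix s t}"
  by (rule finite_subset[of _ "set (prefixes t)"]) auto

lemma branch_sum_append: "branch_sum w x (a @ b) = branch_sum w x a + branch_sum (\<lambda>s. w (map fst a @ s)) (\<lambda>s. x (a @ s)) b"
proof -
  have "{s. s \<noteq> [] \<and> prefix s a} \<inter> (\<lambda>s. a @ s) ` {s. s \<noteq> [] \<and> prefix s b} = {}"
    by (auto simp: prefix_def)
  then have "branch_sum w x (a @ b) = branch_sum w x a +
      (\<Sum>s\<in>(\<lambda>s. a @ s) ` {s. s \<noteq> [] \<and> prefix s b}. w (map fst s) *\<^sub>R x s)"
    unfolding branch_sum_def nonempty_prefixes_append
    by (intro sum.union_disjoint) (auto simp: finite_prefixes)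
  also have "(\<Sum>s\<in>(\<lambda>s. a @ s) ` {s. s \<noteq> [] \<and> prefix s b}. w (map fst s) *\<^sub>R x s) =
      branch_sum (\<lambda>s. w (map fst a @ s)) (\<lambda>s. x (a @ s)) b"
    unfolding branch_sum_def by (subst sum.reindex) (auto simp: inj_on_def)
  finally show ?thesis .
qed

lemma prefix_shift_fst: "prefix s (shift_fst z t) \<longleftrightarrow> (\<exists>q. s = shift_fst z q \<and> prefix q t)"
proof
  assume "prefix s (shift_fst z t)"
  then have "s = take (length s) (shift_fst z t)" by (metis append_eq_conv_conj prefix_def)
  then show "\<exists>q. s = shift_fst z q \<and> prefix q t" by (metis take_shift_fst take_is_prefix)
next
  assume "\<exists>q. s = shift_fst z q \<and> prefix q t"
  then show "prefix s (shift_fst z t)" by (auto simp: prefix_def)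
qed

lemma shift_fst_Nil [simp]: "shift_fst z t = [] \<longleftrightarrow> t = []" by (simp add: shift_fst_def)

lemma branch_sum_shift_fst: "branch_sum w x (shift_fst z t) = branch_sum (\<lambda>s. w (shift z s)) (\<lambda>s. x (shift_fst z s)) t"
proof -
  have "{s. s \<noteq> [] \<and> prefix s (shift_fst z t)} = shift_fst z ` {s. s \<noteq> [] \<and> prefix s t}"
    by (auto simp: prefix_shift_fst)
  then show ?thesis unfolding branch_sum_def
    by (simp add: sum.reindex inj_on_subset[OF inj_shift_fst])
qed

lemma branch_sum_cong:
  assumes "\<And>s. s \<noteq> [] \<Longrightarrow> prefix s t \<Longrightarrow> w (map fst s) = w' (map fst s)"
    "\<And>s. s \<noteq> [] \<Longrightarrow> prefix s t \<Longrightarrow> x s = x' s"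
  shows "branch_sum w x t = branch_sum w' x' t"
  unfolding branch_sum_def using assms by (intro sum.cong) auto

lemma Gam_fst_prefix:
  assumes "n \<ge> 1" "map fst t \<in> Gam \<xi> n" "s \<noteq> []" "prefix s t"
  shows "map fst s \<in> Gam \<xi> n"
  by (rule Gam_prefix[OF assms(1,2)]) (use assms in \<open>auto intro: map_mono_prefix\<close>)

lemma Lam_subset: "t \<in> Lam \<xi> n i \<Longrightarrow> t \<in> Gam \<xi> n"
  by (simp add: Lam_def)

lemma Lam_first:
  "Lam \<xi> (n + 1) 1 = shift (omega_pow \<xi> * ordinal_of_nat n) ` Gam \<xi> 1"
proof -
  have one: "shift (omega_pow \<xi> * ordinal_of_nat n) s \<in> Gam \<xi> (n + 1)" if "s \<in> Gam \<xi> 1" for s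
    using that by (cases "n \<ge> 1") (auto simp: Gam_Suc not_le)
  have "Lam \<xi> (n + 1) 1 = {t \<in> Gam \<xi> (n + 1).
      \<exists>s\<in>Gam \<xi> 1. t = shift (omega_pow \<xi> * ordinal_of_nat n) s}"
  proof -
    have u: "[0..<1] = [0]" by (simp add: One_nat_def)
    have "(\<exists>ts. length ts = 1 \<and> (\<forall>j<1. ts ! j \<in> Gam \<xi> 1) \<and> (\<forall>j<1 - 1. ts ! j \<in> maximal (Gam \<xi> 1)) \<and>
        t = concat (map (\<lambda>j. shift (omega_pow \<xi> * ordinal_of_nat (n + 1 - (j + 1))) (ts ! j)) [0..<1]))
      \<longleftrightarrow> (\<exists>s\<in>Gam \<xi> 1. t = shift (omega_pow \<xi> * ordinal_of_nat n) s)" (is "?L \<longleftrightarrow> ?R") for t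
    proof
      show "?L \<Longrightarrow> ?R" by (auto simp: u)
    next
      assume ?R
      then obtain s where "s \<in> Gam \<xi> 1" "t = shift (omega_pow \<xi> * ordinal_of_nat n) s" by blast
      then show ?L by (intro exI[of _ "[s]"]) (auto simp: u)
    qed
    then show ?thesis unfolding Lam_def by auto
  qed
  then show ?thesis using one by auto
qed

lemma Lam_1: "Lam \<xi> 1 1 = Gam \<xi> 1"
  using Lam_first[of \<xi> 0] by simp

text \<open>
  Removing the first block of a sequence in \<open>\<Lambda>\<^bsub>\<xi>,n+1,i+1\<^esub>\<close> leaves a sequence in \<open>\<Lambda>\<^bsub>\<xi>,n,i\<^esub>\<close>.
\<close>
lemma Lam_later:
  assumes n: "n \<ge> 1" and i: "i \<ge> 1"
  shows "Lam \<xi> (n + 1) (i + 1) = {shift (omega_pow \<xi> * ordinal_of_nat n) s @ u | s u.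
     s \<in> maximal (Gam \<xi> 1) \<and> u \<in> Lam \<xi> n i}"
proof -
  let ?z = "omega_pow \<xi> * ordinal_of_nat n"
  let ?c = "\<lambda>n i ts. concat (map (\<lambda>j. shift (omega_pow \<xi> * ordinal_of_nat (n - (j + 1))) (ts ! j)) [0..<i])"
  have c: "?c (n + 1) (i + 1) (s # ts) = shift ?z s @ ?c n i ts" for s ts
  proof -
    have "[0..<i + 1] = 0 # map Suc [0..<i]"
      by (metis Suc_eq_plus1 map_Suc_upt upt_conv_Cons zero_less_Suc)
    then show ?thesis by (simp add: o_def flip: Suc_eq_plus1 del: upt_Suc)
  qed
  show ?thesis
  proof (intro equalityI subsetI)
    fix t assume "t \<in> Lam \<xi> (n + 1) (i + 1)"
    then obtain ts where t: "t \<in> Gam \<xi> (n + 1)" "i + 1 \<le> n + 1" "length ts = i + 1"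
      "\<forall>j<i + 1. ts ! j \<in> Gam \<xi> 1" "\<forall>j<i + 1 - 1. ts ! j \<in> maximal (Gam \<xi> 1)"
      "t = ?c (n + 1) (i + 1) ts"
      unfolding Lam_def by blast
    obtain s us where ts: "ts = s # us" using t(3) by (cases ts) auto
    define u where "u = ?c n i us"
    have us: "\<forall>j<i. us ! j \<in> Gam \<xi> 1" "\<forall>j<i - 1. us ! j \<in> maximal (Gam \<xi> 1)"
    proof -
      show "\<forall>j<i. us ! j \<in> Gam \<xi> 1"
        using t(4) ts by (metis Suc_eq_plus1 Suc_less_eq nth_Cons_Suc)
      show "\<forall>j<i - 1. us ! j \<in> maximal (Gam \<xi> 1)"
        using t(5) ts by (metis Suc_eq_plus1 diff_add_inverse2 less_diff_conv nth_Cons_Suc)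
    qed
    have s: "s \<in> maximal (Gam \<xi> 1)" using t(5) ts i by (metis diff_add_inverse2 less_le_trans nth_Cons_0 zero_less_one)
    have tu: "t = shift ?z s @ u" using t(6) unfolding ts c u_def .
    have "us ! 0 \<noteq> []" using us(1) i Nil_notin_Gam[OF order_refl, of \<xi>]
      by (metis less_le_trans zero_less_one)
    moreover have "[0..<i] = 0 # [Suc 0..<i]" using i by (simp add: upt_conv_Cons)
    ultimately have "u \<noteq> []" by (simp add: u_def)
    have "u \<in> Gam \<xi> n"
    proof -
      consider (a) r where "t = shift ?z r" "r \<in> Gam \<xi> 1" |
         (b) r v where "t = shift ?z r @ v" "r \<in> maximal (Gam \<xi> 1)" "v \<in> Gam \<xi> n"
        using t(1) Gam_Suc[OF n] by blast
      then show ?thesis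
      proof cases
        case a
        then show ?thesis using shift_append_neq[OF a(2) s \<open>u \<noteq> []\<close>] tu by metis
      next
        case b
        then show ?thesis using shift_append_decomp[OF b(2) s] tu by metis
      qed
    qed
    then have "u \<in> Lam \<xi> n i" unfolding Lam_def
      using us i t(2,3) ts u_def by auto
    then show "t \<in> {shift ?z s @ u | s u. s \<in> maximal (Gam \<xi> 1) \<and> u \<in> Lam \<xi> n i}"
      using s tu by blast
  next
    fix t assume "t \<in> {shift ?z s @ u | s u. s \<in> maximal (Gam \<xi> 1) \<and> u \<in> Lam \<xi> n i}"
    then obtain s u where su: "s \<in> maximal (Gam \<xi> 1)" "u \<in> Lam \<xi> n i" "t = shift ?z s @ u" by blast
    then obtain us where u: "u \<in> Gam \<xi> n" "i \<le> n" "length us = i"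
      "\<forall>j<i. us ! j \<in> Gam \<xi> 1" "\<forall>j<i - 1. us ! j \<in> maximal (Gam \<xi> 1)"
      "u = ?c n i us"
      unfolding Lam_def by blast
    have "t \<in> Gam \<xi> (n + 1)" unfolding Gam_Suc[OF n] using su u(1) by blast
    moreover have "t = ?c (n + 1) (i + 1) (s # us)" unfolding c su(3) using u(6) by simp
    moreover have "\<forall>j<i + 1. (s # us) ! j \<in> Gam \<xi> 1"
      using u(4) maximal_subset[OF su(1)] by (auto simp: nth_Cons split: nat.split)
    moreover have "\<forall>j<i + 1 - 1. (s # us) ! j \<in> maximal (Gam \<xi> 1)"
      using u(5) su(1) by (auto simp: nth_Cons split: nat.split)
    ultimately show "t \<in> Lam \<xi> (n + 1) (i + 1)" unfolding Lam_def
      using u(2,3) i by (intro CollectI conjI exI[of _ "s # us"]) auto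
  qed
qed

lemma block_sums_1:
  assumes "t \<in> tree_prod (Gam \<xi> 1) D"
  shows "block_sums D \<xi> 1 x t = [branch_sum (Prob \<xi> 1) x t]"
proof -
  have "{s \<in> tree_prod (Gam \<xi> 1) D. prefix s t} = {s. s \<noteq> [] \<and> prefix s t}"
  proof (intro equalityI subsetI)
    fix s assume "s \<in> {s \<in> tree_prod (Gam \<xi> 1) D. prefix s t}"
    then show "s \<in> {s. s \<noteq> [] \<and> prefix s t}"
      using Nil_notin_Gam[OF order_refl, of \<xi>] by (auto simp: tree_prod_iff)
  next
    fix s assume "s \<in> {s. s \<noteq> [] \<and> prefix s t}"
    then have s: "s \<noteq> []" "prefix s t" by auto
    have "map fst s \<in> Gam \<xi> 1"
      using Gam_fst_prefix[OF order_refl _ s] assms by (simp add: tree_prod_iff)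
    moreover have "snd ` set s \<subseteq> D" using assms set_mono_prefix[OF s(2)] by (auto simp: tree_prod_iff)
    ultimately show "s \<in> {s \<in> tree_prod (Gam \<xi> 1) D. prefix s t}" using s by (simp add: tree_prod_iff)
  qed
  moreover have "[1..<1 + 1] = [1]" by (simp add: One_nat_def)
  ultimately show ?thesis by (simp add: block_sums_def block_sum_def branch_sum_def Lam_1)
qed

lemma block_sums_Suc:
  assumes n: "n \<ge> 1" and s: "s \<in> tree_prod (maximal (Gam \<xi> 1)) D" and t: "t \<in> tree_prod (Gam \<xi> n) D"
    and z: "z = omega_pow \<xi> * ordinal_of_nat n"
  shows "block_sums D \<xi> (n + 1) x (shift_fst z s @ t) =
    branch_sum (Prob \<xi> 1) (\<lambda>q. x (shift_fst z q)) s # block_sums D \<xi> n (\<lambda>q. x (shift_fst z s @ q)) t"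
proof -
  have sG: "map fst s \<in> Gam \<xi> 1" "map fst s \<in> maximal (Gam \<xi> 1)"
    using s maximal_subset by (auto simp: tree_prod_iff)
  have first: "block_sum D \<xi> (n + 1) x (shift_fst z s @ t) 1 = branch_sum (Prob \<xi> 1) (\<lambda>q. x (shift_fst z q)) s"
  proof -
    have eq: "{q \<in> tree_prod (Lam \<xi> (n + 1) 1) D. prefix q (shift_fst z s @ t)} = shift_fst z ` {q. q \<noteq> [] \<and> prefix q s}"
    proof (intro equalityI subsetI)
      fix q assume "q \<in> {q \<in> tree_prod (Lam \<xi> (n + 1) 1) D. prefix q (shift_fst z s @ t)}"
      then obtain p where p: "p \<in> Gam \<xi> 1" "map fst q = shift z p" and pr: "prefix q (shift_fst z s @ t)"
        by (auto simp: tree_prod_iff Lam_first z)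
      have "prefix q (shift_fst z s)"
      proof (rule ccontr)
        assume "\<not> prefix q (shift_fst z s)"
        then obtain v where v: "q = shift_fst z s @ v" using pr by (auto simp: prefix_append)
        then have "v \<noteq> []" using \<open>\<not> prefix q (shift_fst z s)\<close> by auto
        then have "map fst v \<noteq> []" by simp
        then have "shift z p \<noteq> shift z (map fst s) @ map fst v"
          by (rule shift_append_neq[OF p(1) sG(2)])
        then show False using v p(2) by simp
      qed
      moreover have "q \<noteq> []" using p Nil_notin_Gam[of 1 \<xi>] by auto
      ultimately show "q \<in> shift_fst z ` {q. q \<noteq> [] \<and> prefix q s}" by (auto simp: prefix_shift_fst)
    next
      fix q assume "q \<in> shift_fst z ` {q. q \<noteq> [] \<and> prefix q s}"
      then obtain p where p: "q = shift_fst z p" "p \<noteq> []" "prefix p s" by blast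
      have "map fst p \<in> Gam \<xi> 1" by (rule Gam_fst_prefix[OF order_refl sG(1) p(2,3)])
      moreover have "snd ` set p \<subseteq> D" using s set_mono_prefix[OF p(3)] by (auto simp: tree_prod_iff)
      moreover have pq: "prefix q (shift_fst z s @ t)" using p(1,3) by (auto simp: prefix_def)
      ultimately show "q \<in> {q \<in> tree_prod (Lam \<xi> (n + 1) 1) D. prefix q (shift_fst z s @ t)}"
        using p pq by (auto simp: tree_prod_iff Lam_first z)
    qed
    have "block_sum D \<xi> (n + 1) x (shift_fst z s @ t) 1 =
      (\<Sum>q\<in>{q. q \<noteq> [] \<and> prefix q s}. Prob \<xi> (n + 1) (shift z (map fst q)) *\<^sub>R x (shift_fst z q))"
      unfolding block_sum_def eq by (subst sum.reindex) (auto simp: inj_on_subset[OF inj_shift_fst])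
    also have "\<dots> = branch_sum (Prob \<xi> 1) (\<lambda>q. x (shift_fst z q)) s"
      unfolding branch_sum_def
      by (intro sum.cong refl) (auto simp: z Prob_first[OF n] Gam_fst_prefix[OF order_refl sG(1)])
    finally show ?thesis .
  qed
  have later: "block_sum D \<xi> (n + 1) x (shift_fst z s @ t) (i + 1) = block_sum D \<xi> n (\<lambda>q. x (shift_fst z s @ q)) t i"
    if i: "i \<ge> 1" for i
  proof -
    have eq: "{q \<in> tree_prod (Lam \<xi> (n + 1) (i + 1)) D. prefix q (shift_fst z s @ t)} =
      (\<lambda>q. shift_fst z s @ q) ` {q \<in> tree_prod (Lam \<xi> n i) D. prefix q t}"
    proof (intro equalityI subsetI)
      fix q assume "q \<in> {q \<in> tree_prod (Lam \<xi> (n + 1) (i + 1)) D. prefix q (shift_fst z s @ t)}"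
      then obtain p v where p: "p \<in> maximal (Gam \<xi> 1)" "v \<in> Lam \<xi> n i" "map fst q = shift z p @ v"
        and pr: "prefix q (shift_fst z s @ t)" and qD: "snd ` set q \<subseteq> D"
        by (auto simp: tree_prod_iff Lam_later[OF n i] z)
      obtain w where w: "shift z (map fst s) @ map fst t = shift z p @ v @ w"
        using map_mono_prefix[OF pr, of fst] p(3) by (auto simp: prefix_def)
      have ps: "map fst s = p" "map fst t = v @ w" using shift_append_decomp[OF sG(2) p(1) w] by auto
      have vn: "v \<noteq> []" using Lam_subset[OF p(2)] Nil_notin_Gam[OF n] by metis
      have "\<not> prefix q (shift_fst z s)"
      proof
        assume "prefix q (shift_fst z s)"
        then have "length q \<le> length s" using prefix_length_le by fastforce
        moreover have "length q = length p + length v"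
          by (metis p(3) length_map length_append shift_def)
        ultimately show False using vn ps(1) by auto
      qed
      then obtain q' where q': "q = shift_fst z s @ q'" "prefix q' t" using pr by (auto simp: prefix_append)
      then have "map fst q' = v" using p(3) ps(1) by auto
      then show "q \<in> (\<lambda>q. shift_fst z s @ q) ` {q \<in> tree_prod (Lam \<xi> n i) D. prefix q t}"
        using q' p(2) qD by (auto simp: tree_prod_iff)
    next
      fix q assume "q \<in> (\<lambda>q. shift_fst z s @ q) ` {q \<in> tree_prod (Lam \<xi> n i) D. prefix q t}"
      then obtain p where p: "q = shift_fst z s @ p" "map fst p \<in> Lam \<xi> n i" "snd ` set p \<subseteq> D" "prefix p t"
        by (auto simp: tree_prod_iff)
      then have "map fst q \<in> Lam \<xi> (n + 1) (i + 1)"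
        unfolding Lam_later[OF n i] using sG(2) z by auto
      moreover have "snd ` set q \<subseteq> D" using p s by (auto simp: tree_prod_iff image_Un)
      ultimately show "q \<in> {q \<in> tree_prod (Lam \<xi> (n + 1) (i + 1)) D. prefix q (shift_fst z s @ t)}"
        using p by (auto simp: tree_prod_iff)
    qed
    have "block_sum D \<xi> (n + 1) x (shift_fst z s @ t) (i + 1) =
      (\<Sum>q\<in>{q \<in> tree_prod (Lam \<xi> n i) D. prefix q t}.
         Prob \<xi> (n + 1) (shift z (map fst s) @ map fst q) *\<^sub>R x (shift_fst z s @ q))"
      unfolding block_sum_def eq by (subst sum.reindex) (auto simp: inj_on_def)
    also have "\<dots> = block_sum D \<xi> n (\<lambda>q. x (shift_fst z s @ q)) t i"
      unfolding block_sum_def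
      by (intro sum.cong refl) (auto simp: z Prob_later[OF n sG(2)] tree_prod_iff Lam_subset)
    finally show ?thesis .
  qed
  have "1 < Suc (n + 1)" by simp
  then have "[1..<n + 1 + 1] = 1 # map Suc [1..<n + 1]"
    by (metis Suc_eq_plus1 map_Suc_upt upt_conv_Cons)
  then show ?thesis using first later by (simp add: block_sums_def flip: Suc_eq_plus1 del: upt_Suc)
qed

lemma Gam_Suc_image:
  assumes n: "n \<ge> 1"
  shows "Gam \<xi> (n + 1) = shift (omega_pow \<xi> * ordinal_of_nat n) ` Gam \<xi> 1 \<union>
     {shift (omega_pow \<xi> * ordinal_of_nat n) s @ u | s u. s \<in> maximal (Gam \<xi> 1) \<and> u \<in> Gam \<xi> n}"
  unfolding Gam_Suc[OF n] by (rule arg_cong2[where f = "(\<union>)"]) auto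

lemma maximal_Gam_Suc:
  assumes n: "n \<ge> 1"
  shows "maximal (Gam \<xi> (n + 1)) = {shift (omega_pow \<xi> * ordinal_of_nat n) s @ u | s u.
     s \<in> maximal (Gam \<xi> 1) \<and> u \<in> maximal (Gam \<xi> n)}"
  unfolding Gam_Suc_image[OF n] by (rule maximal_concat[OF Gam_nonempty[OF n] Nil_notin_Gam[OF n]])

lemma tree_prod_concat:
  assumes "t \<in> tree_prod {shift z s @ u | s u. s \<in> S \<and> u \<in> T} D"
  obtains s u where "t = shift_fst z s @ u" "s \<in> tree_prod S D" "u \<in> tree_prod T D"
proof -
  from assms obtain s' u' where su: "s' \<in> S" "u' \<in> T" "map fst t = shift z s' @ u'"
    by (auto simp: tree_prod_iff)
  define t1 t2 where "t1 = take (length s') t" and "t2 = drop (length s') t"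
  have t12: "t = t1 @ t2" by (simp add: t1_def t2_def)
  have l: "length (shift z s') = length s'" by (simp add: shift_def)
  have f: "map fst t1 = shift z s'" "map fst t2 = u'"
    using su(3) l by (simp_all add: t1_def t2_def take_map[symmetric] drop_map[symmetric])
  then obtain q where q: "t1 = shift_fst z q" "map fst q = s'" "map snd q = map snd t1"
    using ex_shift_fst[of t1 z s'] by blast
  show ?thesis
    by (rule that[of q t2]) (use t12 q su f assms in \<open>auto simp: tree_prod_iff image_Un\<close>)
qed

lemma tree_prod_concatI:
  assumes "s \<in> tree_prod S D" "u \<in> tree_prod T D"
  shows "shift_fst z s @ u \<in> tree_prod {shift z s @ u | s u. s \<in> S \<and> u \<in> T} D"
  using assms by (auto simp: tree_prod_iff image_Un)

lemma branch_sum_Gam_Suc: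
  assumes n: "n \<ge> 1" and s: "s \<in> tree_prod (maximal (Gam \<xi> 1)) D" and t: "t \<in> tree_prod (Gam \<xi> n) D"
    and z: "z = omega_pow \<xi> * ordinal_of_nat n"
  shows "branch_sum (Prob \<xi> (n + 1)) x (shift_fst z s @ t) =
    branch_sum (Prob \<xi> 1) (\<lambda>q. x (shift_fst z q)) s + branch_sum (Prob \<xi> n) (\<lambda>q. x (shift_fst z s @ q)) t"
proof -
  have sG: "map fst s \<in> Gam \<xi> 1" "map fst s \<in> maximal (Gam \<xi> 1)"
    using s maximal_subset by (auto simp: tree_prod_iff)
  have tG: "map fst t \<in> Gam \<xi> n" using t by (simp add: tree_prod_iff)
  show ?thesis unfolding branch_sum_append branch_sum_shift_fst
    by (intro arg_cong2[where f = "(+)"] branch_sum_cong)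
      (auto simp: z Prob_first[OF n] Prob_later[OF n sG(2)] Gam_fst_prefix[OF order_refl sG(1)]
        Gam_fst_prefix[OF n tG])
qed

lemma branch_sum_eq_sum_block_sums:
  "n \<ge> 1 \<Longrightarrow> t \<in> tree_prod (maximal (Gam \<xi> n)) D \<Longrightarrow>
    branch_sum (Prob \<xi> n) x t = sum_list (block_sums D \<xi> n x t)"
proof (induction n arbitrary: t x rule: dec_induct)
  case base
  then have "t \<in> tree_prod (Gam \<xi> 1) D" by (auto simp: tree_prod_iff maximal_subset)
  then show ?case by (simp add: block_sums_1)
next
  case (step n)
  have "t \<in> tree_prod (maximal (Gam \<xi> (n + 1))) D" using step(4) by (metis Suc_eq_plus1)
  then obtain s u where su: "t = shift_fst (omega_pow \<xi> * ordinal_of_nat n) s @ u"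
    "s \<in> tree_prod (maximal (Gam \<xi> 1)) D" "u \<in> tree_prod (maximal (Gam \<xi> n)) D"
    unfolding maximal_Gam_Suc[OF step(1)] by (rule tree_prod_concat)
  have "u \<in> tree_prod (Gam \<xi> n) D" using su(3) by (auto simp: tree_prod_iff maximal_subset)
  then show ?case unfolding Suc_eq_plus1
    using branch_sum_Gam_Suc[OF step(1) su(2) _ refl, of u x] block_sums_Suc[OF step(1) su(2) _ refl, of u x]
      step(3)[OF su(3)] su(1) by simp
qed

lemma branch_sum_succ:
  assumes n: "n \<ge> 1" and t: "t \<in> tree_prod (maximal (Gam \<xi> n)) D"
  shows "branch_sum (Prob (osucc \<xi>) 1) x t = inverse (real n) *\<^sub>R sum_list (block_sums D \<xi> n x t)"
proof -
  have tG: "map fst t \<in> Gam \<xi> n" using t by (auto simp: tree_prod_iff maximal_subset)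
  have "branch_sum (Prob (osucc \<xi>) 1) x t = inverse (real n) *\<^sub>R branch_sum (Prob \<xi> n) x t"
    unfolding branch_sum_def scaleR_sum_right
    by (intro sum.cong refl)
      (auto simp: Prob_succ[OF n] Gam_fst_prefix[OF n tG] divide_inverse mult.commute)
  then show ?thesis using branch_sum_eq_sum_block_sums[OF n t] by metis
qed

lemma branch_sum_limit:
  assumes "limit_ordinal \<xi>" "\<zeta> < \<xi>" "t \<in> tree_prod (Gam (osucc \<zeta>) 1) D"
  shows "branch_sum (Prob \<xi> 1) x (shift_fst (omega_pow \<zeta>) t) =
    branch_sum (Prob (osucc \<zeta>) 1) (\<lambda>q. x (shift_fst (omega_pow \<zeta>) q)) t"
proof -
  have tG: "map fst t \<in> Gam (osucc \<zeta>) 1" using assms by (simp add: tree_prod_iff)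
  show ?thesis unfolding branch_sum_shift_fst
    by (intro branch_sum_cong) (auto simp: Prob_limit[OF assms(1,2)] Gam_fst_prefix[OF order_refl tG])
qed

section \<open>Large sets\<close>

text \<open>
  The \<open>n\<close>-fold product of a family \<open>L\<close> of sets of vectors: a set \<open>E\<close> of lists belongs to it iff for
  \<open>L\<close>-many \<open>z\<^sub>1\<close>, for \<open>L\<close>-many \<open>z\<^sub>2\<close>, and so on, the list \<open>[z\<^sub>1, \<dots>, z\<^sub>n]\<close> is in \<open>E\<close>.
\<close>
primrec nest :: "('x set \<Rightarrow> bool) \<Rightarrow> nat \<Rightarrow> 'x list set \<Rightarrow> bool" where
  "nest L 0 E \<longleftrightarrow> [] \<in> E"
| "nest L (Suc n) E \<longleftrightarrow> L {z. nest L n {l. z # l \<in> E}}"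

text \<open>
  The sets that contain all averages \<open>\<Sum>\<^bsub>s \<le> t\<^esub> \<bbbP>\<^bsub>\<xi>,1\<^esub>(s) x\<^sub>s\<close> of some collection on \<open>\<Gamma>\<^bsub>\<xi>,1\<^esub>.D\<close>, described by
  recursion on \<open>\<xi>\<close> without reference to trees, when \<open>L\<close> is the family of these sets for \<open>\<xi> = 0\<close>.  At a
  successor \<open>\<eta> + 1\<close>, for every \<open>n\<close> the means of \<open>n\<close> consecutive averages of order \<open>\<eta>\<close> have to be in \<open>E\<close>.
\<close>
function Large :: "('x::real_vector set \<Rightarrow> bool) \<Rightarrow> 'o ordinal \<Rightarrow> 'x set \<Rightarrow> bool" where
  "Large L \<xi> E \<longleftrightarrow>
    (if \<xi> = 0 then L E
     else if limit_ordinal \<xi> then \<forall>\<zeta>\<in>{..<\<xi>}. Large L (osucc \<zeta>) E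
     else \<forall>n\<in>{1..}. nest (\<lambda>S. Large L (opred \<xi>) S) n {l. inverse (real n) *\<^sub>R sum_list l \<in> E})"
  by auto
termination
  by (relation "inv_image {(x, y). x < y} (\<lambda>(L, \<xi>, E). \<xi>)")
    (auto simp: wf limit_ordinal_osucc_less limit_ordinal_def)

declare Large.simps [simp del]

lemma Large_0: "Large L 0 E \<longleftrightarrow> L E"
  by (simp add: Large.simps)

lemma Large_limit: "limit_ordinal \<xi> \<Longrightarrow> Large L \<xi> E \<longleftrightarrow> (\<forall>\<zeta><\<xi>. Large L (osucc \<zeta>) E)"
  by (subst Large.simps) (auto simp: limit_ordinal_def)

lemma Large_succ: "Large L (osucc \<xi>) E \<longleftrightarrow>
    (\<forall>n\<ge>1. nest (Large L \<xi>) n {l. inverse (real n) *\<^sub>R sum_list l \<in> E})"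
  by (subst Large.simps) (auto simp: limit_ordinal_def)

lemma nest_1: "nest L 1 E \<longleftrightarrow> L {z. [z] \<in> E}"
  by (simp add: One_nat_def)

lemma nest_plus_1: "nest L (n + 1) E \<longleftrightarrow> L {z. nest L n {l. z # l \<in> E}}"
  by (simp flip: Suc_eq_plus1)

text \<open>
  The tree version of \<open>nest (Large L \<xi>) n E\<close>: some collection on \<open>\<Gamma>\<^bsub>\<xi>,n\<^esub>.D\<close> has its lists of block sums
  over all maximal branches in \<open>E\<close>.
\<close>
definition realizes where
  "realizes null D \<xi> n E \<longleftrightarrow>
    (\<exists>x. collection null D (Gam \<xi> n) x \<and> (\<forall>t\<in>tree_prod (maximal (Gam \<xi> n)) D. block_sums D \<xi> n x t \<in> E))"

lemma block_sums_1_maximal: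
  "t \<in> tree_prod (maximal (Gam \<xi> 1)) D \<Longrightarrow> block_sums D \<xi> 1 x t = [branch_sum (Prob \<xi> 1) x t]"
  by (rule block_sums_1) (auto simp: tree_prod_iff maximal_subset)

lemma realizes_1: "realizes null D \<xi> 1 E \<longleftrightarrow>
    (\<exists>x. collection null D (Gam \<xi> 1) x \<and> (\<forall>t\<in>tree_prod (maximal (Gam \<xi> 1)) D. [branch_sum (Prob \<xi> 1) x t] \<in> E))"
  by (simp add: realizes_def block_sums_1_maximal)

lemma realizes_limit:
  fixes null :: "('d \<Rightarrow> 'x::real_vector) \<Rightarrow> bool" and \<xi> :: "'o ordinal"
  assumes lim: "limit_ordinal \<xi>"
  shows "realizes null D \<xi> 1 E \<longleftrightarrow> (\<forall>\<zeta><\<xi>. realizes null D (osucc \<zeta>) 1 E)"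
proof
  let ?z = "omega_pow"
  have max: "maximal (Gam \<xi> 1) = (\<Union>\<zeta>\<in>{..<\<xi>}. shift (?z \<zeta>) ` maximal (Gam (osucc \<zeta>) 1))"
    unfolding Gam_limit[OF lim] using Gam_limit_hd_disjoint Nil_notin_Gam[OF order_refl]
    by (intro maximal_union) blast+
  show "\<forall>\<zeta><\<xi>. realizes null D (osucc \<zeta>) 1 E" if E: "realizes null D \<xi> 1 E"
  proof (intro allI impI)
    fix \<zeta> assume \<zeta>: "\<zeta> < \<xi>"
    from E obtain x where x: "collection null D (Gam \<xi> 1) x"
      "\<forall>t\<in>tree_prod (maximal (Gam \<xi> 1)) D. [branch_sum (Prob \<xi> 1) x t] \<in> E"
      unfolding realizes_1 by blast
    have "collection null D (Gam (osucc \<zeta>) 1) (\<lambda>t. x (shift_fst (?z \<zeta>) t))"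
      using collection_sub[OF x(1)] Gam_limit[OF lim] \<zeta> by auto
    moreover have "[branch_sum (Prob (osucc \<zeta>) 1) (\<lambda>t. x (shift_fst (?z \<zeta>) t)) t] \<in> E"
      if t: "t \<in> tree_prod (maximal (Gam (osucc \<zeta>) 1)) D" for t
    proof -
      have "t \<in> tree_prod (Gam (osucc \<zeta>) 1) D" using t by (auto simp: tree_prod_iff maximal_subset)
      moreover have "shift_fst (?z \<zeta>) t \<in> tree_prod (maximal (Gam \<xi> 1)) D"
        using t \<zeta> unfolding max by (auto simp: tree_prod_iff)
      ultimately show ?thesis using x(2) branch_sum_limit[OF lim \<zeta>] by metis
    qed
    ultimately show "realizes null D (osucc \<zeta>) 1 E" unfolding realizes_1 by blast
  qed
  show "realizes null D \<xi> 1 E" if E: "\<forall>\<zeta><\<xi>. realizes null D (osucc \<zeta>) 1 E"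
  proof -
    from E have "\<forall>\<zeta>. \<exists>x. \<zeta> < \<xi> \<longrightarrow> collection null D (Gam (osucc \<zeta>) 1) x \<and>
       (\<forall>t\<in>tree_prod (maximal (Gam (osucc \<zeta>) 1)) D. [branch_sum (Prob (osucc \<zeta>) 1) x t] \<in> E)"
      unfolding realizes_1 by blast
    then obtain y where y: "\<And>\<zeta>. \<zeta> < \<xi> \<Longrightarrow> collection null D (Gam (osucc \<zeta>) 1) (y \<zeta>)"
       "\<And>\<zeta> t. \<zeta> < \<xi> \<Longrightarrow> t \<in> tree_prod (maximal (Gam (osucc \<zeta>) 1)) D \<Longrightarrow>
          [branch_sum (Prob (osucc \<zeta>) 1) (y \<zeta>) t] \<in> E"
      by metis
    obtain x where x: "collection null D (\<Union>\<zeta>\<in>{..<\<xi>}. shift (?z \<zeta>) ` Gam (osucc \<zeta>) 1) x"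
      "\<And>\<zeta> t. \<zeta> \<in> {..<\<xi>} \<Longrightarrow> map fst t \<in> Gam (osucc \<zeta>) 1 \<Longrightarrow> x (shift_fst (?z \<zeta>) t) = y \<zeta> t"
    proof (rule collection_union[of "{..<\<xi>}" "\<lambda>\<zeta>. Gam (osucc \<zeta>) 1" ?z null D y])
      show "[] \<notin> Gam (osucc \<zeta>) 1" for \<zeta> :: "'o ordinal" by (rule Nil_notin_Gam) simp
      show "i = j" if "s \<in> Gam (osucc i) 1" "t \<in> Gam (osucc j) 1" "?z i + hd s = ?z j + hd t"
        for i j and s t :: "'o ordinal list" using that by (rule Gam_limit_hd_disjoint)
      show "collection null D (Gam (osucc i) 1) (y i)" if "i \<in> {..<\<xi>}" for i using y that by simp
    qed blast
    have "[branch_sum (Prob \<xi> 1) x t] \<in> E" if t: "t \<in> tree_prod (maximal (Gam \<xi> 1)) D" for t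
    proof -
      from t obtain \<zeta> p where p: "\<zeta> < \<xi>" "p \<in> maximal (Gam (osucc \<zeta>) 1)" "map fst t = shift (?z \<zeta>) p"
        unfolding max by (auto simp: tree_prod_iff)
      from ex_shift_fst[OF p(3)] obtain q where q: "t = shift_fst (?z \<zeta>) q" "map fst q = p" by blast
      have qm: "q \<in> tree_prod (maximal (Gam (osucc \<zeta>) 1)) D"
        using p q t by (auto simp: tree_prod_iff)
      then have qG: "q \<in> tree_prod (Gam (osucc \<zeta>) 1) D" by (auto simp: tree_prod_iff maximal_subset)
      then have fG: "map fst q \<in> Gam (osucc \<zeta>) 1" by (simp add: tree_prod_iff)
      have "branch_sum (Prob \<xi> 1) x t = branch_sum (Prob (osucc \<zeta>) 1) (y \<zeta>) q"
        unfolding q(1) branch_sum_limit[OF lim p(1) qG]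
        by (intro branch_sum_cong) (auto simp: x(2) p(1) Gam_fst_prefix[OF order_refl fG])
      then show ?thesis using y(2)[OF p(1) qm] by simp
    qed
    then show ?thesis unfolding realizes_1 using x(1) Gam_limit[OF lim] by metis
  qed
qed

lemma realizes_succ:
  "realizes null D (osucc \<xi>) 1 E \<longleftrightarrow>
    (\<forall>n\<ge>1. realizes null D \<xi> n {l. [inverse (real n) *\<^sub>R sum_list l] \<in> E})"
proof
  have un: "Gam (osucc \<xi>) 1 = (\<Union>n\<in>{1..}. shift 0 ` Gam \<xi> n)" by (simp add: Gam_osucc)
  have max: "maximal (Gam (osucc \<xi>) 1) = (\<Union>n\<in>{1..}. shift 0 ` maximal (Gam \<xi> n))"
    unfolding un using Gam_hd_disjoint Nil_notin_Gam
    by (intro maximal_union) (auto, blast)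
  show "\<forall>n\<ge>1. realizes null D \<xi> n {l. [inverse (real n) *\<^sub>R sum_list l] \<in> E}"
    if E: "realizes null D (osucc \<xi>) 1 E"
  proof (intro allI impI)
    fix n :: nat assume n: "n \<ge> 1"
    from E obtain x where x: "collection null D (Gam (osucc \<xi>) 1) x"
      "\<forall>t\<in>tree_prod (maximal (Gam (osucc \<xi>) 1)) D. [branch_sum (Prob (osucc \<xi>) 1) x t] \<in> E"
      unfolding realizes_1 by blast
    have "collection null D (Gam \<xi> n) x"
      using collection_sub[OF x(1), of 0 "Gam \<xi> n"] un n by auto
    moreover have "[inverse (real n) *\<^sub>R sum_list (block_sums D \<xi> n x t)] \<in> E"
      if t: "t \<in> tree_prod (maximal (Gam \<xi> n)) D" for t
    proof -
      have "t \<in> tree_prod (maximal (Gam (osucc \<xi>) 1)) D"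
        using t n unfolding max by (auto simp: tree_prod_iff)
      then show ?thesis using x(2) branch_sum_succ[OF n t] by metis
    qed
    ultimately show "realizes null D \<xi> n {l. [inverse (real n) *\<^sub>R sum_list l] \<in> E}"
      unfolding realizes_def by blast
  qed
  show "realizes null D (osucc \<xi>) 1 E"
    if E: "\<forall>n\<ge>1. realizes null D \<xi> n {l. [inverse (real n) *\<^sub>R sum_list l] \<in> E}"
  proof -
    from E have "\<forall>n. \<exists>x. n \<ge> 1 \<longrightarrow> collection null D (Gam \<xi> n) x \<and>
       (\<forall>t\<in>tree_prod (maximal (Gam \<xi> n)) D. [inverse (real n) *\<^sub>R sum_list (block_sums D \<xi> n x t)] \<in> E)"
      unfolding realizes_def by blast
    then obtain y where y: "\<And>n. n \<ge> 1 \<Longrightarrow> collection null D (Gam \<xi> n) (y n)"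
       "\<And>n t. n \<ge> 1 \<Longrightarrow> t \<in> tree_prod (maximal (Gam \<xi> n)) D \<Longrightarrow>
          [inverse (real n) *\<^sub>R sum_list (block_sums D \<xi> n (y n) t)] \<in> E"
      by metis
    obtain x where x: "collection null D (\<Union>n\<in>{1..}. shift 0 ` Gam \<xi> n) x"
      "\<And>n t. n \<in> {1..} \<Longrightarrow> map fst t \<in> Gam \<xi> n \<Longrightarrow> x (shift_fst 0 t) = y n t"
    proof (rule collection_union[of "{1..}" "Gam \<xi>" "\<lambda>_. 0" null D y])
      show "[] \<notin> Gam \<xi> n" if "n \<in> {1..}" for n using that Nil_notin_Gam by auto
      show "i = j" if "i \<in> {1..}" "j \<in> {1..}" "s \<in> Gam \<xi> i" "t \<in> Gam \<xi> j" "0 + hd s = 0 + hd t"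
        for i j s t using that Gam_hd_disjoint by auto
      show "collection null D (Gam \<xi> i) (y i)" if "i \<in> {1..}" for i using y that by simp
    qed blast
    have "[branch_sum (Prob (osucc \<xi>) 1) x t] \<in> E"
      if t: "t \<in> tree_prod (maximal (Gam (osucc \<xi>) 1)) D" for t
    proof -
      from t obtain n where n: "n \<ge> 1" "t \<in> tree_prod (maximal (Gam \<xi> n)) D"
        unfolding max by (auto simp: tree_prod_iff)
      then have fG: "map fst t \<in> Gam \<xi> n" by (auto simp: tree_prod_iff maximal_subset)
      have "branch_sum (Prob (osucc \<xi>) 1) x t = branch_sum (Prob (osucc \<xi>) 1) (y n) t"
        using x(2)[of n] n(1) by (intro branch_sum_cong) (auto simp: Gam_fst_prefix[OF n(1) fG])
      then show ?thesis using y(2)[OF n] branch_sum_succ[OF n, of "y n"] by simp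
    qed
    then show ?thesis unfolding realizes_1 using x(1) un by metis
  qed
qed

lemma realizes_step:
  assumes n: "n \<ge> 1"
  shows "realizes null D \<xi> (n + 1) E \<longleftrightarrow>
    realizes null D \<xi> 1 {l. \<exists>z\<in>{z. realizes null D \<xi> n {l. z # l \<in> E}}. l = [z]}"
    (is "_ \<longleftrightarrow> realizes null D \<xi> 1 ?F")
proof
  define z where "z = omega_pow \<xi> * ordinal_of_nat n"
  have G: "Gam \<xi> (n + 1) = shift z ` Gam \<xi> 1 \<union>
     {shift z s @ u | s u. s \<in> maximal (Gam \<xi> 1) \<and> u \<in> Gam \<xi> n}"
    unfolding z_def by (rule Gam_Suc_image[OF n])
  have max: "maximal (Gam \<xi> (n + 1)) =
     {shift z s @ u | s u. s \<in> maximal (Gam \<xi> 1) \<and> u \<in> maximal (Gam \<xi> n)}"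
    unfolding maximal_Gam_Suc[OF n] z_def ..
  have mG: "t \<in> tree_prod (Gam \<xi> m) D" if "t \<in> tree_prod (maximal (Gam \<xi> m)) D" for t m
    using that by (auto simp: tree_prod_iff maximal_subset)
  show "realizes null D \<xi> 1 ?F" if E: "realizes null D \<xi> (n + 1) E"
  proof -
    from E obtain x where x: "collection null D (Gam \<xi> (n + 1)) x"
      "\<forall>t\<in>tree_prod (maximal (Gam \<xi> (n + 1))) D. block_sums D \<xi> (n + 1) x t \<in> E"
      unfolding realizes_def by blast
    have "collection null D (Gam \<xi> 1) (\<lambda>t. x (shift_fst z t))"
      by (rule collection_sub[OF x(1)]) (simp add: G)
    moreover have "realizes null D \<xi> n {l. branch_sum (Prob \<xi> 1) (\<lambda>t. x (shift_fst z t)) s # l \<in> E}"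
      if s: "s \<in> tree_prod (maximal (Gam \<xi> 1)) D" for s
    proof -
      have "collection null D (Gam \<xi> n) (\<lambda>t. x (shift_fst z s @ t))"
        by (rule collection_after[OF x(1)]) (use s G in \<open>auto simp: tree_prod_iff\<close>)
      moreover have "branch_sum (Prob \<xi> 1) (\<lambda>t. x (shift_fst z t)) s # block_sums D \<xi> n (\<lambda>t. x (shift_fst z s @ t)) t \<in> E"
        if t: "t \<in> tree_prod (maximal (Gam \<xi> n)) D" for t
      proof -
        have "shift_fst z s @ t \<in> tree_prod (maximal (Gam \<xi> (n + 1))) D"
          unfolding max by (rule tree_prod_concatI[OF s t])
        then show ?thesis using x(2) block_sums_Suc[OF n s mG[OF t] z_def] by metis
      qed
      ultimately show ?thesis unfolding realizes_def by blast
    qed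
    ultimately show ?thesis unfolding realizes_1 by auto
  qed
  show "realizes null D \<xi> (n + 1) E" if F: "realizes null D \<xi> 1 ?F"
  proof -
    from F obtain y where y: "collection null D (Gam \<xi> 1) y"
      "\<forall>s\<in>tree_prod (maximal (Gam \<xi> 1)) D. realizes null D \<xi> n {l. branch_sum (Prob \<xi> 1) y s # l \<in> E}"
      unfolding realizes_1 by auto
    from y(2) have "\<forall>s. \<exists>w. s \<in> tree_prod (maximal (Gam \<xi> 1)) D \<longrightarrow> collection null D (Gam \<xi> n) w \<and>
      (\<forall>t\<in>tree_prod (maximal (Gam \<xi> n)) D. branch_sum (Prob \<xi> 1) y s # block_sums D \<xi> n w t \<in> E)"
      unfolding realizes_def by blast
    then obtain w where w: "\<And>s. s \<in> tree_prod (maximal (Gam \<xi> 1)) D \<Longrightarrow> collection null D (Gam \<xi> n) (w s)"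
      "\<And>s t. s \<in> tree_prod (maximal (Gam \<xi> 1)) D \<Longrightarrow> t \<in> tree_prod (maximal (Gam \<xi> n)) D \<Longrightarrow>
         branch_sum (Prob \<xi> 1) y s # block_sums D \<xi> n (w s) t \<in> E"
      by metis
    obtain x where x: "collection null D (Gam \<xi> (n + 1)) x"
      "\<And>t. map fst t \<in> Gam \<xi> 1 \<Longrightarrow> x (shift_fst z t) = y t"
      "\<And>s t. map fst s \<in> maximal (Gam \<xi> 1) \<Longrightarrow> map fst t \<in> Gam \<xi> n \<Longrightarrow> x (shift_fst z s @ t) = w s t"
      unfolding G by (rule collection_concat[OF Nil_notin_Gam[OF n] y(1) w(1)]) blast+
    have "block_sums D \<xi> (n + 1) x t \<in> E" if tm: "t \<in> tree_prod (maximal (Gam \<xi> (n + 1))) D" for t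
    proof -
      obtain s u where su: "t = shift_fst z s @ u" "s \<in> tree_prod (maximal (Gam \<xi> 1)) D"
        "u \<in> tree_prod (maximal (Gam \<xi> n)) D"
        using tm unfolding max by (rule tree_prod_concat)
      have sG: "map fst s \<in> Gam \<xi> 1" "map fst s \<in> maximal (Gam \<xi> 1)"
        using su(2) by (auto simp: tree_prod_iff maximal_subset)
      have 1: "branch_sum (Prob \<xi> 1) (\<lambda>q. x (shift_fst z q)) s = branch_sum (Prob \<xi> 1) y s"
        by (intro branch_sum_cong refl x(2) Gam_fst_prefix[OF order_refl sG(1)])
      have 2: "block_sums D \<xi> n (\<lambda>q. x (shift_fst z s @ q)) u = block_sums D \<xi> n (w s) u"
        unfolding block_sums_def block_sum_def
        by (intro map_cong refl sum.cong) (auto simp: x(3) sG tree_prod_iff Lam_subset)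
      show ?thesis
        using block_sums_Suc[OF n su(2) mG[OF su(3)] z_def, of x] 1 2 w(2)[OF su(2,3)] su(1) by simp
    qed
    then show ?thesis unfolding realizes_def using x(1) by blast
  qed
qed

text \<open>
  The recursion for large sets mirrors the recursion for the trees, so both descriptions agree.
\<close>
lemma realizes_iff:
  fixes null :: "('d \<Rightarrow> 'x::real_vector) \<Rightarrow> bool" and \<xi> :: "'o ordinal"
  assumes "n \<ge> 1"
  shows "realizes null D \<xi> n E \<longleftrightarrow> nest (Large (\<lambda>E. \<exists>g. null g \<and> g ` D \<subseteq> E) \<xi>) n E"
  using assms
proof (induction \<xi> n arbitrary: E rule: Gam_induct)
  case zero
  have max: "maximal {[0 :: 'o ordinal]} = {[0]}" by (auto simp: maximal_def)
  have tp: "tree_prod {[0 :: 'o ordinal]} D = (\<lambda>u. [(0, u)]) ` D"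
    by (auto simp: tree_prod_def map_eq_Cons_conv)
  have sm: "branch_sum (Prob 0 1) x [(0 :: 'o ordinal, u)] = x [(0, u)]"
    for x :: "('o ordinal \<times> 'd) list \<Rightarrow> 'x" and u
  proof -
    have "{s. s \<noteq> [] \<and> prefix s [(0 :: 'o ordinal, u)]} = {[(0, u)]}" by (auto simp: prefix_Cons)
    then show ?thesis by (simp add: branch_sum_def Prob_zero)
  qed
  have co: "collection null D {[0 :: 'o ordinal]} x \<longleftrightarrow> null (\<lambda>u. x [(0, u)])"
    for x :: "('o ordinal \<times> 'd) list \<Rightarrow> 'x"
    by (auto simp: collection_def)
  show ?case
    unfolding realizes_1 Gam_0 max tp co nest_1 Large_0 using sm
    by (auto 0 3 intro: exI[of _ "\<lambda>t. g (snd (hd t))" for g])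
next
  case (limit \<xi>)
  then show ?case by (simp add: realizes_limit[OF limit(1)] nest_1 Large_limit[OF limit(1)])
next
  case (succ \<xi>)
  then show ?case by (simp add: realizes_succ nest_1 Large_succ)
next
  case (step \<xi> n)
  then show ?case by (simp add: realizes_step nest_1 nest_plus_1 del: add_Suc_right)
qed

section \<open>Partition regularity\<close>

text \<open>
  A family of sets is closed under supersets.  The members of such a family are called large below.
\<close>
definition upclosed :: "('a set \<Rightarrow> bool) \<Rightarrow> bool" where
  "upclosed L \<longleftrightarrow> (\<forall>E F. L E \<longrightarrow> E \<subseteq> F \<longrightarrow> L F)"

text \<open>
  If a large set is split into two pieces, then one of the pieces is large.  This replaces the
  Ramsey-type stabilisation arguments for functions on the maximal branches of the trees.
\<close>
definition partition_regular :: "('a set \<Rightarrow> bool) \<Rightarrow> bool" where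
  "partition_regular L \<longleftrightarrow> (\<forall>E F. L (E \<union> F) \<longrightarrow> L E \<or> L F)"

lemma upclosedD: "upclosed L \<Longrightarrow> L E \<Longrightarrow> E \<subseteq> F \<Longrightarrow> L F"
  unfolding upclosed_def by blast

lemma nest_upclosed: "upclosed L \<Longrightarrow> upclosed (nest L n)"
proof (induction n)
  case (Suc n)
  show ?case unfolding upclosed_def
  proof (intro allI impI)
    fix E F :: "'a list set" assume *: "nest L (Suc n) E" "E \<subseteq> F"
    have "{z. nest L n {l. z # l \<in> E}} \<subseteq> {z. nest L n {l. z # l \<in> F}}"
    proof
      fix z assume "z \<in> {z. nest L n {l. z # l \<in> E}}"
      then have "nest L n {l. z # l \<in> E}" by simp
      then have "nest L n {l. z # l \<in> F}"
        by (rule upclosedD[OF Suc.IH[OF Suc.prems]]) (use * in auto)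
      then show "z \<in> {z. nest L n {l. z # l \<in> F}}" by simp
    qed
    then show "nest L (Suc n) F" using upclosedD[OF Suc.prems] * by simp
  qed
qed (auto simp: upclosed_def)

lemma nest_mono: "upclosed L \<Longrightarrow> nest L n E \<Longrightarrow> E \<subseteq> F \<Longrightarrow> nest L n F"
  using nest_upclosed upclosedD by blast

lemma nest_mono_family:
  assumes "\<And>E. L E \<Longrightarrow> L' E" "upclosed L'"
  shows "nest L n E \<Longrightarrow> nest L' n E"
proof (induction n arbitrary: E)
  case (Suc n)
  have "L' {z. nest L n {l. z # l \<in> E}}" using Suc.prems assms(1) by simp
  then have "L' {z. nest L' n {l. z # l \<in> E}}"
    by (rule upclosedD[OF assms(2)]) (use Suc.IH in auto)
  then show ?case by simp
qed simp

lemma nest_append: "nest L n {l. nest L m {l'. l @ l' \<in> E}} \<longleftrightarrow> nest L (n + m) E"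
proof (induction n arbitrary: E)
  case (Suc n)
  have "nest L n {l. nest L m {l'. z # l @ l' \<in> E}} \<longleftrightarrow> nest L (n + m) {l. z # l \<in> E}" for z
    using Suc[of "{l. z # l \<in> E}"] by simp
  then show ?case by simp
qed simp

lemma nest_partition_regular:
  assumes up: "upclosed L" and "partition_regular L"
  shows "partition_regular (nest L n)"
proof -
  have "nest L n (E \<union> F) \<Longrightarrow> nest L n E \<or> nest L n F" for E F
  proof (induction n arbitrary: E F)
    case (Suc n)
    have "{z. nest L n {l. z # l \<in> E \<union> F}} \<subseteq>
      {z. nest L n {l. z # l \<in> E}} \<union> {z. nest L n {l. z # l \<in> F}}"
    proof
      fix z assume "z \<in> {z. nest L n {l. z # l \<in> E \<union> F}}"
      then have "nest L n ({l. z # l \<in> E} \<union> {l. z # l \<in> F})" by (simp add: Collect_disj_eq)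
      from Suc.IH[OF this]
      show "z \<in> {z. nest L n {l. z # l \<in> E}} \<union> {z. nest L n {l. z # l \<in> F}}" by simp
    qed
    then have "L ({z. nest L n {l. z # l \<in> E}} \<union> {z. nest L n {l. z # l \<in> F}})"
      using Suc.prems upclosedD[OF up] by simp
    then show ?case using assms(2) unfolding partition_regular_def by simp
  qed simp
  then show ?thesis unfolding partition_regular_def by blast
qed

text \<open>
  If every \<open>L'\<close>-large set contains the \<open>r\<close>-multiples of the sums of \<open>N\<close>-fold \<open>L\<close>-large lists, then \<open>k\<close>
  steps of \<open>L'\<close> can be replaced by \<open>k N\<close> steps of \<open>L\<close>.
\<close>
lemma nest_flatten:
  fixes L L' :: "'x::real_vector set \<Rightarrow> bool"
  assumes L: "upclosed L" and L': "\<And>S. L' S \<Longrightarrow> nest L N {l. r *\<^sub>R sum_list l \<in> S}"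
  shows "nest L' k {l. P (sum_list l)} \<Longrightarrow> nest L (k * N) {l. P (r *\<^sub>R sum_list l)}"
proof (induction k arbitrary: P)
  case (Suc k)
  have "nest L N {l. nest L' k {l'. P (r *\<^sub>R sum_list l + sum_list l')}}"
    using L'[of "{z. nest L' k {l'. P (z + sum_list l')}}"] Suc.prems by simp
  then have "nest L N {l. nest L (k * N) {l'. P (r *\<^sub>R sum_list l + r *\<^sub>R sum_list l')}}"
  proof (rule nest_mono[OF L], intro subsetI CollectI, elim CollectE)
    fix l assume "nest L' k {l'. P (r *\<^sub>R sum_list l + sum_list l')}"
    from Suc.IH[OF this]
    show "nest L (k * N) {l'. P (r *\<^sub>R sum_list l + r *\<^sub>R sum_list l')}" .
  qed
  then have "nest L N {l. nest L (k * N) {l'. l @ l' \<in> {l. P (r *\<^sub>R sum_list l)}}}"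
    by (simp add: scaleR_add_right)
  then show ?case unfolding nest_append by simp
qed simp

text \<open>
  Conversely, \<open>N k\<close> steps can be bundled into \<open>N\<close> groups of \<open>k\<close> consecutive ones, provided that
  sums over a group, multiplied by \<open>r\<close>, range over large sets only.
\<close>
lemma nest_group:
  fixes L :: "'x::real_vector set \<Rightarrow> bool"
  assumes L: "upclosed L" and avg: "\<And>S. nest L k {l. r *\<^sub>R sum_list l \<in> S} \<Longrightarrow> L S"
  shows "nest L (N * k) {l. P (r *\<^sub>R sum_list l)} \<Longrightarrow> nest L N {l. P (sum_list l)}"
proof (induction N arbitrary: P)
  case (Suc N)
  have "nest L k {l. nest L (N * k) {l'. l @ l' \<in> {l. P (r *\<^sub>R sum_list l)}}}"
    unfolding nest_append using Suc.prems by simp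
  then have "nest L k {l. nest L (N * k) {l'. P (r *\<^sub>R sum_list l + r *\<^sub>R sum_list l')}}"
    by (simp add: scaleR_add_right)
  then have "nest L k {l. r *\<^sub>R sum_list l \<in> {z. nest L N {l'. P (z + sum_list l')}}}"
  proof (rule nest_mono[OF L], intro subsetI CollectI, elim CollectE)
    fix l assume "nest L (N * k) {l'. P (r *\<^sub>R sum_list l + r *\<^sub>R sum_list l')}"
    from Suc.IH[OF this]
    show "nest L N {l'. P (r *\<^sub>R sum_list l + sum_list l')}" .
  qed
  from avg[OF this] show ?case by simp
qed simp

lemma nest_zero:
  assumes "\<And>E. 0 \<in> E \<Longrightarrow> L E"
  shows "replicate n 0 \<in> E \<Longrightarrow> nest L n E"
  by (induction n arbitrary: E) (auto intro: assms)

lemma nest_vimage: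
  assumes up: "upclosed L" and "\<And>E. L E \<Longrightarrow> L {z. T z \<in> E}"
  shows "nest L n E \<Longrightarrow> nest L n {l. map T l \<in> E}"
proof (induction n arbitrary: E)
  case (Suc n)
  have "L {z. T z \<in> {z. nest L n {l. z # l \<in> E}}}" by (rule assms(2)) (use Suc.prems in simp)
  then have "L {z. nest L n {l. T z # map T l \<in> E}}"
    by (rule upclosedD[OF up]) (use Suc.IH in force)
  then show ?case by simp
qed simp

lemma ordinal_induct [case_names zero succ limit]:
  assumes "P 0" "\<And>\<eta>. P \<eta> \<Longrightarrow> P (osucc \<eta>)"
    "\<And>\<xi>. limit_ordinal \<xi> \<Longrightarrow> (\<And>\<zeta>. \<zeta> < \<xi> \<Longrightarrow> P \<zeta>) \<Longrightarrow> P \<xi>"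
  shows "P \<xi>"
proof (induction \<xi> rule: less_induct)
  case (less \<xi>)
  show ?case
  proof (cases \<xi> rule: ordinal_cases)
    case zero
    then show ?thesis using assms(1) by simp
  next
    case (succ \<eta>)
    then show ?thesis using assms(2) less less_osucc by metis
  next
    case limit
    then show ?thesis using assms(3) less by metis
  qed
qed

lemma Large_upclosed:
  assumes "upclosed L" shows "upclosed (Large L \<xi>)"
proof (induction \<xi> rule: ordinal_induct)
  case zero
  then show ?case using assms by (simp add: upclosed_def Large_0)
next
  case (succ \<eta>)
  show ?case unfolding upclosed_def Large_succ
  proof (intro allI impI)
    fix E F :: "'a set" and n :: nat
    assume *: "\<forall>n\<ge>1. nest (Large L \<eta>) n {l. inverse (real n) *\<^sub>R sum_list l \<in> E}" "E \<subseteq> F" "n \<ge> 1"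
    then have "nest (Large L \<eta>) n {l. inverse (real n) *\<^sub>R sum_list l \<in> E}" by blast
    then show "nest (Large L \<eta>) n {l. inverse (real n) *\<^sub>R sum_list l \<in> F}"
      by (rule nest_mono[OF succ]) (use * in auto)
  qed
next
  case (limit \<xi>)
  show ?case unfolding upclosed_def Large_limit[OF limit(1)]
    using limit(2)[OF limit_ordinal_osucc_less[OF limit(1)]] upclosedD by blast
qed

text \<open>
  The case \<open>n = 1\<close> of the successor clause.
\<close>
lemma Large_succD: "Large L (osucc \<eta>) E \<Longrightarrow> Large L \<eta> E"
  unfolding Large_succ by (drule spec[of _ 1]) (simp add: nest_1)

lemma Large_decreasing: "\<zeta> \<le> \<xi> \<Longrightarrow> Large L \<xi> E \<Longrightarrow> Large L \<zeta> E"
proof (induction \<xi> rule: ordinal_induct)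
  case zero
  then show ?case by (metis antisym ordinal_zero_le)
next
  case (succ \<eta>)
  show ?case
  proof (cases "\<zeta> = osucc \<eta>")
    case False
    then have "\<zeta> \<le> \<eta>" using succ.prems by (metis antisym not_le osucc_le_iff)
    then show ?thesis using succ Large_succD by blast
  qed (use succ in simp)
next
  case (limit \<xi>)
  show ?case
  proof (cases "\<zeta> = \<xi>")
    case False
    then have "\<zeta> < \<xi>" using limit.prems by simp
    then show ?thesis using limit Large_limit[OF limit(1)] Large_succD by blast
  qed (use limit in simp)
qed

text \<open>
  The properties of the large sets of order \<open>0\<close> that pass to all orders.
\<close>
locale null_family =
  fixes L :: "'x::real_normed_vector set \<Rightarrow> bool"
  assumes up: "upclosed L"
    and part: "partition_regular L"
    and zero: "0 \<in> E \<Longrightarrow> L E"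
    and ball: "L E \<Longrightarrow> \<exists>z\<in>E. norm z \<le> 1"
    and average: "k \<ge> 1 \<Longrightarrow> nest L k {l. inverse (real k) *\<^sub>R sum_list l \<in> E} \<Longrightarrow> L E"
begin

text \<open>
  Means of \<open>k\<close> averages of order \<open>\<xi>\<close> are as good as averages of order \<open>\<xi>\<close>.  At a successor, choose the
  same number \<open>N\<close> for each of the \<open>k\<close> averages; the \<open>k N\<close> summands of lower order are then regrouped
  into \<open>N\<close> groups of \<open>k\<close> consecutive ones.
\<close>
lemma Large_average:
  "k \<ge> 1 \<Longrightarrow> nest (Large L \<xi>) k {l. inverse (real k) *\<^sub>R sum_list l \<in> E} \<Longrightarrow> Large L \<xi> E"
proof (induction \<xi> arbitrary: E k rule: ordinal_induct)
  case zero
  have eq: "Large L 0 = L" by (rule ext) (simp add: Large_0)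
  show ?case using zero(2) average[OF zero(1)] unfolding eq by blast
next
  case (succ \<eta>)
  note upL = Large_upclosed[OF up, of \<eta>]
  show ?case unfolding Large_succ
  proof (intro allI impI)
    fix N :: nat assume N: "N \<ge> 1"
    have "nest (Large L \<eta>) (k * N) {l. inverse (real k) *\<^sub>R (inverse (real N) *\<^sub>R sum_list l) \<in> E}"
      by (rule nest_flatten[OF upL, where P = "\<lambda>s. inverse (real k) *\<^sub>R s \<in> E" and L' = "Large L (osucc \<eta>)"])
        (use N Large_succ succ.prems in auto)
    then have "nest (Large L \<eta>) (N * k) {l. inverse (real N) *\<^sub>R (inverse (real k) *\<^sub>R sum_list l) \<in> E}"
      by (simp add: mult.commute)
    then show "nest (Large L \<eta>) N {l. inverse (real N) *\<^sub>R sum_list l \<in> E}"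
      by - (rule nest_group[OF upL succ.IH[OF succ.prems(1)],
            where P = "\<lambda>s. inverse (real N) *\<^sub>R s \<in> E"], simp_all)
  qed
next
  case (limit \<xi>)
  show ?case unfolding Large_limit[OF limit(1)]
  proof (intro allI impI)
    fix \<zeta> assume "\<zeta> < \<xi>"
    then have lt: "osucc \<zeta> < \<xi>" by (rule limit_ordinal_osucc_less[OF limit(1)])
    show "Large L (osucc \<zeta>) E"
      by (rule limit(2)[OF lt limit(3)])
        (rule nest_mono_family[OF Large_decreasing[OF less_imp_le[OF lt]] Large_upclosed[OF up] limit(4)])
  qed
qed

text \<open>
  Hence the condition for \<open>n k\<close> in the successor clause implies the one for \<open>n\<close>.
\<close>
lemma nest_Large_divide:
  assumes "k \<ge> 1" "nest (Large L \<xi>) (n * k) {l. inverse (real (n * k)) *\<^sub>R sum_list l \<in> E}"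
  shows "nest (Large L \<xi>) n {l. inverse (real n) *\<^sub>R sum_list l \<in> E}"
  by (rule nest_group[OF Large_upclosed[OF up] Large_average[OF assms(1)],
        where P = "\<lambda>s. inverse (real n) *\<^sub>R s \<in> E"]) (use assms(2) in simp_all)

text \<open>
  At a successor, the failures of the two pieces at \<open>m\<close> and at \<open>n\<close> are both failures at \<open>m n\<close>; at a limit,
  the failures at \<open>\<zeta>\<close> and \<open>\<eta>\<close> are both failures at the maximum.
\<close>
lemma Large_partition_regular: "partition_regular (Large L \<xi>)"
proof (induction \<xi> rule: ordinal_induct)
  case zero
  then show ?case using part by (simp add: partition_regular_def Large_0)
next
  case (succ \<eta>)
  note nreg = nest_partition_regular[OF Large_upclosed[OF up] succ]
  show ?case unfolding partition_regular_def
  proof (intro allI impI, rule ccontr)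
    fix E F assume EF: "Large L (osucc \<eta>) (E \<union> F)" "\<not> (Large L (osucc \<eta>) E \<or> Large L (osucc \<eta>) F)"
    then obtain m n where m: "m \<ge> 1" "\<not> nest (Large L \<eta>) m {l. inverse (real m) *\<^sub>R sum_list l \<in> E}"
      and n: "n \<ge> 1" "\<not> nest (Large L \<eta>) n {l. inverse (real n) *\<^sub>R sum_list l \<in> F}"
      unfolding Large_succ by blast
    have "m * n \<ge> 1" using mult_le_mono[OF m(1) n(1)] by simp
    then have "nest (Large L \<eta>) (m * n) {l. inverse (real (m * n)) *\<^sub>R sum_list l \<in> E \<union> F}"
      using EF(1) unfolding Large_succ by blast
    then have "nest (Large L \<eta>) (m * n) ({l. inverse (real (m * n)) *\<^sub>R sum_list l \<in> E} \<union>
        {l. inverse (real (m * n)) *\<^sub>R sum_list l \<in> F})"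
      by (simp only: Un_iff Collect_disj_eq)
    then have "nest (Large L \<eta>) (m * n) {l. inverse (real (m * n)) *\<^sub>R sum_list l \<in> E} \<or>
        nest (Large L \<eta>) (n * m) {l. inverse (real (n * m)) *\<^sub>R sum_list l \<in> F}"
      using nreg unfolding partition_regular_def by (metis mult.commute)
    then show False using nest_Large_divide m n by blast
  qed
next
  case (limit \<xi>)
  show ?case unfolding partition_regular_def
  proof (intro allI impI, rule ccontr)
    fix E F assume EF: "Large L \<xi> (E \<union> F)" "\<not> (Large L \<xi> E \<or> Large L \<xi> F)"
    then obtain \<zeta> \<eta> where z: "\<zeta> < \<xi>" "\<not> Large L (osucc \<zeta>) E" and h: "\<eta> < \<xi>" "\<not> Large L (osucc \<eta>) F"
      unfolding Large_limit[OF limit(1)] by blast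
    let ?m = "max \<zeta> \<eta>"
    have m: "?m < \<xi>" using z h by simp
    then have "Large L (osucc ?m) (E \<union> F)" using EF(1) unfolding Large_limit[OF limit(1)] by blast
    then have "Large L (osucc ?m) E \<or> Large L (osucc ?m) F"
      using limit(2)[OF limit_ordinal_osucc_less[OF limit(1) m]] unfolding partition_regular_def by blast
    moreover have "osucc \<zeta> \<le> osucc ?m" "osucc \<eta> \<le> osucc ?m"
      by (auto simp: osucc_le_iff intro: le_less_trans[OF _ less_osucc])
    ultimately show False using z h Large_decreasing by blast
  qed
qed

lemma Large_zero: "0 \<in> E \<Longrightarrow> Large L \<xi> E"
proof (induction \<xi> arbitrary: E rule: ordinal_induct)
  case zero
  then show ?case using null_family.zero[OF null_family_axioms] by (simp add: Large_0)
next
  case (succ \<eta>)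
  have "sum_list (replicate n (0 :: 'x)) = 0" for n by (induction n) simp_all
  then show ?case unfolding Large_succ
    by (intro allI impI nest_zero succ.IH) (use succ.prems in simp_all)
next
  case (limit \<xi>)
  then show ?case using limit_ordinal_osucc_less[OF limit(1)] by (simp add: Large_limit[OF limit(1)])
qed

lemma Large_ball: "Large L \<xi> E \<Longrightarrow> \<exists>z\<in>E. norm z \<le> 1"
  using Large_decreasing[OF ordinal_zero_le, of L \<xi> E] ball by (simp add: Large_0)

lemma Large_vimage:
  assumes T: "linear T" and L: "\<And>E. L E \<Longrightarrow> L {z. T z \<in> E}"
  shows "Large L \<xi> E \<Longrightarrow> Large L \<xi> {z. T z \<in> E}"
proof (induction \<xi> arbitrary: E rule: ordinal_induct)
  case zero
  then show ?case using L by (simp add: Large_0)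
next
  case (succ \<eta>)
  have sl: "sum_list (map T l) = T (sum_list l)" for l
    by (induction l) (simp_all add: linear_0[OF T] linear_add[OF T])
  show ?case unfolding Large_succ
  proof (intro allI impI)
    fix n :: nat assume "n \<ge> 1"
    then have "nest (Large L \<eta>) n {l. inverse (real n) *\<^sub>R sum_list l \<in> E}"
      using succ.prems unfolding Large_succ by blast
    from nest_vimage[OF Large_upclosed[OF up] succ.IH this]
    show "nest (Large L \<eta>) n {l. inverse (real n) *\<^sub>R sum_list l \<in> {z. T z \<in> E}}"
      by (simp add: sl linear_scale[OF T])
  qed
next
  case (limit \<xi>)
  then show ?case using limit_ordinal_osucc_less[OF limit(1)] by (simp add: Large_limit[OF limit(1)])
qed

end

section \<open>The equivalent norm\<close>

text \<open>
  The Minkowski functional of the sublevel set \<open>{y. F y \<le> R}\<close>.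
\<close>
definition minkowski :: "('y::real_vector \<Rightarrow> real) \<Rightarrow> real \<Rightarrow> 'y \<Rightarrow> real" where
  "minkowski F R y = Inf {t. t > 0 \<and> F ((1 / t) *\<^sub>R y) \<le> R}"

text \<open>
  A convex function within \<open>M\<close> of the norm.  As \<open>F 0 \<le> M\<close>, the sublevel set for \<open>R = M + 1\<close> contains
  the unit ball and is contained in the ball of radius \<open>M + 1\<close>; its Minkowski functional is a norm up to
  invariance under scalars of modulus one, which is treated separately.
\<close>
locale convex_gauge =
  fixes F :: "'y::real_normed_vector \<Rightarrow> real" and M :: real
  assumes conv: "\<And>a b y w. 0 \<le> a \<Longrightarrow> 0 \<le> b \<Longrightarrow> a + b = 1 \<Longrightarrow> F (a *\<^sub>R y + b *\<^sub>R w) \<le> a * F y + b * F w"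
    and lower: "\<And>y. norm y \<le> F y"
    and upper: "\<And>y. F y \<le> norm y + M"
begin

abbreviation "N \<equiv> minkowski F (M + 1)"

lemma M_nonneg: "0 \<le> M"
  using lower[of 0] upper[of 0] by simp

lemma le_shrink:
  assumes "0 \<le> a" "a \<le> 1" "F y \<le> M + 1" shows "F (a *\<^sub>R y) \<le> M + 1"
proof -
  have "F (a *\<^sub>R y) = F (a *\<^sub>R y + (1 - a) *\<^sub>R 0)" by simp
  also have "\<dots> \<le> a * F y + (1 - a) * F 0" using assms by (intro conv) auto
  also have "\<dots> \<le> a * (M + 1) + (1 - a) * (M + 1)"
    using assms upper[of 0] by (intro add_mono mult_left_mono) auto
  finally show ?thesis by (simp add: algebra_simps)
qed

lemma bdd: "bdd_below {t. t > 0 \<and> F ((1 / t) *\<^sub>R y) \<le> M + 1}"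
  by (rule bdd_belowI[of _ 0]) auto

lemma N_le: "t > 0 \<Longrightarrow> F ((1 / t) *\<^sub>R y) \<le> M + 1 \<Longrightarrow> N y \<le> t"
  unfolding minkowski_def by (rule cInf_lower[OF _ bdd]) auto

lemma F_norm: "y \<noteq> 0 \<Longrightarrow> F ((1 / norm y) *\<^sub>R y) \<le> M + 1"
  using upper[of "(1 / norm y) *\<^sub>R y"] by simp

lemma nonempty: "{t. t > 0 \<and> F ((1 / t) *\<^sub>R y) \<le> M + 1} \<noteq> {}"
proof (cases "y = 0")
  case True
  then show ?thesis using upper[of 0] by (auto intro!: exI[of _ 1])
next
  case False
  then show ?thesis using F_norm[OF False] by (auto intro!: exI[of _ "norm y"])
qed

lemma N_less:
  assumes "N y < t" shows "t > 0" "F ((1 / t) *\<^sub>R y) \<le> M + 1"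
proof -
  obtain s where s: "s > 0" "F ((1 / s) *\<^sub>R y) \<le> M + 1" "s < t"
    using assms cInf_lessD[OF nonempty, of y t] unfolding minkowski_def by blast
  then show "t > 0" by simp
  have "F ((s / t) *\<^sub>R ((1 / s) *\<^sub>R y)) \<le> M + 1" by (rule le_shrink) (use s in auto)
  then show "F ((1 / t) *\<^sub>R y) \<le> M + 1" using s by simp
qed

lemma N_upper: "N y \<le> norm y"
proof (cases "y = 0")
  case True
  have "N y \<le> e" if "e > 0" for e using that True upper[of 0] by (intro N_le) auto
  then show ?thesis using True field_le_epsilon[of "N y" 0] by simp
next
  case False
  then show ?thesis using F_norm by (intro N_le) auto
qed

lemma N_lower: "norm y \<le> (M + 1) * N y"
proof -
  have "norm y / (M + 1) \<le> t" if t: "t > 0" "F ((1 / t) *\<^sub>R y) \<le> M + 1" for t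
  proof -
    have "norm y / t \<le> M + 1" using lower[of "(1 / t) *\<^sub>R y"] t by simp
    then show ?thesis using t(1) M_nonneg by (simp add: field_simps)
  qed
  then have "norm y / (M + 1) \<le> N y"
    unfolding minkowski_def by (intro cInf_greatest[OF nonempty]) auto
  then show ?thesis using M_nonneg by (simp add: field_simps)
qed

lemma N_nonneg: "0 \<le> N y"
  using N_lower[of y] M_nonneg by (smt (verit) norm_ge_zero zero_le_mult_iff)

lemma N_zero_iff: "N y = 0 \<longleftrightarrow> y = 0"
  using N_lower[of y] N_upper[of y] N_nonneg[of y] by auto

lemma N_triangle: "N (y + w) \<le> N y + N w"
proof (rule field_le_epsilon)
  fix e :: real assume e: "e > 0"
  define s t where "s = N y + e / 2" and "t = N w + e / 2"
  have s: "s > 0" "F ((1 / s) *\<^sub>R y) \<le> M + 1" using N_less[of y s] e by (auto simp: s_def)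
  have t: "t > 0" "F ((1 / t) *\<^sub>R w) \<le> M + 1" using N_less[of w t] e by (auto simp: t_def)
  have eq: "(1 / (s + t)) *\<^sub>R (y + w) =
      (s / (s + t)) *\<^sub>R ((1 / s) *\<^sub>R y) + (t / (s + t)) *\<^sub>R ((1 / t) *\<^sub>R w)"
    using s t by (simp add: scaleR_add_right)
  have "F ((1 / (s + t)) *\<^sub>R (y + w)) \<le>
      (s / (s + t)) * F ((1 / s) *\<^sub>R y) + (t / (s + t)) * F ((1 / t) *\<^sub>R w)"
    unfolding eq using s t by (intro conv) (auto simp: add_divide_distrib[symmetric])
  also have "\<dots> \<le> (s / (s + t)) * (M + 1) + (t / (s + t)) * (M + 1)"
    using s t by (intro add_mono mult_left_mono) auto
  also have "\<dots> = ((s + t) / (s + t)) * (M + 1)"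
    by (simp only: distrib_right add_divide_distrib)
  also have "\<dots> = M + 1" using s t by simp
  finally have "N (y + w) \<le> s + t" using s t by (intro N_le) auto
  then show "N (y + w) \<le> N y + N w + e" by (simp add: s_def t_def)
qed

lemma N_scaleR:
  assumes r: "r > 0" shows "N (r *\<^sub>R y) = r * N y"
proof -
  have le: "N (r *\<^sub>R y) \<le> r * N y" if r: "r > 0" for r y
  proof (rule field_le_epsilon)
    fix e :: real assume "e > 0"
    then have "N y < N y + e / r" using r by simp
    from N_less[OF this] have "N (r *\<^sub>R y) \<le> r * (N y + e / r)"
      using r by (intro N_le) auto
    then show "N (r *\<^sub>R y) \<le> r * N y + e" using r by (simp add: algebra_simps)
  qed
  have "N y \<le> (1 / r) * N (r *\<^sub>R y)" using le[of "1 / r" "r *\<^sub>R y"] r by simp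
  then show ?thesis using le[OF r, of y] r by (simp add: field_simps)
qed

text \<open>
  As \<open>F 0 \<le> M = R - 1\<close>, convexity bounds the functional just above the sublevel \<open>R\<close>.
\<close>
lemma N_le_of_F:
  assumes "0 \<le> d" "F w \<le> M + 1 + d" shows "N w \<le> 1 + d"
proof (rule N_le)
  have "F ((1 / (1 + d)) *\<^sub>R w) = F ((1 / (1 + d)) *\<^sub>R w + (d / (1 + d)) *\<^sub>R 0)" by simp
  also have "\<dots> \<le> (1 / (1 + d)) * F w + (d / (1 + d)) * F 0"
    using assms by (intro conv) (auto simp: add_divide_distrib[symmetric])
  also have "\<dots> \<le> (1 / (1 + d)) * (M + 1 + d) + (d / (1 + d)) * M"
    using assms upper[of 0] by (intro add_mono mult_left_mono) auto
  also have "\<dots> = ((1 + d) * (M + 1)) / (1 + d)"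
    unfolding times_divide_eq_left add_divide_distrib[symmetric] by (simp add: algebra_simps)
  also have "\<dots> = M + 1" using assms(1) by simp
  finally show "F ((1 / (1 + d)) *\<^sub>R w) \<le> M + 1" .
qed (use assms in simp)

end

text \<open>
  The supremum of the levels that \<open>g\<close> exceeds on a large set.  For partition regular families it is
  subadditive in \<open>g\<close>.
\<close>
definition large_sup :: "('a set \<Rightarrow> bool) \<Rightarrow> ('a \<Rightarrow> real) \<Rightarrow> real" where
  "large_sup L g = Sup {c. L {z. g z > c}}"

text \<open>
  A partition regular family such that at most \<open>n\<close> steps cannot force \<open>B (z\<^sub>1 + \<dots> + z\<^sub>k)\<close> to be larger
  than \<open>M\<close> in norm.
\<close>
locale large_family =
  fixes L :: "'x::real_vector set \<Rightarrow> bool" and B :: "'x \<Rightarrow> 'y::real_normed_vector" and M :: real and n :: nat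
  assumes up: "upclosed L" and part: "partition_regular L"
    and zero: "\<And>E. 0 \<in> E \<Longrightarrow> L E" and nonempty: "\<not> L {}"
    and lin: "linear B"
    and n: "n \<ge> 1"
    and bound: "\<And>k E e. k \<le> n \<Longrightarrow> nest L k E \<Longrightarrow> e > 0 \<Longrightarrow> \<exists>l\<in>E. norm (B (sum_list l)) \<le> M + e"
begin

text \<open>
  The level above which \<open>k\<close> steps starting from \<open>y\<close> can force the norm.
\<close>
definition f :: "nat \<Rightarrow> 'y \<Rightarrow> real" where
  "f k y = large_sup (nest L k) (\<lambda>l. norm (y + B (sum_list l)))"

text \<open>
  The mean of \<open>f 0, \<dots>, f (n - 1)\<close>.  One step from \<open>y\<close> can force \<open>f k\<close> up to \<open>f (k + 1) y\<close>
  only, so it can force an increase of the mean by no more than \<open>(f n y - f 0 y) / n \<le> M / n\<close>.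
\<close>

definition F :: "'y \<Rightarrow> real" where "F y = (\<Sum>k<n. f k y) / real n"

lemma nest_above:
  assumes "k \<le> n" "nest L k {l. norm (y + B (sum_list l)) > c}" shows "c \<le> norm y + M"
proof (rule field_le_epsilon)
  fix e :: real assume "e > 0"
  from bound[OF assms this] obtain l where "norm (y + B (sum_list l)) > c" "norm (B (sum_list l)) \<le> M + e"
    by blast
  then show "c \<le> norm y + M + e" using norm_triangle_ineq[of y "B (sum_list l)"] by simp
qed

lemma nest_below:
  assumes "c < norm y" shows "nest L k {l. norm (y + B (sum_list l)) > c}"
proof (rule nest_zero[OF zero])
  have "sum_list (replicate k (0 :: 'x)) = 0" by (induction k) simp_all
  then show "replicate k 0 \<in> {l. norm (y + B (sum_list l)) > c}"
    using assms by (simp add: linear_0[OF lin])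
qed

lemma bdd_f: "k \<le> n \<Longrightarrow> bdd_above {c. nest L k {l. norm (y + B (sum_list l)) > c}}"
  using nest_above by (intro bdd_aboveI[of _ "norm y + M"]) auto

lemma nonempty_f: "{c. nest L k {l. norm (y + B (sum_list l)) > c}} \<noteq> {}"
  using nest_below[of "norm y - 1" y k] by auto

lemma f_ge: "k \<le> n \<Longrightarrow> nest L k {l. norm (y + B (sum_list l)) > c} \<Longrightarrow> c \<le> f k y"
  unfolding f_def large_sup_def by (rule cSup_upper[OF _ bdd_f]) auto

lemma f_less:
  assumes "c < f k y" shows "nest L k {l. norm (y + B (sum_list l)) > c}"
proof -
  obtain c' where c': "nest L k {l. norm (y + B (sum_list l)) > c'}" "c < c'"
    using less_cSupD[OF nonempty_f, of c k y] assms unfolding f_def large_sup_def by blast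
  show ?thesis by (rule nest_mono[OF up c'(1)]) (use c' in auto)
qed

lemma f_upper: "k \<le> n \<Longrightarrow> f k y \<le> norm y + M"
  unfolding f_def large_sup_def by (rule cSup_least[OF nonempty_f]) (use nest_above in auto)

lemma f_lower: "k \<le> n \<Longrightarrow> norm y \<le> f k y"
  using f_ge[OF _ nest_below] by (meson dense_le_bounded less_imp_le linorder_not_less dense order_less_le_trans)

text \<open>
  A list for which \<open>a y + b w\<close> is moved far away moves \<open>y\<close> or \<open>w\<close> far away; one of these two
  alternatives happens on a large set.
\<close>
lemma f_convex:
  assumes k: "k \<le> n" and ab: "0 \<le> a" "0 \<le> b" "a + b = 1"
  shows "f k (a *\<^sub>R y + b *\<^sub>R w) \<le> a * f k y + b * f k w"
proof (rule ccontr)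
  assume "\<not> ?thesis"
  then have gap: "a * f k y + b * f k w < f k (a *\<^sub>R y + b *\<^sub>R w)" by simp
  define e where "e = (f k (a *\<^sub>R y + b *\<^sub>R w) - (a * f k y + b * f k w)) / 2"
  have e: "e > 0" "a * f k y + b * f k w + e < f k (a *\<^sub>R y + b *\<^sub>R w)"
    using gap unfolding e_def by (simp_all add: field_simps)
  let ?E = "{l. norm (y + B (sum_list l)) > f k y + e}"
  let ?F = "{l. norm (w + B (sum_list l)) > f k w + e}"
  have "nest L k {l. norm (a *\<^sub>R y + b *\<^sub>R w + B (sum_list l)) > a * f k y + b * f k w + e}"
    by (rule f_less[OF e(2)])
  moreover have "{l. norm (a *\<^sub>R y + b *\<^sub>R w + B (sum_list l)) > a * f k y + b * f k w + e} \<subseteq> ?E \<union> ?F"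
  proof (intro subsetI, rule ccontr)
    fix l assume l: "l \<in> {l. norm (a *\<^sub>R y + b *\<^sub>R w + B (sum_list l)) > a * f k y + b * f k w + e}"
      "l \<notin> ?E \<union> ?F"
    let ?v = "B (sum_list l)"
    have v: "?v = a *\<^sub>R ?v + b *\<^sub>R ?v" using ab(3) by (metis scaleR_left_distrib scaleR_one)
    have "a *\<^sub>R y + b *\<^sub>R w + ?v = a *\<^sub>R (y + ?v) + b *\<^sub>R (w + ?v)"
      by (subst v) (simp add: scaleR_add_right)
    then have "norm (a *\<^sub>R y + b *\<^sub>R w + ?v) \<le> a * norm (y + ?v) + b * norm (w + ?v)"
      using norm_triangle_ineq[of "a *\<^sub>R (y + ?v)" "b *\<^sub>R (w + ?v)"] ab by simp
    also have "\<dots> \<le> a * (f k y + e) + b * (f k w + e)"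
      using l(2) ab by (intro add_mono mult_left_mono) auto
    also have "\<dots> = a * f k y + b * f k w + (a + b) * e" by (simp add: algebra_simps)
    finally show False using l(1) ab(3) by simp
  qed
  ultimately have "nest L k (?E \<union> ?F)" by (rule nest_mono[OF up])
  then have "nest L k ?E \<or> nest L k ?F"
    using nest_partition_regular[OF up part] unfolding partition_regular_def by blast
  then show False using f_ge[OF k, of "f k y + e" y] f_ge[OF k, of "f k w + e" w] e(1) by auto
qed

lemma part_finite:
  fixes m :: nat
  shows "L (\<Union>k<m. E k) \<Longrightarrow> \<exists>k<m. L (E k)"
proof (induction m)
  case (Suc m)
  then have "L ((\<Union>k<m. E k) \<union> E m)" by (simp add: lessThan_Suc Un_commute)
  then have "L (\<Union>k<m. E k) \<or> L (E m)" using part unfolding partition_regular_def by blast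
  then show ?case using Suc.IH less_Suc_eq by blast
qed (use nonempty in simp)

lemma F_step:
  assumes E: "L E" and d: "d > 0"
  shows "\<exists>z\<in>E. F (y + B z) \<le> F y + M / real n + d"
proof (rule ccontr)
  assume no: "\<not> ?thesis"
  have sum: "(\<Sum>k<n. f (Suc k) y) \<le> (\<Sum>k<n. f k y) + M"
  proof -
    have "(\<Sum>k<n. f (Suc k) y) = (\<Sum>k<n. f k y) + f n y - f 0 y"
      using sum.lessThan_Suc_shift[of "\<lambda>k. f k y" n] by simp
    then show ?thesis using f_upper[of n y] f_lower[of 0 y] by simp
  qed
  \<comment> \<open>otherwise, for each \<open>z\<close> in \<open>E\<close>, one of the \<open>n\<close> summands grows by more than it can on a large set\<close>
  have "E \<subseteq> (\<Union>k<n. {z. f k (y + B z) > f (Suc k) y + d})"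
  proof
    fix z assume "z \<in> E"
    then have z: "F (y + B z) > F y + M / real n + d" using no by auto
    have "real n * (F y + M / real n + d) < real n * F (y + B z)"
      using z n by (intro mult_strict_left_mono) auto
    then have "(\<Sum>k<n. f k y) + M + real n * d < (\<Sum>k<n. f k (y + B z))"
      using n by (simp add: F_def distrib_left)
    then have "(\<Sum>k<n. f (Suc k) y + d) < (\<Sum>k<n. f k (y + B z))"
      using sum by (simp add: sum.distrib)
    then have "\<exists>k<n. f (Suc k) y + d < f k (y + B z)"
      by (metis (no_types, lifting) lessThan_iff not_le sum_mono)
    then show "z \<in> (\<Union>k<n. {z. f k (y + B z) > f (Suc k) y + d})" by auto
  qed
  then have "L (\<Union>k<n. {z. f k (y + B z) > f (Suc k) y + d})" by (rule upclosedD[OF up E])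
  then obtain k where k: "k < n" "L {z. f k (y + B z) > f (Suc k) y + d}" using part_finite by blast
  have "L {z. nest L k {l. norm (y + B z + B (sum_list l)) > f (Suc k) y + d}}"
    by (rule upclosedD[OF up k(2)]) (use f_less in auto)
  then have "nest L (Suc k) {l. norm (y + B (sum_list l)) > f (Suc k) y + d}"
    by (simp add: linear_add[OF lin] add.assoc)
  from f_ge[OF _ this] show False using k d by simp
qed

sublocale convex_gauge F M
proof
  have n0: "real n > 0" using n by simp
  fix a b :: real and y w :: 'y
  show "F (a *\<^sub>R y + b *\<^sub>R w) \<le> a * F y + b * F w" if ab: "0 \<le> a" "0 \<le> b" "a + b = 1"
  proof -
    have "(\<Sum>k<n. f k (a *\<^sub>R y + b *\<^sub>R w)) \<le> (\<Sum>k<n. a * f k y + b * f k w)"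
      by (intro sum_mono f_convex) (use ab in auto)
    then show ?thesis using n0
      by (simp add: F_def sum.distrib sum_distrib_left[symmetric] field_simps)
  qed
  have "real n * norm y \<le> (\<Sum>k<n. f k y)"
    using sum_mono[of "{..<n}" "\<lambda>_. norm y" "\<lambda>k. f k y"] f_lower by simp
  then show "norm y \<le> F y" using n0 by (simp add: F_def field_simps)
  have "(\<Sum>k<n. f k y) \<le> real n * (norm y + M)"
    using sum_mono[of "{..<n}" "\<lambda>k. f k y" "\<lambda>_. norm y + M"] f_upper by simp
  then show "F y \<le> norm y + M" using n0 by (simp add: F_def field_simps)
qed

text \<open>
  The case of interest is \<open>w = c y\<close> and \<open>S z = c\<^bsup>-1\<^esup> z\<close> for a scalar \<open>c\<close> of modulus one.
\<close>
lemma f_le_rotate: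
  assumes k: "k \<le> n" and S: "linear S" "\<And>E. L E \<Longrightarrow> L {z. S z \<in> E}"
    and eq: "\<And>z. norm (y + B (S z)) = norm (w + B z)"
  shows "f k y \<le> f k w"
proof (rule dense_le)
  fix c assume c: "c < f k y"
  have sl: "sum_list (map S l) = S (sum_list l)" for l
    by (induction l) (simp_all add: linear_0[OF S(1)] linear_add[OF S(1)])
  have "nest L k {l. map S l \<in> {l. norm (y + B (sum_list l)) > c}}"
    by (rule nest_vimage[OF up S(2) f_less[OF c]])
  then show "c \<le> f k w" by (intro f_ge[OF k]) (simp add: sl eq)
qed

lemma F_le_rotate:
  assumes "linear S" "\<And>E. L E \<Longrightarrow> L {z. S z \<in> E}" "\<And>z. norm (y + B (S z)) = norm (w + B z)"
  shows "F y \<le> F w"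
  unfolding F_def by (intro divide_right_mono sum_mono f_le_rotate[OF _ assms]) auto

lemma N_step:
  assumes "N y \<le> 1" and E: "L E" and d: "d > 0"
  shows "\<exists>z\<in>E. N (y + B z) \<le> 1 + M / real n + d"
proof -
  define e where "e = d / 2"
  have e: "e > 0" using d by (simp add: e_def)
  define y' where "y' = (1 / (1 + e)) *\<^sub>R y"
  \<comment> \<open>\<open>y\<close> is shrunk slightly, as the infimum in \<open>N y\<close> need not be attained\<close>
  have "F y' \<le> M + 1" unfolding y'_def by (rule N_less) (use assms e in simp)
  obtain z where z: "z \<in> E" "F (y' + B z) \<le> F y' + M / real n + e" using F_step[OF E e] by blast
  have Mn: "0 \<le> M / real n" using M_nonneg by simp
  have 1: "N (y' + B z) \<le> 1 + (M / real n + e)"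
    by (rule N_le_of_F) (use z \<open>F y' \<le> M + 1\<close> Mn e in auto)
  have "y - y' = (1 - 1 / (1 + e)) *\<^sub>R y" by (simp add: y'_def scaleR_left_diff_distrib)
  also have "1 - 1 / (1 + e) = e / (1 + e)" using e by (simp add: field_simps)
  finally have "N (y - y') = e / (1 + e) * N y" using e by (simp add: N_scaleR)
  also have "\<dots> \<le> e / (1 + e) * 1" using e assms by (intro mult_left_mono) auto
  also have "\<dots> \<le> e" using e by (simp add: field_simps)
  finally have 2: "N (y - y') \<le> e" .
  have "N (y + B z) = N ((y' + B z) + (y - y'))" by (simp add: algebra_simps)
  also have "\<dots> \<le> 1 + (M / real n + e) + e" using N_triangle 1 2 by (meson add_mono order_trans)
  finally show ?thesis using z(1) e_def by (intro bexI[of _ z]) auto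
qed

lemma N_isometry:
  assumes "\<And>y. F (T y) = F y" "linear T"
  shows "N (T y) = N y"
  using assms(1) unfolding minkowski_def by (simp add: linear_scale[OF assms(2), symmetric])

end

section \<open>Weak neighbourhoods of zero\<close>

text \<open>
  Weakly null nets in the unit ball, indexed by the weak neighbourhoods of zero.
\<close>
definition weakly_null_family :: "('k::real_or_complex \<Rightarrow> 'x::banach \<Rightarrow> 'x) \<Rightarrow> ('x set \<Rightarrow> 'x) \<Rightarrow> bool" where
  "weakly_null_family sX g \<longleftrightarrow> limitin (weak_topology sX) g 0 (tails (D_weak sX) (\<lambda>U V. V \<subseteq> U)) \<and>
     (\<forall>u\<in>D_weak sX. norm (g u) \<le> 1)"

text \<open>
  The large sets of order \<open>0\<close>: those whose intersection with the unit ball has zero in its weak closure.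
\<close>
definition meets :: "('k::real_or_complex \<Rightarrow> 'x::banach \<Rightarrow> 'x) \<Rightarrow> 'x set \<Rightarrow> bool" where
  "meets sX E \<longleftrightarrow> (\<forall>V\<in>D_weak sX. \<exists>z\<in>V. norm z \<le> 1 \<and> z \<in> E)"

context banach_over
begin

lemma operator_zero: "operator scale (*) (\<lambda>_. 0)"
  by (simp add: operator_def)

lemma topspace_weak: "topspace (weak_topology scale) = UNIV"
proof -
  have "openin (weak_topology scale) ((\<lambda>_. 0 :: 'k) -` UNIV)"
    unfolding weak_topology_def
    by (rule topology_generated_by_Basis) (use operator_zero in blast)
  then show ?thesis using openin_subset by fastforce
qed

lemma D_weak_UNIV: "UNIV \<in> D_weak scale"
  using openin_topspace[of "weak_topology scale"] by (simp add: D_weak_def topspace_weak)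

lemma D_weak_Int: "U \<in> D_weak scale \<Longrightarrow> V \<in> D_weak scale \<Longrightarrow> U \<inter> V \<in> D_weak scale"
  by (auto simp: D_weak_def)

lemma eventually_tails:
  "eventually P (tails (D_weak scale) (\<lambda>U V. V \<subseteq> U)) \<longleftrightarrow>
    (\<exists>U\<in>D_weak scale. \<forall>V\<in>D_weak scale. V \<subseteq> U \<longrightarrow> P V)"
proof -
  let ?F = "\<lambda>U. principal {V \<in> D_weak scale. V \<subseteq> U}"
  have "eventually P (INF U\<in>D_weak scale. ?F U) \<longleftrightarrow> (\<exists>U\<in>D_weak scale. eventually P (?F U))"
  proof (rule eventually_INF_base)
    show "D_weak scale \<noteq> {}" using D_weak_UNIV by blast
    show "\<exists>W\<in>D_weak scale. ?F W \<le> inf (?F U) (?F V)" if "U \<in> D_weak scale" "V \<in> D_weak scale" for U V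
      by (rule bexI[OF _ D_weak_Int[OF that]]) auto
  qed
  then show ?thesis unfolding tails_def eventually_principal by blast
qed

lemma weakly_null_family_iff: "weakly_null_family scale g \<longleftrightarrow>
    (\<forall>W\<in>D_weak scale. \<exists>U\<in>D_weak scale. \<forall>V\<in>D_weak scale. V \<subseteq> U \<longrightarrow> g V \<in> W) \<and>
    (\<forall>u\<in>D_weak scale. norm (g u) \<le> 1)"
  unfolding weakly_null_family_def limitin_def eventually_tails by (auto simp: topspace_weak D_weak_def)

lemma meets_iff: "(\<exists>g. weakly_null_family scale g \<and> g ` D_weak scale \<subseteq> E) \<longleftrightarrow> meets scale E"
proof
  assume "\<exists>g. weakly_null_family scale g \<and> g ` D_weak scale \<subseteq> E"
  then obtain g where g: "weakly_null_family scale g" "g ` D_weak scale \<subseteq> E" by blast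
  show "meets scale E" unfolding meets_def
  proof
    fix W assume "W \<in> D_weak scale"
    then obtain U where "U \<in> D_weak scale" "\<forall>V\<in>D_weak scale. V \<subseteq> U \<longrightarrow> g V \<in> W"
      using g(1) unfolding weakly_null_family_iff by blast
    then show "\<exists>z\<in>W. norm z \<le> 1 \<and> z \<in> E" using g unfolding weakly_null_family_iff by (intro bexI[of _ "g U"]) auto
  qed
next
  assume "meets scale E"
  then have "\<forall>V. \<exists>z. V \<in> D_weak scale \<longrightarrow> z \<in> V \<and> norm z \<le> 1 \<and> z \<in> E"
    unfolding meets_def by blast
  then obtain g where g: "\<And>V. V \<in> D_weak scale \<Longrightarrow> g V \<in> V \<and> norm (g V) \<le> 1 \<and> g V \<in> E" by metis
  then show "\<exists>g. weakly_null_family scale g \<and> g ` D_weak scale \<subseteq> E"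
    unfolding weakly_null_family_iff by (intro exI[of _ g]) blast
qed

lemma B_coll_iff:
  assumes n: "n \<ge> 1"
  shows "x \<in> B_coll scale \<xi> n \<longleftrightarrow> collection (weakly_null_family scale) (D_weak scale) (Gam \<xi> n) x"
proof
  let ?D = "D_weak scale"
  assume x: "x \<in> B_coll scale \<xi> n"
  show "collection (weakly_null_family scale) ?D (Gam \<xi> n) x"
  proof (rule collectionI)
    fix t \<zeta> assume t: "map fst t @ [\<zeta>] \<in> Gam \<xi> n" "snd ` set t \<subseteq> ?D"
    have tu: "t @ [(\<zeta>, u)] \<in> tree_prod (Gam \<xi> n) ?D" if "u \<in> ?D" for u
      using t that by (auto simp: tree_prod_iff)
    have "t = [] \<or> t \<in> tree_prod (Gam \<xi> n) ?D"
      using Gam_prefix[OF n t(1), of "map fst t"] t(2) by (auto simp: tree_prod_iff)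
    then have "limitin (weak_topology scale) (\<lambda>u. x (t @ [(\<zeta>, u)])) 0 (tails ?D (\<lambda>U V. V \<subseteq> U))"
      using x tu[OF D_weak_UNIV] D_weak_UNIV unfolding B_coll_def weakly_null_def by blast
    moreover have "norm (x (t @ [(\<zeta>, u)])) \<le> 1" if "u \<in> ?D" for u
      using x tu[OF that] by (auto simp: B_coll_def)
    ultimately show "weakly_null_family scale (\<lambda>u. x (t @ [(\<zeta>, u)]))" by (simp add: weakly_null_family_def)
  qed
next
  let ?D = "D_weak scale"
  assume x: "collection (weakly_null_family scale) ?D (Gam \<xi> n) x"
  have "weakly_null scale ?D (\<lambda>U V. V \<subseteq> U) \<xi> n x"
    unfolding weakly_null_def
  proof (intro ballI allI impI)
    fix t \<zeta> assume "\<exists>u\<in>?D. t @ [(\<zeta>, u)] \<in> tree_prod (Gam \<xi> n) ?D"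
    then have "weakly_null_family scale (\<lambda>u. x (t @ [(\<zeta>, u)]))" by (intro collectionD[OF x]) (auto simp: tree_prod_iff)
    then show "limitin (weak_topology scale) (\<lambda>u. x (t @ [(\<zeta>, u)])) 0 (tails ?D (\<lambda>U V. V \<subseteq> U))"
      by (simp add: weakly_null_family_def)
  qed
  moreover have "norm (x t) \<le> 1" if t: "t \<in> tree_prod (Gam \<xi> n) ?D" for t
  proof -
    have "t \<noteq> []" using t Nil_notin_Gam[OF n, of \<xi>] by (auto simp: tree_prod_iff)
    then obtain s \<zeta> u where s: "t = s @ [(\<zeta>, u)]" by (metis rev_exhaust surj_pair)
    then have "weakly_null_family scale (\<lambda>u. x (s @ [(\<zeta>, u)]))" using t by (intro collectionD[OF x]) (auto simp: tree_prod_iff)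
    then show ?thesis using s t by (auto simp: weakly_null_family_def tree_prod_iff)
  qed
  ultimately show "x \<in> B_coll scale \<xi> n" by (simp add: B_coll_def)
qed

text \<open>The weak topology has a base of absolutely convex neighbourhoods.\<close>

lemma weak_base:
  assumes "V \<in> D_weak scale"
  obtains W where "W \<in> D_weak scale" "W \<subseteq> V" "convex W"
    "\<And>c z. norm c = 1 \<Longrightarrow> z \<in> W \<Longrightarrow> scale c z \<in> W"
proof -
  let ?B = "{f -` U | f U. operator scale (*) f \<and> open (U :: 'k set)}"
  define good where "good v V \<longleftrightarrow> (\<exists>W\<in>D_weak scale. (\<lambda>w. v + w) ` W \<subseteq> V \<and> convex W \<and>
      (\<forall>c z. norm c = 1 \<longrightarrow> z \<in> W \<longrightarrow> scale c z \<in> W))" for v and V :: "'x set"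
  have good_mono: "good v b" if ab: "good v a" "a \<subseteq> b" for v a b
  proof -
    from ab(1) obtain W where W: "W \<in> D_weak scale" "(\<lambda>w. v + w) ` W \<subseteq> a" "convex W"
      "\<forall>c z. norm c = 1 \<longrightarrow> z \<in> W \<longrightarrow> scale c z \<in> W"
      unfolding good_def by (elim bexE conjE)
    show ?thesis unfolding good_def
      using W(3,4) order_trans[OF W(2) ab(2)] by (intro bexI[OF _ W(1)] conjI)
  qed
  have "generate_topology_on ?B V"
    using assms unfolding D_weak_def weak_topology_def openin_topology_generated_by_iff by simp
  then have "\<forall>v\<in>V. good v V"
  proof induction
    case Empty
    then show ?case by simp
  next
    case (Int a b)
    show ?case
    proof
      fix v assume "v \<in> a \<inter> b"
      then have "good v a" "good v b" using Int by auto
      then obtain W1 W2 where "W1 \<in> D_weak scale \<and> (\<lambda>w. v + w) ` W1 \<subseteq> a \<and> convex W1 \<and>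
          (\<forall>c z. norm c = 1 \<longrightarrow> z \<in> W1 \<longrightarrow> scale c z \<in> W1)"
        "W2 \<in> D_weak scale \<and> (\<lambda>w. v + w) ` W2 \<subseteq> b \<and> convex W2 \<and>
          (\<forall>c z. norm c = 1 \<longrightarrow> z \<in> W2 \<longrightarrow> scale c z \<in> W2)"
        unfolding good_def by blast
      then show "good v (a \<inter> b)" unfolding good_def
        by (intro bexI[of _ "W1 \<inter> W2"]) (auto intro: D_weak_Int convex_Int)
    qed
  next
    case (UN K)
    show ?case
    proof
      fix v assume "v \<in> \<Union>K"
      then obtain k where k: "k \<in> K" "v \<in> k" by blast
      then have "good v k" using UN by blast
      then show "good v (\<Union>K)" using good_mono k(1) by (metis Sup_upper)
    qed
  next
    case (Basis s)
    then obtain f U where f: "operator scale (*) f" "open U" "s = f -` U" by blast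
    have bl: "bounded_linear f" and fs: "\<And>c z. f (scale c z) = c * f z"
      using f(1) by (auto simp: operator_def)
    have lin: "linear f" using bl by (rule bounded_linear.linear)
    show ?case
    proof
      fix v assume "v \<in> s"
      then obtain e where e: "e > 0" "\<And>y. dist y (f v) < e \<Longrightarrow> y \<in> U"
        using f(2,3) by (auto simp: open_dist)
      let ?W = "f -` ball 0 e"
      have "openin (weak_topology scale) ?W" unfolding weak_topology_def
        by (rule topology_generated_by_Basis) (use f(1) open_ball in blast)
      then have "?W \<in> D_weak scale" using e(1) by (simp add: D_weak_def linear_0[OF lin])
      moreover have "(\<lambda>w. v + w) ` ?W \<subseteq> s"
        using e(2) f(3) by (auto simp: linear_add[OF lin] dist_norm)
      moreover have "convex ?W" by (rule convex_linear_vimage[OF lin convex_ball])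
      moreover have "scale c z \<in> ?W" if "norm c = 1" "z \<in> ?W" for c z
        using that by (simp add: fs norm_mult)
      ultimately show "good v s" unfolding good_def by (intro bexI[of _ ?W] conjI allI impI)
    qed
  qed
  then have "good 0 V" using assms by (simp add: D_weak_def)
  then show ?thesis using that unfolding good_def by auto
qed

lemma linear_scale_left: "linear (scale c)"
proof (rule linearI)
  fix r x
  have "scale c (r *\<^sub>R x) = scale (c * of_real r) x" by (simp flip: scale_of_real)
  also have "\<dots> = r *\<^sub>R scale c x" by (simp add: mult.commute flip: scale_of_real)
  finally show "scale c (r *\<^sub>R x) = r *\<^sub>R scale c x" .
qed (rule scale_right_distrib)

lemma meets_rotate:
  assumes c: "norm c = 1" and E: "meets scale E"
  shows "meets scale {z. scale c z \<in> E}"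
  unfolding meets_def
proof
  fix V assume "V \<in> D_weak scale"
  then obtain W where W: "W \<in> D_weak scale" "W \<subseteq> V"
    "\<And>c z. norm c = 1 \<Longrightarrow> z \<in> W \<Longrightarrow> scale c z \<in> W"
    by (rule weak_base) blast
  obtain z where z: "z \<in> W" "norm z \<le> 1" "z \<in> E" using E W(1) unfolding meets_def by blast
  have ic: "norm (inverse c) = 1" "c \<noteq> 0" using c by (auto simp: norm_inverse)
  then show "\<exists>z\<in>V. norm z \<le> 1 \<and> z \<in> {z. scale c z \<in> E}"
    using W(2) W(3)[OF ic(1) z(1)] z
    by (intro bexI[of _ "scale (inverse c) z"]) (auto simp: norm_scale)
qed

text \<open>
  The averaging property holds because the vectors can be chosen one after the other in a convex
  neighbourhood.
\<close>
lemma null_family_meets: "null_family (meets scale)"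
proof
  show "upclosed (meets scale)" unfolding upclosed_def meets_def by blast
  show "partition_regular (meets scale)" unfolding partition_regular_def
  proof (intro allI impI, rule ccontr)
    fix E F assume EF: "meets scale (E \<union> F)" "\<not> (meets scale E \<or> meets scale F)"
    then obtain U V where U: "U \<in> D_weak scale" "\<not> (\<exists>z\<in>U. norm z \<le> 1 \<and> z \<in> E)"
      and V: "V \<in> D_weak scale" "\<not> (\<exists>z\<in>V. norm z \<le> 1 \<and> z \<in> F)"
      unfolding meets_def by blast
    then show False using EF(1) D_weak_Int[OF U(1) V(1)] unfolding meets_def by blast
  qed
  show "meets scale E" if "0 \<in> E" for E :: "'x set"
    using that unfolding meets_def D_weak_def by (auto intro!: bexI[of _ 0])
  show "\<exists>z\<in>E. norm z \<le> 1" if "meets scale E" for E :: "'x set"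
    using that D_weak_UNIV unfolding meets_def by blast
  show "meets scale E" if k: "1 \<le> k" and nest: "nest (meets scale) k {l. inverse (real k) *\<^sub>R sum_list l \<in> E}"
    for k and E :: "'x set"
    unfolding meets_def
  proof
    fix V assume "V \<in> D_weak scale"
    then obtain W where W: "W \<in> D_weak scale" "W \<subseteq> V" "convex W" by (rule weak_base) blast
    have "\<exists>l\<in>F. length l = m \<and> (\<forall>z\<in>set l. z \<in> W \<and> norm z \<le> 1)" if "nest (meets scale) m F"
      for m and F :: "'x list set"
      using that
    proof (induction m arbitrary: F)
      case (Suc m)
      then have "meets scale {z. nest (meets scale) m {l. z # l \<in> F}}" by simp
      then obtain z where z: "z \<in> W" "norm z \<le> 1" "nest (meets scale) m {l. z # l \<in> F}"
        using W(1) unfolding meets_def by blast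
      from Suc.IH[OF z(3)] obtain l where "z # l \<in> F" "length l = m" "\<forall>z\<in>set l. z \<in> W \<and> norm z \<le> 1"
        by blast
      then show ?case using z(1,2) by (intro bexI[of _ "z # l"]) auto
    qed simp
    from this[OF nest] obtain l where l: "inverse (real k) *\<^sub>R sum_list l \<in> E" "length l = k"
      "\<forall>z\<in>set l. z \<in> W \<and> norm z \<le> 1" by blast
    have "inverse (real k) *\<^sub>R sum_list l \<in> W \<inter> cball 0 1"
    proof -
      have eq: "inverse (real k) *\<^sub>R sum_list l = (\<Sum>i<k. (1 / real k) *\<^sub>R l ! i)"
        using l(2) by (simp add: sum_list_sum_nth scaleR_sum_right atLeast0LessThan inverse_eq_divide)
      show ?thesis unfolding eq
        by (rule convex_sum) (use k l W(3) in \<open>auto intro: convex_Int\<close>)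
    qed
    then show "\<exists>z\<in>V. norm z \<le> 1 \<and> z \<in> E"
      using l(1) W(2) by (intro bexI[of _ "inverse (real k) *\<^sub>R sum_list l"]) auto
  qed
qed

abbreviation "large \<equiv> Large (meets scale)"

lemma realizes_B_coll:
  assumes "n \<ge> 1"
  shows "nest (large \<xi>) n E \<longleftrightarrow> (\<exists>x\<in>B_coll scale \<xi> n.
    \<forall>t\<in>maximal (tree_prod (Gam \<xi> n) (D_weak scale)). block_sums (D_weak scale) \<xi> n x t \<in> E)"
proof -
  have ne: "D_weak scale \<noteq> {}" using D_weak_UNIV by blast
  have "(\<lambda>E. \<exists>g. weakly_null_family scale g \<and> g ` D_weak scale \<subseteq> E) = meets scale"
    by (rule ext) (rule meets_iff)
  then show ?thesis
    using realizes_iff[OF assms, of "weakly_null_family scale" "D_weak scale" \<xi> E]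
    by (simp add: realizes_def maximal_tree_prod[OF ne] B_coll_iff[OF assms] Bex_def)
qed

lemma realizes_B_coll_1:
  "large \<xi> E \<longleftrightarrow> (\<exists>x\<in>B_coll scale \<xi> 1.
    \<forall>t\<in>maximal (tree_prod (Gam \<xi> 1) (D_weak scale)). branch_sum (Prob \<xi> 1) x t \<in> E)"
proof -
  have ne: "D_weak scale \<noteq> {}" using D_weak_UNIV by blast
  have "large \<xi> E \<longleftrightarrow> nest (large \<xi>) 1 {l. \<exists>z\<in>E. l = [z]}" by (simp add: nest_1)
  then show ?thesis unfolding realizes_B_coll[OF order_refl]
    by (simp add: maximal_tree_prod[OF ne] block_sums_1_maximal)
qed

section \<open>The modulus and the seminorm in terms of large sets\<close>

text \<open>
  Both quantities are now expressed by large sets: the modulus by single steps, and \<open>\<theta>\<^bsub>\<xi>,n\<^esub>\<close> by lists of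
  steps.  Suprema over collections with infima over branches become statements that every large set
  contains a vector with an upper bound.
\<close>
lemma rho_leI:
  assumes "\<And>y E d. N y \<le> 1 \<Longrightarrow> large \<xi> E \<Longrightarrow> d > 0 \<Longrightarrow> \<exists>z\<in>E. N (y + \<sigma> *\<^sub>R A z) \<le> 1 + r + d"
    and "0 \<le> r"
  shows "rho scale \<xi> \<sigma> A N \<le> ereal r"
proof -
  have "rho_at scale \<xi> \<sigma> y A N \<le> ereal r" if y: "N y \<le> 1" for y
    unfolding rho_at_def
  proof (rule SUP_least, rule ereal_le_epsilon2)
    fix x and d :: real assume x: "x \<in> B_coll scale \<xi> 1" and d: "d > 0"
    let ?M = "maximal (tree_prod (Gam \<xi> 1) (D_weak scale))"
    have "large \<xi> (branch_sum (Prob \<xi> 1) x ` ?M)" unfolding realizes_B_coll_1 using x by blast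
    from assms(1)[OF y this d] obtain t where t: "t \<in> ?M" "N (y + \<sigma> *\<^sub>R A (branch_sum (Prob \<xi> 1) x t)) \<le> 1 + r + d"
      by blast
    show "(INF t\<in>?M. ereal (N (y + \<sigma> *\<^sub>R A (\<Sum>s\<in>{s. s \<noteq> [] \<and> prefix s t}. Prob \<xi> 1 (map fst s) *\<^sub>R x s)) - 1))
        \<le> ereal r + ereal d"
      by (rule INF_lower2[OF t(1)]) (use t(2) in \<open>simp add: branch_sum_def\<close>)
  qed
  then show ?thesis using assms(2) unfolding rho_def by (auto simp: unit_ball_def intro!: SUP_least)
qed

lemma rho_leD:
  fixes A :: "'x \<Rightarrow> 'y::banach"
  assumes rho: "rho scale \<xi> \<sigma> A N \<le> ereal r" and r: "0 \<le> r" and N0: "N 0 = 0"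
    and y: "N y \<le> 1" and E: "large \<xi> E" and d: "d > 0"
  shows "\<exists>z\<in>E. N (y + \<sigma> *\<^sub>R A z) \<le> 1 + r + d"
proof (cases "(UNIV :: 'y set) = {0}")
  case True
  then have "v = 0" for v :: 'y by blast
  then have "N v = 0" for v using N0 by metis
  moreover obtain z where "z \<in> E" using null_family.Large_ball[OF null_family_meets E] by blast
  ultimately show ?thesis using r d by (intro bexI[of _ z]) auto
next
  case False
  let ?M = "maximal (tree_prod (Gam \<xi> 1) (D_weak scale))"
  obtain x where x: "x \<in> B_coll scale \<xi> 1" "\<forall>t\<in>?M. branch_sum (Prob \<xi> 1) x t \<in> E"
    using E unfolding realizes_B_coll_1 by blast
  have "(INF t\<in>?M. ereal (N (y + \<sigma> *\<^sub>R A (branch_sum (Prob \<xi> 1) x t)) - 1)) \<le> rho_at scale \<xi> \<sigma> y A N"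
    unfolding rho_at_def branch_sum_def by (rule SUP_upper[OF x(1)])
  also have "\<dots> \<le> rho scale \<xi> \<sigma> A N"
    unfolding rho_def using False y by (auto simp: unit_ball_def intro: SUP_upper)
  also have "\<dots> < ereal (r + d)" using rho d by (meson ereal_less_eq(3) le_less_trans less_ereal.simps(1) less_add_same_cancel1)
  finally obtain t where "t \<in> ?M" "N (y + \<sigma> *\<^sub>R A (branch_sum (Prob \<xi> 1) x t)) - 1 < r + d"
    unfolding INF_less_iff by auto
  then show ?thesis using x(2) by (intro bexI[of _ "branch_sum (Prob \<xi> 1) x t"]) auto
qed

text \<open>
  The coefficients are \<open>1/n\<close> for \<open>i \<le> n\<close> and \<open>0\<close> after that; the number \<open>m\<close> of blocks may be smaller or
  larger than \<open>n\<close>.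
\<close>
lemma theta_term:
  assumes n: "n \<ge> 1"
  shows "(\<Sum>i=1..m. scale (inverse (of_nat n) * (\<Sum>j=1..n. basis_vec j i)) (block_sum D \<xi> m x t i)) =
     inverse (real n) *\<^sub>R sum_list (take n (block_sums D \<xi> m x t))"
proof -
  have c: "inverse (of_nat n) * (\<Sum>j=1..n. basis_vec j i) = (if i \<le> n then of_real (inverse (real n)) else (0 :: 'k))"
    if "i \<in> {1..m}" for i
    using that by (simp add: basis_vec_def)
  have "(\<Sum>i=1..m. scale (inverse (of_nat n) * (\<Sum>j=1..n. basis_vec j i)) (block_sum D \<xi> m x t i)) =
      (\<Sum>i=1..m. if i \<le> n then inverse (real n) *\<^sub>R block_sum D \<xi> m x t i else 0)"
    by (intro sum.cong refl) (simp only: c, simp add: scale_of_real del: of_real_inverse)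
  also have "\<dots> = (\<Sum>i\<in>{1..min n m}. inverse (real n) *\<^sub>R block_sum D \<xi> m x t i)"
    by (rule sum.mono_neutral_cong_right) auto
  also have "\<dots> = inverse (real n) *\<^sub>R (\<Sum>i\<in>{1..min n m}. block_sum D \<xi> m x t i)"
    by (simp add: scaleR_sum_right)
  also have "(\<Sum>i\<in>{1..min n m}. block_sum D \<xi> m x t i) = sum_list (take n (block_sums D \<xi> m x t))"
  proof -
    have "take n [1..<m + 1] = [1..<min n m + 1]"
    proof (cases "n \<le> m")
      case True
      then show ?thesis using take_upt[of 1 n "m + 1"] by (simp add: add.commute del: upt_Suc)
    qed (simp add: min_def)
    then have "take n (block_sums D \<xi> m x t) = map (block_sum D \<xi> m x t) [1..<min n m + 1]"
      by (simp add: block_sums_def take_map)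
    moreover have "sum_list (map (block_sum D \<xi> m x t) [1..<min n m + 1]) =
        sum (block_sum D \<xi> m x t) (set [1..<min n m + 1])"
      by (rule sum_list_distinct_conv_sum_set) simp
    moreover have "set [1..<min n m + 1] = {1..min n m}" by auto
    ultimately show ?thesis by metis
  qed
  finally show ?thesis .
qed

lemma theta_eq:
  assumes n: "n \<ge> 1"
  shows "theta scale \<xi> n A = (SUP m\<in>{1..}. SUP x\<in>B_coll scale \<xi> m.
     INF t\<in>maximal (tree_prod (Gam \<xi> m) (D_weak scale)).
       ereal (norm (A (inverse (real n) *\<^sub>R sum_list (take n (block_sums (D_weak scale) \<xi> m x t))))))"
  unfolding theta_def xi_seminorm_def theta_term[OF n, unfolded block_sum_def] ..

lemma theta_leI:
  assumes n: "n \<ge> 1"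
    and "\<And>m E d. m \<ge> 1 \<Longrightarrow> nest (large \<xi>) m E \<Longrightarrow> d > 0 \<Longrightarrow>
      \<exists>l\<in>E. norm (A (inverse (real n) *\<^sub>R sum_list (take n l))) \<le> c + d"
  shows "theta scale \<xi> n A \<le> ereal c"
  unfolding theta_eq[OF n]
proof (intro SUP_least, rule ereal_le_epsilon2)
  fix m x and d :: real assume m: "m \<in> {1..}" and x: "x \<in> B_coll scale \<xi> m" and d: "d > 0"
  let ?M = "maximal (tree_prod (Gam \<xi> m) (D_weak scale))"
  have m: "m \<ge> 1" using m by simp
  have "nest (large \<xi>) m (block_sums (D_weak scale) \<xi> m x ` ?M)"
    unfolding realizes_B_coll[OF m] using x by blast
  from assms(2)[OF m this d] obtain t where t: "t \<in> ?M"
    "norm (A (inverse (real n) *\<^sub>R sum_list (take n (block_sums (D_weak scale) \<xi> m x t)))) \<le> c + d" by blast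
  show "(INF t\<in>?M. ereal (norm (A (inverse (real n) *\<^sub>R sum_list (take n (block_sums (D_weak scale) \<xi> m x t))))))
      \<le> ereal c + ereal d"
    by (rule INF_lower2[OF t(1)]) (use t(2) in simp)
qed

lemma theta_leD:
  assumes n: "n \<ge> 1" and theta: "theta scale \<xi> n A \<le> ereal c"
    and E: "nest (large \<xi>) n E" and d: "d > 0"
  shows "\<exists>l\<in>E. norm (A (inverse (real n) *\<^sub>R sum_list l)) \<le> c + d"
proof -
  let ?M = "maximal (tree_prod (Gam \<xi> n) (D_weak scale))"
  obtain x where x: "x \<in> B_coll scale \<xi> n" "\<forall>t\<in>?M. block_sums (D_weak scale) \<xi> n x t \<in> E"
    using E unfolding realizes_B_coll[OF n] by blast
  have "(INF t\<in>?M. ereal (norm (A (inverse (real n) *\<^sub>R sum_list (take n (block_sums (D_weak scale) \<xi> n x t))))))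
      \<le> theta scale \<xi> n A"
    unfolding theta_eq[OF n] by (rule SUP_upper2[of n]) (use n x(1) in \<open>auto intro: SUP_upper\<close>)
  also have "\<dots> < ereal (c + d)" using theta d by (meson ereal_less_eq(3) le_less_trans less_ereal.simps(1) less_add_same_cancel1)
  finally obtain t where t: "t \<in> ?M"
    "norm (A (inverse (real n) *\<^sub>R sum_list (take n (block_sums (D_weak scale) \<xi> n x t)))) < c + d"
    unfolding INF_less_iff by auto
  moreover have "take n (block_sums (D_weak scale) \<xi> n x t) = block_sums (D_weak scale) \<xi> n x t"
    by (simp add: block_sums_def)
  ultimately show ?thesis using x(2) by (intro bexI[of _ "block_sums (D_weak scale) \<xi> n x t"]) auto
qed

end

section \<open>Renorming the codomain\<close>

lemma unit_ball_inclusions: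
  assumes "b \<ge> 1" "\<And>y. norm y \<le> b * N y" "\<And>y. N y \<le> norm (y :: 'y::real_normed_vector)"
  shows "(\<lambda>y. inverse b *\<^sub>R y) ` unit_ball N \<subseteq> unit_ball norm"
    "unit_ball norm \<subseteq> (\<lambda>y. b *\<^sub>R y) ` unit_ball N"
proof -
  show "(\<lambda>y. inverse b *\<^sub>R y) ` unit_ball N \<subseteq> unit_ball norm"
  proof (intro image_subsetI)
    fix y assume "y \<in> unit_ball N"
    then have "norm y \<le> b * 1"
      using assms(1,2) by (simp add: unit_ball_def) (meson mult_left_le order_trans zero_le_one)
    then show "inverse b *\<^sub>R y \<in> unit_ball norm"
      using assms(1) by (simp add: unit_ball_def field_simps)
  qed
  show "unit_ball norm \<subseteq> (\<lambda>y. b *\<^sub>R y) ` unit_ball N"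
  proof
    fix y :: 'y assume y: "y \<in> unit_ball norm"
    have "N (inverse b *\<^sub>R y) \<le> norm (inverse b *\<^sub>R y)" by (rule assms(3))
    also have "\<dots> \<le> 1" using y assms(1) by (simp add: unit_ball_def field_simps)
    finally show "y \<in> (\<lambda>y. b *\<^sub>R y) ` unit_ball N"
      using assms(1) by (intro image_eqI[of _ _ "inverse b *\<^sub>R y"]) (auto simp: unit_ball_def)
  qed
qed

text \<open>
  An operator between Banach spaces over the same field, together with an ordinal.
\<close>
locale operator_setting = X: banach_over sX + Y: banach_over sY
  for sX :: "'k::real_or_complex \<Rightarrow> 'x::banach \<Rightarrow> 'x" and sY :: "'k \<Rightarrow> 'y::banach \<Rightarrow> 'y" +
  fixes A :: "'x \<Rightarrow> 'y" and \<xi> :: "'o ordinal"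
  assumes op: "operator sX sY A"
begin

abbreviation "large_A \<equiv> Large (meets sX) \<xi>"

lemma linear_A: "linear A"
  using op by (simp add: operator_def bounded_linear.linear)

lemma A_scale: "A (sX c x) = sY c (A x)"
  using op by (simp add: operator_def)

lemma scaleY_scaleR: "sY c (r *\<^sub>R y) = r *\<^sub>R sY c y"
  by (rule linear_scale[OF Y.linear_scale_left])

text \<open>
  The key construction: if the sum of at most \<open>n\<close> steps of size \<open>\<sigma>\<close> cannot be forced to have norm
  above \<open>M\<close>, then there is a norm, equivalent up to the factor \<open>M + 1\<close>, with modulus at most \<open>M / n\<close> at \<open>\<sigma>\<close>.
\<close>
lemma exists_renorming:
  assumes n: "n \<ge> 1"
    and bound: "\<And>k E e. k \<le> n \<Longrightarrow> nest large_A k E \<Longrightarrow> e > 0 \<Longrightarrow>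
      \<exists>l\<in>E. norm (\<sigma> *\<^sub>R A (sum_list l)) \<le> M + e"
  obtains N where "equivalent_norm sY N" "\<And>y. norm y \<le> (M + 1) * N y" "\<And>y. N y \<le> norm y"
    "rho sX \<xi> \<sigma> A N \<le> ereal (M / real n)" "0 \<le> M"
proof -
  interpret nf: null_family "meets sX" by (rule X.null_family_meets)
  let ?B = "\<lambda>z. \<sigma> *\<^sub>R A z"
  interpret lf: large_family large_A ?B M n
  proof (rule large_family.intro)
    show "upclosed large_A" by (rule Large_upclosed[OF nf.up])
    show "partition_regular large_A" by (rule nf.Large_partition_regular)
    show "large_A E" if "0 \<in> E" for E using that by (rule nf.Large_zero)
    show "\<not> large_A {}" using nf.Large_ball by blast
    show "linear ?B" using linear_compose[OF linear_A linear_scaleR] by (simp add: o_def)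
  qed (use n bound in auto)
  let ?N = "minkowski lf.F (M + 1)"
  have le: "lf.F y \<le> lf.F (sY u y)" if u: "norm u = 1" for u y
  proof (rule lf.F_le_rotate[of "sX (inverse u)"])
    have u0: "u \<noteq> 0" "norm (inverse u) = 1" using u by (auto simp: norm_inverse)
    show "linear (sX (inverse u))" by (rule X.linear_scale_left)
    show "large_A {z. sX (inverse u) z \<in> E}" if "large_A E" for E
      using nf.Large_vimage[OF X.linear_scale_left X.meets_rotate[OF u0(2)] that] .
    show "norm (y + \<sigma> *\<^sub>R A (sX (inverse u) z)) = norm (sY u y + \<sigma> *\<^sub>R A z)" for z
    proof -
      have "sY u (y + \<sigma> *\<^sub>R A (sX (inverse u) z)) = sY u y + \<sigma> *\<^sub>R A z"
        using u0(1) by (simp add: Y.scale_right_distrib A_scale scaleY_scaleR)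
      then show ?thesis using Y.norm_scale[of u "y + \<sigma> *\<^sub>R A (sX (inverse u) z)"] u by simp
    qed
  qed
  have rot: "lf.F (sY u y) = lf.F y" if u: "norm u = 1" for u y
  proof (rule antisym)
    have "u \<noteq> 0" "norm (inverse u) = 1" using u by (auto simp: norm_inverse)
    then show "lf.F (sY u y) \<le> lf.F y" using le[of "inverse u" "sY u y"] by simp
  qed (rule le[OF u])
  have hom: "?N (sY c y) = norm c * ?N y" for c y
  proof (cases "c = 0")
    case True
    then show ?thesis using lf.N_zero_iff[of 0] by simp
  next
    case False
    define u where "u = c / of_real (norm c)"
    have u: "norm u = 1" "c = u * of_real (norm c)" using False by (auto simp: u_def norm_divide)
    have "sY c y = sY u (sY (of_real (norm c)) y)" using u(2) by (metis Y.scale_scale)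
    then have "?N (sY c y) = ?N (sY u (norm c *\<^sub>R y))" by (simp add: Y.scale_of_real)
    also have "\<dots> = ?N (norm c *\<^sub>R y)"
      by (rule lf.N_isometry[OF rot[OF u(1)] Y.linear_scale_left])
    finally show ?thesis using lf.N_scaleR[of "norm c" y] False by simp
  qed
  have M: "0 \<le> M" by (rule lf.M_nonneg)
  have "norm y / (M + 1) \<le> ?N y" for y using lf.N_lower[of y] M by (simp add: field_simps)
  then have "equivalent_norm sY ?N"
    unfolding equivalent_norm_def using lf.N_nonneg lf.N_zero_iff lf.N_triangle hom lf.N_upper M
    by (intro conjI allI exI[of _ "1 / (M + 1)"] exI[of _ "1 :: real"]) auto
  moreover have "rho sX \<xi> \<sigma> A ?N \<le> ereal (M / real n)"
    by (rule X.rho_leI[OF lf.N_step]) (use M in auto)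
  ultimately show ?thesis using that lf.N_lower lf.N_upper M by blast
qed

lemma equivalent_norm_scaleR:
  assumes "equivalent_norm sY N" shows "N (r *\<^sub>R y) = \<bar>r\<bar> * N y"
proof -
  have "N (sY (of_real r) y) = norm (of_real r :: 'k) * N y"
    using assms by (simp add: equivalent_norm_def)
  then show ?thesis by (simp add: Y.scale_of_real)
qed

lemma norm_le_of_inclusion:
  assumes N: "equivalent_norm sY N" and b: "b \<ge> 1"
    and sub: "(\<lambda>y. inverse b *\<^sub>R y) ` unit_ball N \<subseteq> unit_ball norm"
  shows "norm y \<le> b * N y"
proof (cases "y = 0")
  case True
  then show ?thesis using N b by (simp add: equivalent_norm_def)
next
  case False
  then have pos: "N y > 0" using N unfolding equivalent_norm_def by (metis order_le_less)
  have "(1 / N y) *\<^sub>R y \<in> unit_ball N"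
    using pos by (simp add: unit_ball_def equivalent_norm_scaleR[OF N])
  then have "inverse b *\<^sub>R ((1 / N y) *\<^sub>R y) \<in> unit_ball norm" using sub by blast
  then show ?thesis using pos b by (simp add: unit_ball_def field_simps)
qed

text \<open>
  Conversely, a bound \<open>r\<close> for the modulus at \<open>\<sigma>\<close> controls \<open>n\<close> successive steps: starting at zero, each
  step increases the norm by about \<open>r\<close> at most, as soon as that norm is at least \<open>1\<close>.
\<close>
lemma theta_le_of_rho:
  assumes N: "equivalent_norm sY N" and b: "b \<ge> 1" and nb: "\<And>y. norm y \<le> b * N y"
    and s: "\<sigma> > 0" and r: "r \<ge> 0" and rho: "rho sX \<xi> \<sigma> A N \<le> ereal r" and n: "n \<ge> 1"
  shows "theta sX \<xi> n A \<le> ereal (b * (1 + real n * r) / (\<sigma> * real n))"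
proof -
  interpret nf: null_family "meets sX" by (rule X.null_family_meets)
  have N0: "N 0 = 0" and tri: "\<And>y z. N (y + z) \<le> N y + N z" using N by (auto simp: equivalent_norm_def)
  have step: "\<exists>z\<in>E. N (y + \<sigma> *\<^sub>R A z) \<le> K + (r + d)"
    if y: "N y \<le> K" and K: "K \<ge> 1" and E: "large_A E" and d: "d > 0" for y K E d
  proof -
    have "N ((1 / K) *\<^sub>R y) \<le> 1" using y K by (simp add: equivalent_norm_scaleR[OF N])
    from X.rho_leD[OF rho r N0 this E d] obtain z where z: "z \<in> E"
      "N ((1 / K) *\<^sub>R y + \<sigma> *\<^sub>R A z) \<le> 1 + r + d" by blast
    \<comment> \<open>the modulus applies to \<open>y / K\<close>, and the remaining part of \<open>y\<close> has norm at most \<open>K - 1\<close>\<close>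
    have eq: "y + \<sigma> *\<^sub>R A z = ((1 / K) *\<^sub>R y + \<sigma> *\<^sub>R A z) + (1 - 1 / K) *\<^sub>R y"
      by (simp add: scaleR_left_diff_distrib)
    have "N (y + \<sigma> *\<^sub>R A z) \<le> (1 + r + d) + (1 - 1 / K) * N y"
      unfolding eq using tri[of "(1 / K) *\<^sub>R y + \<sigma> *\<^sub>R A z" "(1 - 1 / K) *\<^sub>R y"] z(2) K
      by (simp add: equivalent_norm_scaleR[OF N])
    also have "(1 - 1 / K) * N y \<le> (1 - 1 / K) * K" using y K by (intro mult_left_mono) auto
    also have "(1 - 1 / K) * K = K - 1" using K by (simp add: field_simps)
    finally show ?thesis using z(1) by (intro bexI[of _ z]) auto
  qed
  have steps: "\<exists>l\<in>E. N (y + \<sigma> *\<^sub>R A (sum_list (take k l))) \<le> K + real k * (r + d)"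
    if "N y \<le> K" "K \<ge> 1" "nest large_A m E" and d: "d > 0" for y K E d k m
    using that(1-3)
  proof (induction m arbitrary: y K k E)
    case 0
    then have "N y \<le> K + real k * (r + d)" using r d by (intro add_increasing2) auto
    then show ?case using 0 by (intro bexI[of _ "[]"]) (auto simp: linear_0[OF linear_A])
  next
    case (Suc m)
    let ?E = "{z. nest large_A m {l. z # l \<in> E}}"
    have E: "large_A ?E" using Suc.prems by simp
    show ?case
    proof (cases k)
      case 0
      obtain z where "z \<in> ?E" using nf.Large_ball[OF E] by blast
      then have "nest large_A m {l. z # l \<in> E}" by simp
      from Suc.IH[OF Suc.prems(1,2) this, of 0] obtain l where
        "z # l \<in> E" "N (y + \<sigma> *\<^sub>R A (sum_list (take 0 l))) \<le> K" by auto
      then show ?thesis using 0 by (intro bexI[of _ "z # l"]) auto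
    next
      case (Suc k')
      obtain z where z: "nest large_A m {l. z # l \<in> E}" "N (y + \<sigma> *\<^sub>R A z) \<le> K + (r + d)"
        using step[OF Suc.prems(1,2) E d] by auto
      have "K + (r + d) \<ge> 1" using Suc.prems r d by simp
      from Suc.IH[OF z(2) this z(1), of k'] obtain l where l: "z # l \<in> E"
        "N (y + \<sigma> *\<^sub>R A z + \<sigma> *\<^sub>R A (sum_list (take k' l))) \<le> K + (r + d) + real k' * (r + d)" by auto
      have e1: "y + \<sigma> *\<^sub>R A z + \<sigma> *\<^sub>R A (sum_list (take k' l)) = y + \<sigma> *\<^sub>R A (sum_list (take k (z # l)))"
        using Suc by (simp add: linear_add[OF linear_A] scaleR_add_right)
      have e2: "K + (r + d) + real k' * (r + d) = K + real k * (r + d)"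
        using Suc by (simp add: algebra_simps)
      show ?thesis using l unfolding e1 e2 by blast
    qed
  qed
  show ?thesis
  proof (rule X.theta_leI[OF n])
    fix m and E :: "'x list set" and d :: real
    assume E: "nest large_A m E" and d: "d > 0"
    have d': "d * \<sigma> / b > 0" using d s b by simp
    obtain l where l: "l \<in> E" "N (\<sigma> *\<^sub>R A (sum_list (take n l))) \<le> 1 + real n * (r + d * \<sigma> / b)"
      using steps[OF _ order_refl E d', of 0 n] N0 by auto
    have "norm (A (inverse (real n) *\<^sub>R sum_list (take n l))) =
        norm (\<sigma> *\<^sub>R A (sum_list (take n l))) / (\<sigma> * real n)"
      using s n by (simp add: linear_scale[OF linear_A] field_simps)
    also have "\<dots> \<le> b * (1 + real n * (r + d * \<sigma> / b)) / (\<sigma> * real n)"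
    proof (rule divide_right_mono)
      show "norm (\<sigma> *\<^sub>R A (sum_list (take n l))) \<le> b * (1 + real n * (r + d * \<sigma> / b))"
        using order_trans[OF nb mult_left_mono[OF l(2)]] b by simp
    qed (use s in simp)
    also have "\<dots> = b * (1 + real n * r) / (\<sigma> * real n) + d"
      using s n b by (simp add: field_simps)
    finally show "\<exists>l\<in>E. norm (A (inverse (real n) *\<^sub>R sum_list (take n l))) \<le>
        b * (1 + real n * r) / (\<sigma> * real n) + d" using l(1) by blast
  qed
qed

text \<open>
  With \<open>s = 1/p\<close> the conjugate exponent satisfies \<open>1/q = 1 - s\<close>; this covers \<open>p = \<infinity>\<close> with \<open>s = 0\<close>.
\<close>
lemma N_class_iff:
  assumes P: "1 / P = ereal s" and s: "s < 1"
  shows "A \<in> N_class sX sY \<xi> P \<longleftrightarrow>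
    (\<exists>K\<ge>0. \<forall>n\<ge>1. theta sX \<xi> n A \<le> ereal (K * real n powr (s - 1)))"
proof -
  let ?S = "\<lambda>s. SUP n\<in>{1..}. theta sX \<xi> n A * ereal (real n powr s)"
  have q: "1 / P + 1 / ereal q = 1 \<longleftrightarrow> q \<noteq> 0 \<and> 1 / q = 1 - s" for q
  proof (cases "q = 0")
    case True
    then show ?thesis by (simp add: P divide_ereal_def one_ereal_def zero_ereal_def[symmetric])
  next
    case False
    then have "1 / ereal q = ereal (1 / q)" by (simp add: one_ereal_def)
    then have "1 / P + 1 / ereal q = ereal (s + 1 / q)" by (simp add: P)
    then show ?thesis using False by (auto simp: one_ereal_def)
  qed
  have "A \<in> N_class sX sY \<xi> P \<longleftrightarrow> ?S (1 - s) < \<infinity>"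
  proof
    assume "A \<in> N_class sX sY \<xi> P"
    then show "?S (1 - s) < \<infinity>" unfolding N_class_def q by auto
  next
    assume "?S (1 - s) < \<infinity>"
    then show "A \<in> N_class sX sY \<xi> P" unfolding N_class_def q
      using op s by (intro CollectI conjI exI[of _ "1 / (1 - s)"]) auto
  qed
  also have "\<dots> \<longleftrightarrow> (\<exists>K\<ge>0. \<forall>n\<ge>1. theta sX \<xi> n A \<le> ereal (K * real n powr (s - 1)))"
  proof
    assume fin: "?S (1 - s) < \<infinity>"
    obtain K where K: "?S (1 - s) \<le> ereal K" "K \<ge> 0"
    proof -
      obtain K0 where "?S (1 - s) \<le> ereal K0" using fin by (cases "?S (1 - s)") auto
      then have "?S (1 - s) \<le> ereal (max 0 K0)" by (rule order_trans) simp
      then show ?thesis by (rule that) simp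
    qed
    have "theta sX \<xi> n A \<le> ereal (K * real n powr (s - 1))" if n: "n \<ge> 1" for n
    proof -
      have pos: "real n powr (1 - s) > 0" using n by simp
      have "theta sX \<xi> n A * ereal (real n powr (1 - s)) \<le> ?S (1 - s)"
        by (rule SUP_upper) (use n in simp)
      also have "\<dots> \<le> ereal K" by (rule K(1))
      finally have "theta sX \<xi> n A \<le> ereal (K / real n powr (1 - s))"
        using pos by (cases "theta sX \<xi> n A") (auto simp: pos_le_divide_eq)
      also have "K / real n powr (1 - s) = K * real n powr (s - 1)"
        using powr_minus[of "real n" "1 - s"] by (simp add: divide_inverse)
      finally show ?thesis .
    qed
    then show "\<exists>K\<ge>0. \<forall>n\<ge>1. theta sX \<xi> n A \<le> ereal (K * real n powr (s - 1))"
      by (intro exI[of _ K]) (simp add: K(2))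
  next
    assume "\<exists>K\<ge>0. \<forall>n\<ge>1. theta sX \<xi> n A \<le> ereal (K * real n powr (s - 1))"
    then obtain K where K: "\<And>n. n \<ge> 1 \<Longrightarrow> theta sX \<xi> n A \<le> ereal (K * real n powr (s - 1))" by blast
    have "?S (1 - s) \<le> ereal K"
    proof (rule SUP_least)
      fix n :: nat assume "n \<in> {1..}"
      then have n: "n \<ge> 1" by simp
      have "theta sX \<xi> n A * ereal (real n powr (1 - s)) \<le>
          ereal (K * real n powr (s - 1)) * ereal (real n powr (1 - s))"
        by (rule ereal_mult_right_mono[OF K[OF n]]) simp
      also have "\<dots> = ereal K" using n by (simp add: powr_add[symmetric])
      finally show "theta sX \<xi> n A * ereal (real n powr (1 - s)) \<le> ereal K" .
    qed
    then show "?S (1 - s) < \<infinity>" by (rule le_less_trans) simp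
  qed
  finally show ?thesis .
qed

lemma nest_bound_of_theta:
  assumes K: "K \<ge> 0" "\<And>n. n \<ge> 1 \<Longrightarrow> theta sX \<xi> n A \<le> ereal (K * real n powr (s - 1))"
    and s: "0 \<le> s" and E: "nest large_A k E" and k: "k \<le> n" and e: "e > 0"
  shows "\<exists>l\<in>E. norm (A (sum_list l)) \<le> K * real n powr s + e"
proof (cases "k = 0")
  case True
  then show ?thesis using E e K(1)
    by (intro bexI[of _ "[]"]) (auto simp: linear_0[OF linear_A] intro!: add_nonneg_nonneg)
next
  case False
  then have k1: "k \<ge> 1" by simp
  have "e / real k > 0" using e k1 by simp
  from X.theta_leD[OF k1 K(2)[OF k1] E this] obtain l where l: "l \<in> E"
    "norm (A (inverse (real k) *\<^sub>R sum_list l)) \<le> K * real k powr (s - 1) + e / real k" by blast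
  have "norm (A (sum_list l)) = real k * norm (A (inverse (real k) *\<^sub>R sum_list l))"
    using k1 by (simp add: linear_scale[OF linear_A])
  also have "\<dots> \<le> real k * (K * real k powr (s - 1) + e / real k)"
    using l(2) by (intro mult_left_mono) auto
  also have "\<dots> = K * real k powr s + e"
    using k1 by (simp add: powr_diff field_simps)
  also have "\<dots> \<le> K * real n powr s + e"
    using K(1) s k by (intro add_right_mono mult_left_mono powr_mono2) auto
  finally show ?thesis using l(1) by blast
qed

text \<open>
  For \<open>\<sigma> \<le> 1\<close> the number of steps is \<open>n \<approx> \<sigma>\<^bsup>-p\<^esup>\<close>, for which \<open>\<sigma> n\<^bsup>1/p\<^esup>\<close> is of order \<open>1\<close> and \<open>1/n \<le> \<sigma>\<^sup>p\<close>.
\<close>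
lemma renorming_small:
  assumes p: "1 < p" and K: "K \<ge> 0" "\<And>n. n \<ge> 1 \<Longrightarrow> theta sX \<xi> n A \<le> ereal (K * real n powr (1 / p - 1))"
    and s: "0 < \<sigma>" "\<sigma> \<le> 1"
  obtains N where "equivalent_norm sY N" "\<And>y. norm y \<le> (2 * K + 1) * N y" "\<And>y. N y \<le> norm y"
    "rho sX \<xi> \<sigma> A N \<le> ereal (2 * K * \<sigma> powr p)"
proof -
  define n where "n = nat \<lceil>\<sigma> powr (- p)\<rceil>"
  have ge1: "\<sigma> powr (- p) \<ge> 1"
    using powr_mono_both'[of 0 p \<sigma> 1] s p
    by (simp add: powr_minus one_le_inverse powr_le1)
  have n: "real n \<ge> \<sigma> powr (- p)" "real n \<le> 2 * \<sigma> powr (- p)" "n \<ge> 1"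
  proof -
    show 1: "real n \<ge> \<sigma> powr (- p)" unfolding n_def by (rule real_nat_ceiling_ge)
    show "real n \<le> 2 * \<sigma> powr (- p)" unfolding n_def using ge1 by linarith
    show "n \<ge> 1" using 1 ge1 by linarith
  qed
  have root: "\<sigma> * real n powr (1 / p) \<le> 2"
  proof -
    have "real n powr (1 / p) \<le> (2 * \<sigma> powr (- p)) powr (1 / p)"
      using n(2) p by (intro powr_mono2) auto
    also have "\<dots> = 2 powr (1 / p) * \<sigma> powr (- 1)"
      using s p by (simp add: powr_mult powr_powr)
    also have "\<dots> \<le> 2 * \<sigma> powr (- 1)"
      using powr_mono[of "1 / p" 1 2] p by (intro mult_right_mono) auto
    finally have "\<sigma> * real n powr (1 / p) \<le> \<sigma> * (2 * \<sigma> powr (- 1))"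
      using s by (intro mult_left_mono) auto
    also have "\<dots> = 2" using s by (simp add: powr_minus)
    finally show ?thesis .
  qed
  obtain N where N: "equivalent_norm sY N" "\<And>y. norm y \<le> (2 * K + 1) * N y" "\<And>y. N y \<le> norm y"
    "rho sX \<xi> \<sigma> A N \<le> ereal (2 * K / real n)"
  proof (rule exists_renorming[of n \<sigma> "2 * K"])
    fix k E and e :: real assume k: "k \<le> n" and E: "nest large_A k E" and e: "e > 0"
    have "e / \<sigma> > 0" using e s by simp
    from nest_bound_of_theta[OF K _ E k this] p obtain l where l: "l \<in> E"
      "norm (A (sum_list l)) \<le> K * real n powr (1 / p) + e / \<sigma>" by auto
    have "norm (\<sigma> *\<^sub>R A (sum_list l)) \<le> \<sigma> * (K * real n powr (1 / p) + e / \<sigma>)"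
      using l(2) s by simp
    also have "\<dots> = K * (\<sigma> * real n powr (1 / p)) + e" using s by (simp add: algebra_simps)
    also have "\<dots> \<le> K * 2 + e" using root K(1) by (intro add_right_mono mult_left_mono) auto
    finally show "\<exists>l\<in>E. norm (\<sigma> *\<^sub>R A (sum_list l)) \<le> 2 * K + e" using l(1) by (auto simp: mult.commute)
  qed (use n in auto)
  have "1 / real n \<le> 1 / \<sigma> powr (- p)"
    using n(1,3) s by (intro divide_left_mono) (auto intro!: mult_pos_pos)
  then have "1 / real n \<le> \<sigma> powr p" by (simp add: powr_minus_divide)
  then have "2 * K / real n \<le> 2 * K * \<sigma> powr p"
    using mult_left_mono[of "1 / real n" "\<sigma> powr p" "2 * K"] K(1) by simp
  then have "rho sX \<xi> \<sigma> A N \<le> ereal (2 * K * \<sigma> powr p)" using N(4) by (meson ereal_less_eq(3) order_trans)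
  then show ?thesis using that N by blast
qed

text \<open>
  The original norm serves for \<open>\<sigma> > 1\<close>.
\<close>
lemma rho_norm_le:
  assumes B: "\<And>z. norm (A z) \<le> B * norm z" "B \<ge> 0" and s: "\<sigma> > 0"
  shows "rho sX \<xi> \<sigma> A norm \<le> ereal (\<sigma> * B)"
proof (rule X.rho_leI)
  fix y :: 'y and E and d :: real assume y: "norm y \<le> 1" and E: "large_A E" and d: "d > 0"
  obtain z where z: "z \<in> E" "norm z \<le> 1"
    using null_family.Large_ball[OF X.null_family_meets E] by blast
  have "norm (A z) \<le> B" using B(1)[of z] mult_left_mono[OF z(2) B(2)] by simp
  then have "\<sigma> * norm (A z) \<le> \<sigma> * B" using s by (intro mult_left_mono) auto
  then have "norm (\<sigma> *\<^sub>R A z) \<le> \<sigma> * B" using s by simp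
  then have "norm (y + \<sigma> *\<^sub>R A z) \<le> 1 + \<sigma> * B + d"
    using norm_triangle_ineq[of y "\<sigma> *\<^sub>R A z"] y d by linarith
  then show "\<exists>z\<in>E. norm (y + \<sigma> *\<^sub>R A z) \<le> 1 + \<sigma> * B + d" using z(1) by blast
qed (use B s in simp)

lemma equivalent_norm_norm: "equivalent_norm sY norm"
  unfolding equivalent_norm_def
  by (intro conjI allI exI[of _ "1 :: real"]) (auto simp: Y.norm_scale norm_triangle_ineq)

lemma power_type:
  assumes p: "1 < p"
  shows "A \<in> N_class sX sY \<xi> (ereal p) \<longleftrightarrow>
       (\<exists>C\<ge>1. \<exists>b\<ge>1. \<forall>\<sigma>>0. \<exists>N. equivalent_norm sY N \<and>
          (\<lambda>y. inverse b *\<^sub>R y) ` unit_ball N \<subseteq> unit_ball norm \<and>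
          unit_ball norm \<subseteq> (\<lambda>y. b *\<^sub>R y) ` unit_ball N \<and>
          rho sX \<xi> \<sigma> A N \<le> ereal (C * \<sigma> powr p))" (is "_ \<longleftrightarrow> ?R")
proof -
  have "1 / ereal p = ereal (1 / p)" using p by (simp add: one_ereal_def)
  note cls = N_class_iff[OF this]
  show ?thesis
  proof
    assume "A \<in> N_class sX sY \<xi> (ereal p)"
    then obtain K where K: "K \<ge> 0" "\<And>n. n \<ge> 1 \<Longrightarrow> theta sX \<xi> n A \<le> ereal (K * real n powr (1 / p - 1))"
      using cls p by auto
    obtain B where B: "\<And>z. norm (A z) \<le> B * norm z" "B \<ge> 0"
    proof -
      have "bounded_linear A" using op by (simp add: operator_def)
      then show ?thesis using that bounded_linear.nonneg_bounded[of A] by (metis mult.commute)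
    qed
    define C b where "C = 1 + 2 * K + B" and "b = 2 * K + 1"
    have Cb: "C \<ge> 1" "b \<ge> 1" using K(1) B(2) by (auto simp: C_def b_def)
    have "\<exists>N. equivalent_norm sY N \<and>
          (\<lambda>y. inverse b *\<^sub>R y) ` unit_ball N \<subseteq> unit_ball norm \<and>
          unit_ball norm \<subseteq> (\<lambda>y. b *\<^sub>R y) ` unit_ball N \<and>
          rho sX \<xi> \<sigma> A N \<le> ereal (C * \<sigma> powr p)" if s: "\<sigma> > 0" for \<sigma>
    proof (cases "\<sigma> \<le> 1")
      case True
      obtain N where N: "equivalent_norm sY N" "\<And>y. norm y \<le> b * N y" "\<And>y. N y \<le> norm y"
        "rho sX \<xi> \<sigma> A N \<le> ereal (2 * K * \<sigma> powr p)"
        using renorming_small[OF p K s True] unfolding b_def by blast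
      have "2 * K * \<sigma> powr p \<le> C * \<sigma> powr p" using B(2) by (intro mult_right_mono) (auto simp: C_def)
      then have "rho sX \<xi> \<sigma> A N \<le> ereal (C * \<sigma> powr p)" using N(4) by (meson ereal_less_eq(3) order_trans)
      then show ?thesis using N(1) unit_ball_inclusions[OF Cb(2) N(2,3)] by blast
    next
      case False
      have "\<sigma> * B \<le> \<sigma> powr p * C"
        using False p K(1) B(2) powr_mono[of 1 p \<sigma>] by (intro mult_mono) (auto simp: C_def)
      then have "rho sX \<xi> \<sigma> A norm \<le> ereal (C * \<sigma> powr p)"
        using rho_norm_le[OF B s] by (metis ereal_less_eq(3) mult.commute order_trans)
      moreover have "norm y \<le> b * norm y" for y :: 'y
        using mult_right_mono[OF Cb(2), of "norm y"] by simp
      ultimately show ?thesis using equivalent_norm_norm unit_ball_inclusions[OF Cb(2), of norm] by blast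
    qed
    then show ?R using Cb by blast
  next
    assume ?R
    then obtain C b where Cb: "C \<ge> 1" "b \<ge> 1" and R: "\<And>\<sigma>. \<sigma> > 0 \<Longrightarrow> \<exists>N. equivalent_norm sY N \<and>
          (\<lambda>y. inverse b *\<^sub>R y) ` unit_ball N \<subseteq> unit_ball norm \<and>
          unit_ball norm \<subseteq> (\<lambda>y. b *\<^sub>R y) ` unit_ball N \<and>
          rho sX \<xi> \<sigma> A N \<le> ereal (C * \<sigma> powr p)" by blast
    have "theta sX \<xi> n A \<le> ereal (b * (1 + C) * real n powr (1 / p - 1))" if n: "n \<ge> 1" for n
    proof -
      \<comment> \<open>for this \<open>\<sigma>\<close> the increments of \<open>n\<close> steps sum up to \<open>n C \<sigma>\<^sup>p = C\<close>\<close>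
      define \<sigma> where "\<sigma> = real n powr (- (1 / p))"
      have s: "\<sigma> > 0" using n by (simp add: \<sigma>_def)
      have "\<sigma> powr p = real n powr (- 1)" using p by (simp add: \<sigma>_def powr_powr)
      then have sp: "real n * (C * \<sigma> powr p) = C" using n by (simp add: powr_minus)
      obtain N where N: "equivalent_norm sY N" "(\<lambda>y. inverse b *\<^sub>R y) ` unit_ball N \<subseteq> unit_ball norm"
        "rho sX \<xi> \<sigma> A N \<le> ereal (C * \<sigma> powr p)" using R[OF s] by blast
      have "theta sX \<xi> n A \<le> ereal (b * (1 + real n * (C * \<sigma> powr p)) / (\<sigma> * real n))"
        by (rule theta_le_of_rho[OF N(1) Cb(2) norm_le_of_inclusion[OF N(1) Cb(2) N(2)] s _ N(3) n])
          (use Cb in simp)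
      also have "b * (1 + real n * (C * \<sigma> powr p)) / (\<sigma> * real n) = b * (1 + C) * real n powr (1 / p - 1)"
        unfolding sp using n by (simp add: \<sigma>_def powr_minus powr_diff field_simps)
      finally show ?thesis .
    qed
    moreover have "b * (1 + C) \<ge> 0" using Cb by simp
    ultimately show "A \<in> N_class sX sY \<xi> (ereal p)" using cls p by auto
  qed
qed

lemma flat_type:
  shows "A \<in> N_class sX sY \<xi> \<infinity> \<longleftrightarrow>
       (\<exists>b\<ge>1. \<exists>\<sigma>>0. \<forall>\<epsilon>>0. \<exists>N. equivalent_norm sY N \<and>
          (\<lambda>y. inverse b *\<^sub>R y) ` unit_ball N \<subseteq> unit_ball norm \<and>
          unit_ball norm \<subseteq> (\<lambda>y. b *\<^sub>R y) ` unit_ball N \<and>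
          rho sX \<xi> \<sigma> A N \<le> ereal \<epsilon>)" (is "_ \<longleftrightarrow> ?R")
proof -
  have "1 / (\<infinity> :: ereal) = ereal 0" by simp
  note cls = N_class_iff[OF this]
  show ?thesis
  proof
    assume "A \<in> N_class sX sY \<xi> \<infinity>"
    then obtain K where K: "K \<ge> 0" "\<And>n. n \<ge> 1 \<Longrightarrow> theta sX \<xi> n A \<le> ereal (K * real n powr (0 - 1))"
      using cls by auto
    have b: "K + 1 \<ge> 1" using K(1) by simp
    have "\<exists>N. equivalent_norm sY N \<and>
          (\<lambda>y. inverse (K + 1) *\<^sub>R y) ` unit_ball N \<subseteq> unit_ball norm \<and>
          unit_ball norm \<subseteq> (\<lambda>y. (K + 1) *\<^sub>R y) ` unit_ball N \<and>
          rho sX \<xi> 1 A N \<le> ereal \<epsilon>" if e: "\<epsilon> > 0" for \<epsilon>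
    proof -
      define n where "n = nat \<lceil>K / \<epsilon>\<rceil> + 1"
      have n: "n \<ge> 1" "K / \<epsilon> \<le> real n" unfolding n_def by linarith+
      obtain N where N: "equivalent_norm sY N" "\<And>y. norm y \<le> (K + 1) * N y" "\<And>y. N y \<le> norm y"
        "rho sX \<xi> 1 A N \<le> ereal (K / real n)"
      proof (rule exists_renorming[OF n(1), of 1 K])
        fix k E and d :: real assume k: "k \<le> n" and E: "nest large_A k E" and d: "d > 0"
        from nest_bound_of_theta[OF K order_refl E k d] n
        show "\<exists>l\<in>E. norm (1 *\<^sub>R A (sum_list l)) \<le> K + d" by simp
      qed blast
      have "K / real n \<le> \<epsilon>" using n e by (simp add: field_simps)
      then have "rho sX \<xi> 1 A N \<le> ereal \<epsilon>" using N(4) by (meson ereal_less_eq(3) order_trans)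
      then show ?thesis using N(1) unit_ball_inclusions[OF b N(2,3)] by blast
    qed
    then show ?R using b zero_less_one by blast
  next
    assume ?R
    then obtain b \<sigma> where b: "b \<ge> 1" and s: "\<sigma> > 0" and R: "\<And>\<epsilon>. \<epsilon> > 0 \<Longrightarrow> \<exists>N. equivalent_norm sY N \<and>
          (\<lambda>y. inverse b *\<^sub>R y) ` unit_ball N \<subseteq> unit_ball norm \<and>
          unit_ball norm \<subseteq> (\<lambda>y. b *\<^sub>R y) ` unit_ball N \<and>
          rho sX \<xi> \<sigma> A N \<le> ereal \<epsilon>" by blast
    have "theta sX \<xi> n A \<le> ereal (2 * b / \<sigma> * real n powr (0 - 1))" if n: "n \<ge> 1" for n
    proof -
      have "1 / real n > 0" using n by simp
      from R[OF this] obtain N where N: "equivalent_norm sY N"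
        "(\<lambda>y. inverse b *\<^sub>R y) ` unit_ball N \<subseteq> unit_ball norm"
        "rho sX \<xi> \<sigma> A N \<le> ereal (1 / real n)" by blast
      have "theta sX \<xi> n A \<le> ereal (b * (1 + real n * (1 / real n)) / (\<sigma> * real n))"
        by (rule theta_le_of_rho[OF N(1) b norm_le_of_inclusion[OF N(1) b N(2)] s _ N(3) n]) simp
      also have "b * (1 + real n * (1 / real n)) / (\<sigma> * real n) = 2 * b / \<sigma> * real n powr (0 - 1)"
        using n by (simp add: powr_minus field_simps)
      finally show ?thesis .
    qed
    moreover have "2 * b / \<sigma> \<ge> 0" using b s by simp
    ultimately show "A \<in> N_class sX sY \<xi> \<infinity>" using cls by auto
  qed
qed

end

theorem theorem1p2:
  fixes sX :: "'k::real_or_complex \<Rightarrow> 'x::banach \<Rightarrow> 'x"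
    and sY :: "'k \<Rightarrow> 'y::banach \<Rightarrow> 'y"
    and A :: "'x \<Rightarrow> 'y"
    and \<xi> :: "'o ordinal"
    and p :: real
  assumes "banach_over sX" and "banach_over sY"
    and "1 < p"
    and "operator sX sY A"
  shows "(A \<in> N_class sX sY \<xi> (ereal p) \<longleftrightarrow>
       (\<exists>C\<ge>1. \<exists>b\<ge>1. \<forall>\<sigma>>0. \<exists>N. equivalent_norm sY N \<and>
          (\<lambda>y. inverse b *\<^sub>R y) ` unit_ball N \<subseteq> unit_ball norm \<and>
          unit_ball norm \<subseteq> (\<lambda>y. b *\<^sub>R y) ` unit_ball N \<and>
          rho sX \<xi> \<sigma> A N \<le> ereal (C * \<sigma> powr p)))
    \<and> (A \<in> N_class sX sY \<xi> \<infinity> \<longleftrightarrow>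
       (\<exists>b\<ge>1. \<exists>\<sigma>>0. \<forall>\<epsilon>>0. \<exists>N. equivalent_norm sY N \<and>
          (\<lambda>y. inverse b *\<^sub>R y) ` unit_ball N \<subseteq> unit_ball norm \<and>
          unit_ball norm \<subseteq> (\<lambda>y. b *\<^sub>R y) ` unit_ball N \<and>
          rho sX \<xi> \<sigma> A N \<le> ereal \<epsilon>))"
proof -
  interpret operator_setting sX sY A \<xi>
    using assms by (simp add: operator_setting_def operator_setting_axioms_def)
  show ?thesis using power_type[OF assms(3)] flat_type by blast
qed

end
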